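(* Let $d\ge 1$ be an integer, $s>0$ with $d>2s$, and $T>0$. Let $a,b,u_0,u_1$ be (possibly irregular) functions or distributions on $\mathbb{R}^d$, with $a,b\ge 0$ in the sense that their approximating nets are non-negative. Assume that there exist $(L^{d/s}(\mathbb{R}^d)\cap L^{d/(2s)}(\mathbb{R}^d))$-, $L^{d/s}(\mathbb{R}^d)$-, $H^{2s}(\mathbb{R}^d)$- and $H^s(\mathbb{R}^d)$-moderate approximations of $a$, $b$, $u_0$ and $u_1$, respectively, those of $a$ and $b$ being non-negative. Then the very weak solution to the Cauchy problem $$u_{tt}(t,x)+(-\Delta)^s u(t,x)+a(x)u(t,x)+b(x)u_t(t,x)=0,\ (t,x)\in[0,T]\times\mathbb{R}^d,\qquad u(0,x)=u_0(x),\ u_t(0,x)=u_1(x),\ x\in\mathbb{R}^d,$$ is unique, in the following sense. For all non-negative $(L^{d/s}(\mathbb{R}^d)\cap L^{d/(2s)}(\mathbb{R}^d))$-moderate approximations $(a_\varepsilon)_\varepsilon,(\tilde a_\varepsilon)_\varepsilon$ of $a$, all non-negative $L^{d/s}(\mathbb{R}^d)$-moderate approximations $(b_\varepsilon)_\varepsilon,(\tilde b_\varepsilon)_\varepsilon$ of $b$, all $H^{2s}(\mathbb{R}^d)$-moderate approximations $(u_{0,\varepsilon})_\varepsilon,(\tilde u_{0,\varepsilon})_\varepsilon$ of $u_0$ and all $H^s(\mathbb{R}^d)$-moderate approximations $(u_{1,\varepsilon})_\varepsilon,(\tilde u_{1,\varepsilon})_\varepsilon$ of $u_1$ such that the nets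 $(a_\varepsilon-\tilde a_\varepsilon)_\varepsilon$, $(b_\varepsilon-\tilde b_\varepsilon)_\varepsilon$, $(u_{0,\varepsilon}-\tilde u_{0,\varepsilon})_\varepsilon$, $(u_{1,\varepsilon}-\tilde u_{1,\varepsilon})_\varepsilon$ are $(L^{d/s}(\mathbb{R}^d)\cap L^{d/(2s)}(\mathbb{R}^d))$-, $L^{d/s}(\mathbb{R}^d)$-, $H^{2s}(\mathbb{R}^d)$-, $H^s(\mathbb{R}^d)$-negligible, respectively, the net $(u_\varepsilon(t,\cdot)-\tilde u_\varepsilon(t,\cdot))_{\varepsilon\in(0,1]}$ is $L^2(\mathbb{R}^d)$-negligible for all $t\in[0,T]$, where, for each $\varepsilon\in(0,1]$, $u_\varepsilon$ and $\tilde u_\varepsilon$ are the solutions in $C([0,T];H^{2s}(\mathbb{R}^d))\cap C^1([0,T];H^s(\mathbb{R}^d))$ of $$\partial_t^2u_\varepsilon+(-\Delta)^su_\varepsilon+a_\varepsilon u_\varepsilon+b_\varepsilon\partial_tu_\varepsilon=0,\quad u_\varepsilon(0,\cdot)=u_{0,\varepsilon},\ \partial_tu_\varepsilon(0,\cdot)=u_{1,\varepsilon},$$ $$\partial_t^2\tilde u_\varepsilon+(-\Delta)^s\tilde u_\varepsilon+\tilde a_\varepsilon \tilde u_\varepsilon+\tilde b_\varepsilon\partial_t\tilde u_\varepsilon=0,\quad \tilde u_\varepsilon(0,\cdot)=\tilde u_{0,\varepsilon},\ \partial_t\tilde u_\varepsilon(0,\cdot)=\tilde u_{1,\varepsilon},$$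 on $[0,T]\times\mathbb{R}^d$.
   Context: The fractional Laplacian is $(-\Delta)^s f=\mathcal{F}^{-1}(|\xi|^{2s}\widehat f)$, and for $\sigma>0$, $H^\sigma(\mathbb{R}^d)=\{f\in L^2(\mathbb{R}^d): (-\Delta)^{\sigma/2}f\in L^2(\mathbb{R}^d)\}$ with norm $\|f\|_{H^\sigma}=\|f\|_{L^2}+\|(-\Delta)^{\sigma/2}f\|_{L^2}$. An intersection of two $L^p$ spaces carries the sum of the two norms. An approximation of a function or distribution $f$ on $\mathbb{R}^d$ is a net $(f_\varepsilon)_{\varepsilon\in(0,1]}$ of smooth functions approximating $f$, not necessarily obtained by convolution with a mollifier (no particular mode of convergence is prescribed). For a normed space $X$ of functions on $\mathbb{R}^d$, a net $(f_\varepsilon)_{\varepsilon\in(0,1]}$ of elements of $X$ is $X$-moderate if there exist $N\in\mathbb{N}_0$ and $C>0$ with $\|f_\varepsilon\|_X\le C\varepsilon^{-N}$ for all $\varepsilon\in(0,1]$; it is $X$-negligible if for every $k>0$ there exists $C_k>0$ with $\|f_\varepsilon\|_X\le C_k\varepsilon^{k}$ for all $\varepsilon\in(0,1]$. A very weak solution is here a net $(u_\varepsilon)_\varepsilon$ in $C([0,T];H^{2s}(\mathbb{R}^d))\cap C^1([0,T];H^s(\mathbb{R}^d))$ solving, for each $\varepsilon\in(0,1]$, the approximating Cauchy problem built from such moderate approximations of the coefficients (non-negative) and data, and such that $\sup_{t\in[0,T]}\big(\|u_\varepsilon(t,\cdot)\|_{L^2}+\|(-\Delta)^{s/2}u_\varepsilon(t,\cdot)\|_{L^2}+\|(-\Delta)^{s}u_\varepsilon(t,\cdot)\|_{L^2}+\|\partial_tu_\varepsilon(t,\cdot)\|_{L^2}\big)\le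 C\varepsilon^{-N}$ for some $N\in\mathbb{N}_0$, $C>0$ and all $\varepsilon\in(0,1]$. The approximating equations are understood in the sense of distributions on $(0,T)\times\mathbb{R}^d$. *)

theory Defs
  imports "HOL-Analysis.Analysis"
begin

section \<open>Function spaces with their norms\<close>

text \<open>Functions are not identified almost everywhere: a space is a set of Borel representatives,
  and its norm is a seminorm on that set. Norms are meaningful on the elements of the space only.\<close>

datatype 'a fspace =
  FSpace (elems: "('a \<Rightarrow> complex) set") (fnorm: "('a \<Rightarrow> complex) \<Rightarrow> real")

definition Lp :: "real \<Rightarrow> 'a::euclidean_space fspace" where
  "Lp p = FSpace
     {f. f \<in> borel_measurable lborel \<and> integrable lborel (\<lambda>x. norm (f x) powr p)}
     (\<lambda>f. (\<integral>x. norm (f x) powr p \<partial>lborel) powr (1 / p))"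

definition inter_space :: "'a fspace \<Rightarrow> 'a fspace \<Rightarrow> 'a fspace" where
  "inter_space X Y = FSpace (elems X \<inter> elems Y) (\<lambda>f. fnorm X f + fnorm Y f)"


section \<open>Fourier transform and fractional Laplacian\<close>

definition trunc_fourier :: "real \<Rightarrow> ('a::euclidean_space \<Rightarrow> complex) \<Rightarrow> 'a \<Rightarrow> complex" where
  "trunc_fourier R f \<xi> = (LINT x:cball 0 R|lborel. cis (- (x \<bullet> \<xi>)) * f x)"

text \<open>\<open>F\<close> is (a representative of) the Plancherel transform of \<open>f\<close>: the limit in \<open>L\<^sup>2\<close>
  of the truncated Fourier integrals. The distance is a nonnegative extended integral, so a
  non-square-integrable difference has distance infinity rather than zero.\<close>

definition is_fourier ::
  "('a::euclidean_space \<Rightarrow> complex) \<Rightarrow> ('a \<Rightarrow> complex) \<Rightarrow> bool" where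
  "is_fourier f F \<longleftrightarrow> f \<in> elems (Lp 2) \<and> F \<in> elems (Lp 2) \<and>
     ((\<lambda>R. \<integral>\<^sup>+\<xi>. ennreal ((norm (trunc_fourier R f \<xi> - F \<xi>))\<^sup>2) \<partial>lborel) \<longlongrightarrow> 0) at_top"

text \<open>\<open>g\<close> is a square-integrable representative of the inverse Fourier transform of
  \<open>|\<xi>|\<^sup>2\<^sup>s F\<close>, where \<open>F\<close> is the Fourier transform of \<open>f\<close>; the inverse transform is the
  inverse of the Plancherel map, so no normalisation constant appears.\<close>

definition is_frac_laplacian ::
  "real \<Rightarrow> ('a::euclidean_space \<Rightarrow> complex) \<Rightarrow> ('a \<Rightarrow> complex) \<Rightarrow> bool" where
  "is_frac_laplacian s f g \<longleftrightarrow>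
     (\<exists>F. is_fourier f F \<and> is_fourier g (\<lambda>\<xi>. of_real (norm \<xi> powr (2 * s)) * F \<xi>))"

text \<open>A representative, meaningful only if the fractional Laplacian of \<open>f\<close> is in \<open>L\<^sup>2\<close>.\<close>

definition frac_laplacian ::
  "real \<Rightarrow> ('a::euclidean_space \<Rightarrow> complex) \<Rightarrow> 'a \<Rightarrow> complex" where
  "frac_laplacian s f = (SOME g. is_frac_laplacian s f g)"

definition Hs :: "real \<Rightarrow> 'a::euclidean_space fspace" where
  "Hs \<sigma> = FSpace
     {f. f \<in> elems (Lp 2) \<and> (\<exists>g \<in> elems (Lp 2). is_frac_laplacian (\<sigma> / 2) f g)}
     (\<lambda>f. fnorm (Lp 2) f + fnorm (Lp 2) (frac_laplacian (\<sigma> / 2) f))"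


section \<open>Smooth functions, test functions and distributions\<close>

fun dir_derivs ::
  "'a::real_normed_vector list \<Rightarrow> ('a \<Rightarrow> 'b::real_normed_vector) \<Rightarrow> 'a \<Rightarrow> 'b" where
  "dir_derivs [] f = f"
| "dir_derivs (v # vs) f = (\<lambda>x. frechet_derivative (dir_derivs vs f) (at x) v)"

definition smooth :: "('a::euclidean_space \<Rightarrow> complex) \<Rightarrow> bool" where
  "smooth f \<longleftrightarrow> (\<forall>vs x. dir_derivs vs f differentiable (at x))"

definition supp :: "('a::topological_space \<Rightarrow> complex) \<Rightarrow> 'a set" where
  "supp f = closure {x. f x \<noteq> 0}"

definition test_function :: "'a::euclidean_space set \<Rightarrow> ('a \<Rightarrow> complex) \<Rightarrow> bool" where
  "test_function \<Omega> \<phi> \<longleftrightarrow> smooth \<phi> \<and> compact (supp \<phi>) \<and> supp \<phi> \<subseteq> \<Omega>"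

text \<open>Continuity is the usual estimate on each compact set \<open>K\<close> by the sup norms of the partial
  derivatives up to some order \<open>N\<close>. Functionals are set to zero off the test functions, so that
  equal distributions are equal elements of the type.\<close>

definition is_distribution :: "(('a::euclidean_space \<Rightarrow> complex) \<Rightarrow> complex) \<Rightarrow> bool" where
  "is_distribution L \<longleftrightarrow>
     (\<forall>\<phi>. \<not> test_function UNIV \<phi> \<longrightarrow> L \<phi> = 0) \<and>
     (\<forall>\<phi> \<psi>. test_function UNIV \<phi> \<longrightarrow> test_function UNIV \<psi> \<longrightarrow>
        L (\<lambda>x. \<phi> x + \<psi> x) = L \<phi> + L \<psi>) \<and>
     (\<forall>c \<phi>. test_function UNIV \<phi> \<longrightarrow> L (\<lambda>x. c * \<phi> x) = c * L \<phi>) \<and>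
     (\<forall>K. compact K \<longrightarrow> (\<exists>C N. \<forall>\<phi> B. test_function K \<phi> \<longrightarrow>
        (\<forall>vs x. set vs \<subseteq> Basis \<longrightarrow> length vs \<le> N \<longrightarrow> norm (dir_derivs vs \<phi> x) \<le> B) \<longrightarrow>
        norm (L \<phi>) \<le> C * B))"

typedef (overloaded) 'a distribution =
  "{L :: ('a::euclidean_space \<Rightarrow> complex) \<Rightarrow> complex. is_distribution L}"
proof
  show "(\<lambda>_. 0) \<in> {L :: ('a \<Rightarrow> complex) \<Rightarrow> complex. is_distribution L}"
    by (auto simp: is_distribution_def intro!: exI[of _ 0])
qed

type_synonym 'a fun_or_distr = "('a \<Rightarrow> complex) + 'a distribution"


section \<open>Nets\<close>

type_synonym 'a net = "real \<Rightarrow> 'a \<Rightarrow> complex"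

text \<open>The relation \<open>conv\<close> is the mode of convergence: \<open>conv f_net f\<close> says that the net approximates
  \<open>f\<close>. It is a parameter, since no particular mode is prescribed. If different objects are to be
  approximated in different modes, take \<open>conv\<close> to be the disjunction of these modes.\<close>

definition approximation ::
  "('a net \<Rightarrow> 'a fun_or_distr \<Rightarrow> bool) \<Rightarrow> 'a::euclidean_space fun_or_distr \<Rightarrow> 'a net \<Rightarrow> bool" where
  "approximation conv f f_net \<longleftrightarrow> (\<forall>\<epsilon>\<in>{0<..1}. smooth (f_net \<epsilon>)) \<and> conv f_net f"

definition nonneg_net :: "'a net \<Rightarrow> bool" where
  "nonneg_net f \<longleftrightarrow> (\<forall>\<epsilon>\<in>{0<..1}. \<forall>x. f \<epsilon> x \<in> \<real>\<^sub>\<ge>\<^sub>0)"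

definition moderate :: "'a fspace \<Rightarrow> 'a net \<Rightarrow> bool" where
  "moderate X f \<longleftrightarrow> (\<forall>\<epsilon>\<in>{0<..1}. f \<epsilon> \<in> elems X) \<and>
     (\<exists>N::nat. \<exists>C>0. \<forall>\<epsilon>\<in>{0<..1}. fnorm X (f \<epsilon>) \<le> C / \<epsilon> ^ N)"

definition negligible_net :: "'a fspace \<Rightarrow> 'a net \<Rightarrow> bool" where
  "negligible_net X f \<longleftrightarrow> (\<forall>\<epsilon>\<in>{0<..1}. f \<epsilon> \<in> elems X) \<and>
     (\<forall>k>0. \<exists>C>0. \<forall>\<epsilon>\<in>{0<..1}. fnorm X (f \<epsilon>) \<le> C * \<epsilon> powr k)"


section \<open>The Cauchy problem\<close>

definition continuous_into ::
  "'a fspace \<Rightarrow> real \<Rightarrow> (real \<Rightarrow> 'a \<Rightarrow> complex) \<Rightarrow> bool" where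
  "continuous_into X T u \<longleftrightarrow> (\<forall>t\<in>{0..T}. u t \<in> elems X \<and>
     ((\<lambda>\<tau>. fnorm X (\<lambda>x. u \<tau> x - u t x)) \<longlongrightarrow> 0) (at t within {0..T}))"

text \<open>\<open>u\<close> is in \<open>C\<^sup>1([0,T];X)\<close> with time derivative \<open>v\<close>, one-sided at the end points.\<close>

definition C1_into_with_deriv ::
  "'a fspace \<Rightarrow> real \<Rightarrow> (real \<Rightarrow> 'a \<Rightarrow> complex) \<Rightarrow> (real \<Rightarrow> 'a \<Rightarrow> complex) \<Rightarrow> bool" where
  "C1_into_with_deriv X T u v \<longleftrightarrow>
     (\<forall>t\<in>{0..T}. u t \<in> elems X) \<and> continuous_into X T v \<and>
     (\<forall>t\<in>{0..T}. ((\<lambda>\<tau>. fnorm X (\<lambda>x. (u \<tau> x - u t x) / of_real (\<tau> - t) - v t x)) \<longlongrightarrow> 0)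
        (at t within {0..T}))"

text \<open>The equation \<open>u\<^sub>t\<^sub>t + (-\<Delta>)\<^sup>s u + a u + b u\<^sub>t = 0\<close> in the sense of distributions on
  \<open>(0,T) \<times> \<real>\<^sup>d\<close>, where \<open>v\<close> is the time derivative of \<open>u\<close>. Curves in function spaces are paired
  with test functions by iterated integrals, as the inner integral depends only on the class of
  \<open>u t\<close>, whereas arbitrary representatives need not be jointly measurable.\<close>

definition wave_equation ::
  "real \<Rightarrow> real \<Rightarrow> ('a::euclidean_space \<Rightarrow> complex) \<Rightarrow> ('a \<Rightarrow> complex) \<Rightarrow>
   (real \<Rightarrow> 'a \<Rightarrow> complex) \<Rightarrow> (real \<Rightarrow> 'a \<Rightarrow> complex) \<Rightarrow> bool" where
  "wave_equation s T a b u v \<longleftrightarrow>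
     (\<forall>\<phi> :: real \<times> 'a \<Rightarrow> complex. test_function ({0<..<T} \<times> UNIV) \<phi> \<longrightarrow>
       (LINT t:{0<..<T}|lborel. (\<integral>x.
            u t x * dir_derivs [(1, 0), (1, 0)] \<phi> (t, x)
          + (frac_laplacian s (u t) x + a x * u t x + b x * v t x) * \<phi> (t, x) \<partial>lborel)) = 0)"

definition cauchy_solution ::
  "real \<Rightarrow> real \<Rightarrow> ('a::euclidean_space \<Rightarrow> complex) \<Rightarrow> ('a \<Rightarrow> complex) \<Rightarrow>
   ('a \<Rightarrow> complex) \<Rightarrow> ('a \<Rightarrow> complex) \<Rightarrow> (real \<Rightarrow> 'a \<Rightarrow> complex) \<Rightarrow> bool" where
  "cauchy_solution s T a b u0 u1 u \<longleftrightarrow>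
     continuous_into (Hs (2 * s)) T u \<and>
     (\<exists>v. C1_into_with_deriv (Hs s) T u v \<and>
          wave_equation s T a b u v \<and>
          (AE x in lborel. u 0 x = u0 x) \<and>
          (AE x in lborel. v 0 x = u1 x))"

end

theory Submission
  imports Defs "HOL-Probability.Characteristic_Functions"
begin

text \<open>
  Fix the parameter of the nets and let \<open>u\<close>, \<open>u'\<close> be the solutions for \<open>(a, b, u0, u1)\<close> and \<open>(a', b', u0', u1')\<close>. Their
  difference \<open>w\<close> solves the equation with coefficients \<open>a\<close>, \<open>b\<close> and right-hand side
  \<open>f = - ((a - a') u' + (b - b') u'\<^sub>t)\<close>. Since \<open>a\<close> and \<open>b\<close> are nonnegative, the square root of the energy
  \<open>E = \<parallel>w\<^sub>t\<parallel>\<^sup>2 + \<parallel>(-\<Delta>) powr (s/2) w\<parallel>\<^sup>2 + \<integral> a |w|\<^sup>2\<close> has at most the slope \<open>\<parallel>f\<parallel>\<close> (\<open>energy_estimate\<close>). So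
  \<open>w\<close> is negligible if its data and \<open>f\<close> are.

  Two facts make \<open>f\<close> negligible. First, multiplication by a function in the Lebesgue space with exponent \<open>d / s\<close> maps the
  homogeneous Sobolev space of order \<open>s\<close> to \<open>L\<^sup>2\<close>, by Hoelder's inequality and the critical Sobolev inequality
  (\<open>sobolev_inequality\<close>, \<open>sobolev_const_exists\<close>). Secondly, \<open>u'\<close> and \<open>u'\<^sub>t\<close> are moderate in that Sobolev space. For \<open>u'\<close>
  this is again the energy estimate. For \<open>u'\<^sub>t\<close> it is the energy estimate for the equation differentiated in time, which
  has the same form as the coefficients do not depend on time; it is justified by difference quotients
  (\<open>time_derivative_estimate\<close>), and the second time derivative at time zero is read off from the equation. Altogether
  \<open>\<parallel>w\<parallel>\<close> is bounded by a polynomial in moderate quantities each term of which has a negligible factor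
  (\<open>stability_estimate\<close>).

  The equation holds only in the sense of distributions. Testing it with products of a function of time and a function of space
  gives scalar differential equations; the lemma of du Bois-Reymond and the density of test functions in \<open>L\<^sup>2\<close> show that
  \<open>u\<^sub>t\<close> is differentiable in time with values in \<open>L\<^sup>2\<close> and that the equation holds at every time
  (\<open>L2_derivative_of_weak_equation\<close>, \<open>cauchy_solution_wave_curve\<close>).

  The Fourier side rests on the Plancherel theorem, which is obtained from Gaussian regularisation
  (\<open>gauss_smoothed_plancherel\<close>, \<open>plancherel\<close>). The Sobolev inequality follows from it by cutting the frequencies of a
  function at a height that depends on the level set that is estimated.
\<close>

section \<open>Square-integrable functions\<close>

abbreviation L2 :: "('a::euclidean_space \<Rightarrow> complex) set" where
  "L2 \<equiv> elems (Lp 2)"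

abbreviation L2norm :: "('a::euclidean_space \<Rightarrow> complex) \<Rightarrow> real" where
  "L2norm \<equiv> fnorm (Lp 2)"

definition L2inner :: "('a::euclidean_space \<Rightarrow> complex) \<Rightarrow> ('a \<Rightarrow> complex) \<Rightarrow> complex" where
  "L2inner f g = (\<integral>x. f x * cnj (g x) \<partial>lborel)"

lemma mem_L2: "f \<in> L2 \<longleftrightarrow> f \<in> borel_measurable borel \<and> integrable lborel (\<lambda>x. (cmod (f x))\<^sup>2)"
  by (simp add: Lp_def)

lemma L2_measurable [measurable_dest]: "f \<in> L2 \<Longrightarrow> f \<in> borel_measurable borel"
  by (simp add: mem_L2)

lemma L2norm_eq: "L2norm f = sqrt (\<integral>x. (cmod (f x))\<^sup>2 \<partial>lborel)"
  by (simp add: Lp_def powr_half_sqrt)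

lemma L2norm_nonneg [simp]: "0 \<le> L2norm f"
  by (simp add: L2norm_eq)

lemma L2norm_sq: "(L2norm f)\<^sup>2 = (\<integral>x. (cmod (f x))\<^sup>2 \<partial>lborel)"
  by (simp add: L2norm_eq)

lemma nn_integral_L2: 
  assumes "f \<in> L2" 
  shows "(\<integral>\<^sup>+x. ennreal ((cmod (f x))\<^sup>2) \<partial>lborel) = ennreal ((L2norm f)\<^sup>2)"
  using assms by (simp add: nn_integral_eq_integral mem_L2 L2norm_sq)

lemma L2_memI:
  assumes "f \<in> borel_measurable borel" "(\<integral>\<^sup>+x. ennreal ((cmod (f x))\<^sup>2) \<partial>lborel) < \<infinity>"
  shows "f \<in> L2"
  using assms by (simp add: mem_L2 integrable_iff_bounded)

lemma L2_norm_leI: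
  assumes "f \<in> borel_measurable borel" "(\<integral>\<^sup>+x. ennreal ((cmod (f x))\<^sup>2) \<partial>lborel) \<le> ennreal (M\<^sup>2)" "0 \<le> M"
  shows "f \<in> L2" "L2norm f \<le> M"
proof -
  show *: "f \<in> L2"
    using assms by (intro L2_memI) (auto simp: le_less_trans)
  show "L2norm f \<le> M"
    using assms nn_integral_L2[OF *] by (simp add: power_mono_iff)
qed

lemma L2_dominated:
  assumes "f \<in> borel_measurable borel" "g \<in> L2" "\<And>x. cmod (f x) \<le> cmod (g x)"
  shows "f \<in> L2" "L2norm f \<le> L2norm g"
proof -
  have "(\<integral>\<^sup>+x. ennreal ((cmod (f x))\<^sup>2) \<partial>lborel) \<le> (\<integral>\<^sup>+x. ennreal ((cmod (g x))\<^sup>2) \<partial>lborel)"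
    using assms(3) by (intro nn_integral_mono ennreal_leI power_mono) auto
  then show "f \<in> L2" "L2norm f \<le> L2norm g"
    using L2_norm_leI[of f "L2norm g"] assms nn_integral_L2[of g] by auto
qed

lemma L2norm_cong_AE:
  assumes "f \<in> borel_measurable borel" "g \<in> borel_measurable borel" "AE x in lborel. f x = g x"
  shows "L2norm f = L2norm g"
  unfolding L2norm_eq using assms by (intro arg_cong[where f=sqrt] integral_cong_AE) auto

lemma L2norm_eq_0_AE:
  assumes "f \<in> L2" "L2norm f = 0"
  shows "AE x in lborel. f x = 0"
proof -
  have "(\<integral>x. (cmod (f x))\<^sup>2 \<partial>lborel) = 0"
    using assms L2norm_sq[of f] by simp
  then have "AE x in lborel. (cmod (f x))\<^sup>2 = 0"
    using assms by (subst (asm) integral_nonneg_eq_0_iff_AE) (auto simp: mem_L2)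
  then show ?thesis by simp
qed

lemma L2_zero [simp]: "(\<lambda>_. 0) \<in> L2" and L2norm_zero [simp]: "L2norm (\<lambda>_. 0) = 0"
  by (auto simp: mem_L2 L2norm_eq)

lemma L2_add [intro]:
  assumes "f \<in> L2" "g \<in> L2" shows "(\<lambda>x. f x + g x) \<in> L2"
proof -
  have "integrable lborel (\<lambda>x. (cmod (f x + g x))\<^sup>2)"
  proof (rule Bochner_Integration.integrable_bound)
    show "integrable lborel (\<lambda>x. 2 * (cmod (f x))\<^sup>2 + 2 * (cmod (g x))\<^sup>2)"
      using assms by (auto simp: mem_L2)
    show "AE x in lborel. norm ((cmod (f x + g x))\<^sup>2) \<le> norm (2 * (cmod (f x))\<^sup>2 + 2 * (cmod (g x))\<^sup>2)"
    proof (rule AE_I2)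
      fix x
      have "(cmod (f x + g x))\<^sup>2 \<le> (cmod (f x) + cmod (g x))\<^sup>2"
        by (intro power_mono norm_triangle_ineq) auto
      also have "\<dots> \<le> 2 * (cmod (f x))\<^sup>2 + 2 * (cmod (g x))\<^sup>2"
        using sum_squares_bound[of "cmod (f x)" "cmod (g x)"] by (simp add: power2_sum)
      finally show "norm ((cmod (f x + g x))\<^sup>2) \<le> norm (2 * (cmod (f x))\<^sup>2 + 2 * (cmod (g x))\<^sup>2)"
        by simp
    qed
  qed (use assms in \<open>auto simp: mem_L2\<close>)
  then show ?thesis using assms by (auto simp: mem_L2)
qed

lemma L2_mult_const [intro]: "f \<in> L2 \<Longrightarrow> (\<lambda>x. c * f x) \<in> L2"
  by (auto simp: mem_L2 norm_mult power_mult_distrib)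

lemma L2norm_mult_const: "L2norm (\<lambda>x. c * f x) = cmod c * L2norm f"
  by (simp add: L2norm_eq norm_mult power_mult_distrib real_sqrt_mult)

lemma L2_uminus [intro]: "f \<in> L2 \<Longrightarrow> (\<lambda>x. - f x) \<in> L2"
  by (auto simp: mem_L2)

lemma L2_diff [intro]: "f \<in> L2 \<Longrightarrow> g \<in> L2 \<Longrightarrow> (\<lambda>x. f x - g x) \<in> L2"
  using L2_add[OF _ L2_uminus, of f g] by simp

lemma L2_divide [intro]: "f \<in> L2 \<Longrightarrow> (\<lambda>x. f x / c) \<in> L2"
  using L2_mult_const[of f "1/c"] by simp

lemma L2norm_divide: "L2norm (\<lambda>x. f x / c) = L2norm f / cmod c"
  using L2norm_mult_const[of "1/c" f] by (simp add: norm_divide)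

lemma L2norm_uminus: "L2norm (\<lambda>x. - f x) = L2norm f"
  by (simp add: L2norm_eq)

lemma L2norm_minus_commute: "L2norm (\<lambda>x. f x - g x) = L2norm (\<lambda>x. g x - f x)"
  by (simp add: L2norm_eq norm_minus_commute)

lemma borel_measurable_cnj [measurable]: "cnj \<in> borel_measurable borel"
  by (intro borel_measurable_continuous_onI continuous_intros)

lemma L2_cnj [intro]: "f \<in> L2 \<Longrightarrow> (\<lambda>x. cnj (f x)) \<in> L2"
  using measurable_compose[OF _ borel_measurable_cnj, of f borel] by (simp add: mem_L2)

lemma L2norm_cnj [simp]: "L2norm (\<lambda>x. cnj (f x)) = L2norm f"
  by (simp add: L2norm_eq)

lemma L2_integrable_norm_mult:
  assumes "f \<in> L2" "g \<in> L2" shows "integrable lborel (\<lambda>x. cmod (f x) * cmod (g x))"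
proof (rule Bochner_Integration.integrable_bound)
  show "integrable lborel (\<lambda>x. (cmod (f x))\<^sup>2 + (cmod (g x))\<^sup>2)"
    using assms by (auto simp: mem_L2)
  show "AE x in lborel. norm (cmod (f x) * cmod (g x)) \<le> norm ((cmod (f x))\<^sup>2 + (cmod (g x))\<^sup>2)"
  proof (rule AE_I2)
    fix x
    show "norm (cmod (f x) * cmod (g x)) \<le> norm ((cmod (f x))\<^sup>2 + (cmod (g x))\<^sup>2)"
      using sum_squares_bound[of "cmod (f x)" "cmod (g x)"] mult_nonneg_nonneg[of "cmod (f x)" "cmod (g x)"]
        norm_ge_zero[of "f x"] norm_ge_zero[of "g x"]
      unfolding real_norm_def by linarith
  qed
qed (use assms in \<open>auto simp: mem_L2\<close>)

lemma L2_integrable_mult [intro]: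
  assumes "f \<in> L2" "g \<in> L2" shows "integrable lborel (\<lambda>x. f x * g x)"
  using L2_integrable_norm_mult[OF assms] assms
  by (intro Bochner_Integration.integrable_bound[OF L2_integrable_norm_mult[OF assms]])
     (auto simp: mem_L2 norm_mult)

lemma Cauchy_Schwarz_norm:
  assumes "f \<in> L2" "g \<in> L2" 
  shows "(\<integral>x. cmod (f x) * cmod (g x) \<partial>lborel) \<le> L2norm f * L2norm g"
proof -
  let ?F = "L2norm f" and ?G = "L2norm g" and ?I = "\<integral>x. cmod (f x) * cmod (g x) \<partial>lborel"
  have int: "integrable lborel (\<lambda>x. cmod (f x) * cmod (g x))" "integrable lborel (\<lambda>x. (cmod (f x))\<^sup>2)"
     "integrable lborel (\<lambda>x. (cmod (g x))\<^sup>2)"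
    using assms L2_integrable_norm_mult by (auto simp: mem_L2)
  show ?thesis
  proof (cases "?F = 0 \<or> ?G = 0")
    case True
    then have "AE x in lborel. cmod (f x) * cmod (g x) = 0"
      using L2norm_eq_0_AE[OF assms(1)] L2norm_eq_0_AE[OF assms(2)] by auto
    then have "?I = 0" by (rule integral_eq_zero_AE)
    then show ?thesis by simp
  next
    case False
    then have pos: "?F > 0" "?G > 0" using L2norm_nonneg[of f] L2norm_nonneg[of g] by linarith+
    have "0 \<le> (\<integral>x. (?G * cmod (f x) - ?F * cmod (g x))\<^sup>2 \<partial>lborel)"
      by (intro Bochner_Integration.integral_nonneg) auto
    also have "\<dots> = (\<integral>x. ?G\<^sup>2 * (cmod (f x))\<^sup>2 + ?F\<^sup>2 * (cmod (g x))\<^sup>2 - 2 * ?G * ?F * (cmod (f x) * cmod (g x)) \<partial>lborel)"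
      by (intro Bochner_Integration.integral_cong refl) (simp add: power2_eq_square algebra_simps)
    also have "\<dots> = ?G\<^sup>2 * ?F\<^sup>2 + ?F\<^sup>2 * ?G\<^sup>2 - 2 * ?G * ?F * ?I"
      using int by (simp add: L2norm_sq)
    finally have "(?G * ?F) * ?I \<le> (?G * ?F) * (?F * ?G)"
      by (simp add: power2_eq_square algebra_simps)
    then show ?thesis using pos by (simp add: mult_le_cancel_left_pos)
  qed
qed

lemma Cauchy_Schwarz_bilinear:
  assumes "f \<in> L2" "g \<in> L2" 
  shows "cmod (\<integral>x. f x * g x \<partial>lborel) \<le> L2norm f * L2norm g"
proof -
  have "cmod (\<integral>x. f x * g x \<partial>lborel) \<le> (\<integral>x. cmod (f x * g x) \<partial>lborel)"
    by (rule integral_norm_bound)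
  also have "\<dots> \<le> L2norm f * L2norm g" 
    using Cauchy_Schwarz_norm[OF assms] by (simp add: norm_mult)
  finally show ?thesis .
qed

lemma L2inner_bound:
  assumes "f \<in> L2" "g \<in> L2" shows "cmod (L2inner f g) \<le> L2norm f * L2norm g"
  using Cauchy_Schwarz_bilinear[OF assms(1) L2_cnj[OF assms(2)]] by (simp add: L2inner_def)

lemma L2inner_self: "f \<in> L2 \<Longrightarrow> L2inner f f = of_real ((L2norm f)\<^sup>2)"
  by (simp add: L2inner_def complex_norm_square[symmetric] L2norm_sq integral_complex_of_real
      flip: of_real_power)

lemma L2inner_add_left: 
  "f \<in> L2 \<Longrightarrow> g \<in> L2 \<Longrightarrow> h \<in> L2 \<Longrightarrow> L2inner (\<lambda>x. f x + g x) h = L2inner f h + L2inner g h"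
  by (auto simp: L2inner_def distrib_right intro!: Bochner_Integration.integral_add)

lemma L2inner_diff_left: 
  "f \<in> L2 \<Longrightarrow> g \<in> L2 \<Longrightarrow> h \<in> L2 \<Longrightarrow> L2inner (\<lambda>x. f x - g x) h = L2inner f h - L2inner g h"
  by (auto simp: L2inner_def left_diff_distrib intro!: Bochner_Integration.integral_diff)

lemma L2inner_mult_left: "L2inner (\<lambda>x. c * f x) h = c * L2inner f h"
  by (simp add: L2inner_def mult.assoc)

lemma L2inner_commute: "L2inner f g = cnj (L2inner g f)"
  unfolding L2inner_def by (subst Bochner_Integration.integral_cnj[symmetric]) (simp add: mult.commute)

lemma L2norm_add_sq:
  assumes "f \<in> L2" "g \<in> L2" 
  shows "(L2norm (\<lambda>x. f x + g x))\<^sup>2 = (L2norm f)\<^sup>2 + 2 * Re (L2inner f g) + (L2norm g)\<^sup>2"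
proof -
  have int: "integrable lborel (\<lambda>x. (cmod (f x))\<^sup>2)" "integrable lborel (\<lambda>x. (cmod (g x))\<^sup>2)"
    "integrable lborel (\<lambda>x. f x * cnj (g x))"
    using assms L2_integrable_mult[OF assms(1) L2_cnj[OF assms(2)]] by (simp_all add: mem_L2)
  define h where "h x = f x * cnj (g x)" for x
  have "(cmod (f x + g x))\<^sup>2 = (cmod (f x))\<^sup>2 + 2 * Re (h x) + (cmod (g x))\<^sup>2" for x
    unfolding cmod_power2 h_def by (simp add: power2_eq_square algebra_simps)
  then show ?thesis using int unfolding L2norm_sq L2inner_def h_def[symmetric] by simp
qed

lemma L2norm_triangle:
  assumes "f \<in> L2" "g \<in> L2" shows "L2norm (\<lambda>x. f x + g x) \<le> L2norm f + L2norm g"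
proof (rule power2_le_imp_le)
  show "(L2norm (\<lambda>x. f x + g x))\<^sup>2 \<le> (L2norm f + L2norm g)\<^sup>2"
    using L2inner_bound[OF assms] complex_Re_le_cmod[of "L2inner f g"]
    by (simp add: L2norm_add_sq assms power2_sum)
qed simp

lemma L2norm_triangle_diff:
  assumes "f \<in> L2" "g \<in> L2" shows "L2norm (\<lambda>x. f x - g x) \<le> L2norm f + L2norm g"
  using L2norm_triangle[OF assms(1) L2_uminus[OF assms(2)]] by (simp add: L2norm_uminus)

lemma L2norm_reverse_triangle:
  assumes "f \<in> L2" "g \<in> L2" shows "\<bar>L2norm f - L2norm g\<bar> \<le> L2norm (\<lambda>x. f x - g x)"
proof -
  have "L2norm (\<lambda>x. (f x - g x) + g x) \<le> L2norm (\<lambda>x. f x - g x) + L2norm g"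
    using assms by (intro L2norm_triangle) auto
  moreover have "L2norm (\<lambda>x. (g x - f x) + f x) \<le> L2norm (\<lambda>x. g x - f x) + L2norm f"
    using assms by (intro L2norm_triangle) auto
  ultimately show ?thesis by (simp add: L2norm_minus_commute[of g f])
qed

lemma L2norm_triangle3:
  assumes "f \<in> L2" "g \<in> L2" "h \<in> L2"
  shows "L2norm (\<lambda>x. f x - h x) \<le> L2norm (\<lambda>x. f x - g x) + L2norm (\<lambda>x. g x - h x)"
  using L2norm_triangle[of "\<lambda>x. f x - g x" "\<lambda>x. g x - h x"] assms by auto

lemma L2norm_tendsto:
  assumes "\<And>i. f i \<in> L2" "g \<in> L2" "((\<lambda>i. L2norm (\<lambda>x. f i x - g x)) \<longlongrightarrow> 0) F"
  shows "((\<lambda>i. L2norm (f i)) \<longlongrightarrow> L2norm g) F"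
proof (rule Lim_transform2[OF tendsto_const])
  show "((\<lambda>i. L2norm g - L2norm (f i)) \<longlongrightarrow> 0) F"
    by (rule Lim_null_comparison[OF _ assms(3)])
       (use L2norm_reverse_triangle[OF assms(1,2)] in \<open>auto simp: abs_minus_commute\<close>)
qed

lemma L2_dominated_convergence:
  fixes f :: "nat \<Rightarrow> 'a::euclidean_space \<Rightarrow> complex"
  assumes f: "\<And>n. f n \<in> borel_measurable borel" and g: "g \<in> borel_measurable borel" and h: "h \<in> L2"
    and lim: "AE x in lborel. (\<lambda>n. f n x) \<longlonglongrightarrow> g x" 
    and bd: "\<And>n x. cmod (f n x) \<le> cmod (h x)"
  shows "g \<in> L2" "(\<lambda>n. L2norm (\<lambda>x. f n x - g x)) \<longlonglongrightarrow> 0"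
proof -
  have gb: "AE x in lborel. cmod (g x) \<le> cmod (h x)"
    using lim
  proof eventually_elim
    case (elim x)
    show ?case
      by (rule LIMSEQ_le_const2[OF tendsto_norm[OF elim]]) (use bd in auto)
  qed
  have hi: "integrable lborel (\<lambda>x. (cmod (h x))\<^sup>2)" using h by (simp add: mem_L2)
  have "integrable lborel (\<lambda>x. (cmod (g x))\<^sup>2)"
    by (rule Bochner_Integration.integrable_bound[OF hi])
       (use gb g in \<open>auto intro: power_mono\<close>)
  then show g2: "g \<in> L2" using g by (simp add: mem_L2)
  have "(\<lambda>n. \<integral>x. (cmod (f n x - g x))\<^sup>2 \<partial>lborel) \<longlonglongrightarrow> integral\<^sup>L lborel (\<lambda>x::'a. 0::real)"
  proof (rule integral_dominated_convergence[where f = "\<lambda>x. 0" and s = "\<lambda>n x. (cmod (f n x - g x))\<^sup>2" and w = "\<lambda>x. 4 * (cmod (h x))\<^sup>2"])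
    show "AE x in lborel. (\<lambda>n. (cmod (f n x - g x))\<^sup>2) \<longlonglongrightarrow> 0"
      using lim by eventually_elim (auto intro!: tendsto_eq_intros simp: tendsto_norm_zero_iff LIM_zero_iff intro: LIM_zero)
    show "AE x in lborel. norm ((cmod (f n x - g x))\<^sup>2) \<le> 4 * (cmod (h x))\<^sup>2" for n
      using gb
    proof eventually_elim
      case (elim x)
      have "cmod (f n x - g x) \<le> 2 * cmod (h x)"
        using norm_triangle_ineq4[of "f n x" "g x"] bd[of n x] elim by linarith
      from power_mono[OF this, of 2] show ?case by (simp add: power_mult_distrib)
    qed
  qed (use f g hi in auto)
  then have "(\<lambda>n. sqrt (\<integral>x. (cmod (f n x - g x))\<^sup>2 \<partial>lborel)) \<longlonglongrightarrow> sqrt 0"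
    by (intro tendsto_real_sqrt) simp
  then show "(\<lambda>n. L2norm (\<lambda>x. f n x - g x)) \<longlonglongrightarrow> 0" by (simp add: L2norm_eq)
qed

text \<open>The squared norm is expanded around \<open>f t\<close>, so that a limit of difference quotients in norm is all
  that is needed. This one rule differentiates every term of the energy.\<close>

lemma L2norm_sq_has_derivative:
  assumes f: "\<And>\<tau>. \<tau> \<in> S \<Longrightarrow> f \<tau> \<in> L2" and "t \<in> S" and f': "f' \<in> L2"
    and lim: "((\<lambda>\<tau>. L2norm (\<lambda>x. (f \<tau> x - f t x) / of_real (\<tau> - t) - f' x)) \<longlongrightarrow> 0) (at t within S)"
  shows "((\<lambda>\<tau>. (L2norm (f \<tau>))\<^sup>2) has_real_derivative 2 * Re (L2inner f' (f t))) (at t within S)"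
proof -
  define D where "D \<tau> = (\<lambda>x. (f \<tau> x - f t x) / of_real (\<tau> - t))" for \<tau>
  have ft: "f t \<in> L2" using assms by auto
  have D: "D \<tau> \<in> L2" if "\<tau> \<in> S" for \<tau>
    unfolding D_def using f[OF that] ft by (intro L2_divide L2_diff)
  have lim: "((\<lambda>\<tau>. L2norm (\<lambda>x. D \<tau> x - f' x)) \<longlongrightarrow> 0) (at t within S)"
    using lim by (simp add: D_def)
  have evS: "eventually (\<lambda>\<tau>. \<tau> \<in> S \<and> \<tau> \<noteq> t) (at t within S)"
    by (auto simp: eventually_at_filter)
  have inner: "((\<lambda>\<tau>. L2inner (D \<tau>) (f t)) \<longlongrightarrow> L2inner f' (f t)) (at t within S)"
  proof (rule Lim_transform2[OF tendsto_const])
    show "((\<lambda>\<tau>. L2inner f' (f t) - L2inner (D \<tau>) (f t)) \<longlongrightarrow> 0) (at t within S)"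
    proof (rule Lim_null_comparison)
      show "((\<lambda>\<tau>. L2norm (\<lambda>x. D \<tau> x - f' x) * L2norm (f t)) \<longlongrightarrow> 0) (at t within S)"
        using tendsto_mult[OF lim tendsto_const[of "L2norm (f t)"]] by simp
      show "\<forall>\<^sub>F \<tau> in at t within S. cmod (L2inner f' (f t) - L2inner (D \<tau>) (f t)) \<le> L2norm (\<lambda>x. D \<tau> x - f' x) * L2norm (f t)"
        using evS
      proof eventually_elim
        case (elim \<tau>)
        then have "L2inner f' (f t) - L2inner (D \<tau>) (f t) = - L2inner (\<lambda>x. D \<tau> x - f' x) (f t)"
          using D f' ft by (subst L2inner_diff_left) auto
        then show ?case using elim D f' ft L2inner_bound[of "\<lambda>x. D \<tau> x - f' x" "f t"] by auto
      qed
    qed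
  qed
  have bd: "((\<lambda>\<tau>. L2norm (D \<tau>)) \<longlongrightarrow> L2norm f') (at t within S)"
  proof (rule Lim_transform2[OF tendsto_const])
    show "((\<lambda>\<tau>. L2norm f' - L2norm (D \<tau>)) \<longlongrightarrow> 0) (at t within S)"
    proof (rule Lim_null_comparison[OF _ lim])
      show "\<forall>\<^sub>F \<tau> in at t within S. norm (L2norm f' - L2norm (D \<tau>)) \<le> L2norm (\<lambda>x. D \<tau> x - f' x)"
        using evS by eventually_elim (use L2norm_reverse_triangle[OF D f'] in \<open>auto simp: abs_minus_commute\<close>)
    qed
  qed
  have "((\<lambda>\<tau>. 2 * Re (L2inner (D \<tau>) (f t)) + (\<tau> - t) * (L2norm (D \<tau>))\<^sup>2) \<longlongrightarrow> 
     2 * Re (L2inner f' (f t)) + (t - t) * (L2norm f')\<^sup>2) (at t within S)"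
    by (intro tendsto_intros inner bd)
  then have "((\<lambda>\<tau>. 2 * Re (L2inner (D \<tau>) (f t)) + (\<tau> - t) * (L2norm (D \<tau>))\<^sup>2) \<longlongrightarrow> 
     2 * Re (L2inner f' (f t))) (at t within S)" by simp
  then have "((\<lambda>\<tau>. ((L2norm (f \<tau>))\<^sup>2 - (L2norm (f t))\<^sup>2) / (\<tau> - t)) \<longlongrightarrow> 2 * Re (L2inner f' (f t))) (at t within S)"
  proof (rule Lim_transform_eventually)
    show "\<forall>\<^sub>F \<tau> in at t within S. 2 * Re (L2inner (D \<tau>) (f t)) + (\<tau> - t) * (L2norm (D \<tau>))\<^sup>2 = 
      ((L2norm (f \<tau>))\<^sup>2 - (L2norm (f t))\<^sup>2) / (\<tau> - t)"
      using evS
    proof eventually_elim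
      case (elim \<tau>)
      have eq: "f \<tau> = (\<lambda>x. of_real (\<tau> - t) * D \<tau> x + f t x)"
        using elim unfolding D_def by (auto simp: fun_eq_iff simp del: of_real_diff)
      have "(L2norm (f \<tau>))\<^sup>2 = (L2norm (\<lambda>x. of_real (\<tau> - t) * D \<tau> x))\<^sup>2 
         + 2 * Re (L2inner (\<lambda>x. of_real (\<tau> - t) * D \<tau> x) (f t)) + (L2norm (f t))\<^sup>2"
        by (subst eq, rule L2norm_add_sq) (use elim D ft in auto)
      then have "(L2norm (f \<tau>))\<^sup>2 - (L2norm (f t))\<^sup>2 = (\<tau> - t)\<^sup>2 * (L2norm (D \<tau>))\<^sup>2 + 2 * (\<tau> - t) * Re (L2inner (D \<tau>) (f t))"
        unfolding L2norm_mult_const L2inner_mult_left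
        by (simp add: power_mult_distrib del: of_real_diff)
      then show ?case using elim by (simp add: power2_eq_square field_simps)
    qed
  qed
  then show ?thesis by (simp add: has_field_derivative_iff)
qed

section \<open>Smooth functions and test functions\<close>

text \<open>Smoothness is a statement about all iterated directional derivatives. It follows by exhibiting a set of
  functions that is closed under directional derivatives, which avoids formulas for the iterated ones.\<close>

lemma smooth_coinduct:
  assumes "f \<in> S" 
    and step: "\<And>f. f \<in> S \<Longrightarrow> \<exists>f'. (\<forall>x. (f has_derivative f' x) (at x)) \<and> (\<forall>v. (\<lambda>x. f' x v) \<in> S)"
  shows "smooth f"
proof -
  have "dir_derivs vs f \<in> S" for vs
  proof (induction vs)
    case (Cons v vs)
    from step[OF Cons] obtain f' where f': "\<And>x. (dir_derivs vs f has_derivative f' x) (at x)" "\<And>v. (\<lambda>x. f' x v) \<in> S"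
      by auto
    have "frechet_derivative (dir_derivs vs f) (at x) = f' x" for x
      using frechet_derivative_at[OF f'(1)] by simp
    then show ?case using f'(2) by simp
  qed (use assms in simp)
  then show ?thesis
    unfolding smooth_def differentiable_def using step by meson
qed

text \<open>The recursion adds derivatives on the outside; iterating a first derivative needs it on the inside.\<close>

lemma dir_derivs_snoc: "dir_derivs (vs @ [v]) f = dir_derivs vs (\<lambda>x. frechet_derivative f (at x) v)"
  by (induction vs) auto

lemma smooth_step:
  assumes "smooth f"
  shows "(f has_derivative frechet_derivative f (at x)) (at x)" 
    and "smooth (\<lambda>x. frechet_derivative f (at x) v)"
proof -
  have "f differentiable (at x)"
    using assms unfolding smooth_def by (metis dir_derivs.simps(1))
  then show "(f has_derivative frechet_derivative f (at x)) (at x)"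
    by (simp add: frechet_derivative_works)
  show "smooth (\<lambda>x. frechet_derivative f (at x) v)"
    unfolding smooth_def
  proof (intro allI)
    fix vs x
    show "dir_derivs vs (\<lambda>x. frechet_derivative f (at x) v) differentiable at x"
      using assms unfolding smooth_def dir_derivs_snoc[symmetric] by blast
  qed
qed

lemma smooth_continuous: "smooth f \<Longrightarrow> continuous_on A f"
  by (intro continuous_at_imp_continuous_on ballI has_derivative_continuous[OF smooth_step(1)])

text \<open>By the Leibniz rule the algebra generated by the smooth functions is closed under directional derivatives,
  which is what the coinduction for sums and products needs.\<close>

inductive_set smooth_algebra :: "('a::euclidean_space \<Rightarrow> complex) set" where
  base: "smooth f \<Longrightarrow> f \<in> smooth_algebra"
| add: "f \<in> smooth_algebra \<Longrightarrow> g \<in> smooth_algebra \<Longrightarrow> (\<lambda>x. f x + g x) \<in> smooth_algebra"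
| mult: "f \<in> smooth_algebra \<Longrightarrow> g \<in> smooth_algebra \<Longrightarrow> (\<lambda>x. f x * g x) \<in> smooth_algebra"

lemma smooth_algebra_smooth:
  assumes "f \<in> smooth_algebra" shows "smooth f"
proof (rule smooth_coinduct[OF assms])
  fix f :: "'a \<Rightarrow> complex"
  assume "f \<in> smooth_algebra"
  then show "\<exists>f'. (\<forall>x. (f has_derivative f' x) (at x)) \<and> (\<forall>v. (\<lambda>x. f' x v) \<in> smooth_algebra)"
  proof induction
    case (base f)
    show ?case
      by (rule exI[of _ "\<lambda>x. frechet_derivative f (at x)"]) (use smooth_step[OF base] smooth_algebra.base in auto)
  next
    case (add f g)
    then obtain f' g' where 
      f': "\<And>x. (f has_derivative f' x) (at x)" "\<And>v. (\<lambda>x. f' x v) \<in> smooth_algebra" and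
      g': "\<And>x. (g has_derivative g' x) (at x)" "\<And>v. (\<lambda>x. g' x v) \<in> smooth_algebra" by blast
    show ?case
      by (rule exI[of _ "\<lambda>x v. f' x v + g' x v"])
         (use f' g' in \<open>auto intro: has_derivative_add smooth_algebra.add\<close>)
  next
    case (mult f g)
    then obtain f' g' where 
      f': "\<And>x. (f has_derivative f' x) (at x)" "\<And>v. (\<lambda>x. f' x v) \<in> smooth_algebra" and
      g': "\<And>x. (g has_derivative g' x) (at x)" "\<And>v. (\<lambda>x. g' x v) \<in> smooth_algebra" by blast
    show ?case
      by (rule exI[of _ "\<lambda>x v. f x * g' x v + f' x v * g x"])
         (use f' g' mult.hyps in \<open>auto intro!: has_derivative_mult smooth_algebra.add smooth_algebra.mult\<close>)
  qed
qed

lemma smooth_mult: "smooth f \<Longrightarrow> smooth g \<Longrightarrow> smooth (\<lambda>x. f x * g x)"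
  by (rule smooth_algebra_smooth[OF smooth_algebra.mult[OF smooth_algebra.base smooth_algebra.base]])

lemma smooth_add: "smooth f \<Longrightarrow> smooth g \<Longrightarrow> smooth (\<lambda>x. f x + g x)"
  by (rule smooth_algebra_smooth[OF smooth_algebra.add[OF smooth_algebra.base smooth_algebra.base]])

lemma smooth_const: "smooth (\<lambda>_. c)"
proof (rule smooth_coinduct)
  show "(\<lambda>_. c) \<in> range (\<lambda>c _. c)" by auto
  fix f :: "'a \<Rightarrow> complex" assume "f \<in> range (\<lambda>c _. c)"
  then show "\<exists>f'. (\<forall>x. (f has_derivative f' x) (at x)) \<and> (\<forall>v. (\<lambda>x. f' x v) \<in> range (\<lambda>c _. c))"
    by (intro exI[of _ "\<lambda>_ _. 0"]) auto
qed

lemma smooth_prod: "finite A \<Longrightarrow> (\<And>i. i \<in> A \<Longrightarrow> smooth (f i)) \<Longrightarrow> smooth (\<lambda>x. \<Prod>i\<in>A. f i x)"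
  by (induction A rule: finite_induct) (auto intro: smooth_const smooth_mult)

lemma smooth_compose_linear:
  fixes l :: "'b::euclidean_space \<Rightarrow> 'a::euclidean_space"
  assumes "smooth f" "bounded_linear l"
  shows "smooth (\<lambda>x. f (l x))"
proof (rule smooth_coinduct)
  show "(\<lambda>x. f (l x)) \<in> {\<lambda>x. g (l x) | g. smooth g}" using assms by auto
  fix h :: "'b \<Rightarrow> complex" assume "h \<in> {\<lambda>x. g (l x) | g. smooth g}"
  then obtain g where g: "h = (\<lambda>x. g (l x))" "smooth g" by auto
  show "\<exists>h'. (\<forall>x. (h has_derivative h' x) (at x)) \<and> (\<forall>v. (\<lambda>x. h' x v) \<in> {\<lambda>x. g (l x) | g. smooth g})"
  proof (intro exI[of _ "\<lambda>x v. frechet_derivative g (at (l x)) (l v)"] conjI allI)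
    show "(h has_derivative (\<lambda>v. frechet_derivative g (at (l x)) (l v))) (at x)" for x
      unfolding g
      by (rule has_derivative_compose[OF bounded_linear_imp_has_derivative[OF assms(2)] smooth_step(1)[OF g(2)]])
    show "(\<lambda>x. frechet_derivative g (at (l x)) (l v)) \<in> {\<lambda>x. g (l x) | g. smooth g}" for v
      by (intro CollectI exI[of _ "\<lambda>y. frechet_derivative g (at y) (l v)"] conjI refl smooth_step g)
  qed
qed

text \<open>The witness \<open>D\<close> is the sequence of all derivatives; for concrete functions of one variable it is easier to
  give than the iterated directional derivatives.\<close>

definition smooth_real :: "(real \<Rightarrow> real) \<Rightarrow> bool" where
  "smooth_real h \<longleftrightarrow> (\<exists>D. D 0 = h \<and> (\<forall>n x. (D n has_real_derivative D (Suc n) x) (at x)))"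

lemma smooth_of_real:
  fixes l :: "'a::euclidean_space \<Rightarrow> real"
  assumes "smooth_real h" "bounded_linear l"
  shows "smooth (\<lambda>x. of_real (h (c * l x + k)))"
proof -
  from assms obtain D where D: "D 0 = h" "\<And>n x. (D n has_real_derivative D (Suc n) x) (at x)"
    unfolding smooth_real_def by blast
  define S :: "('a \<Rightarrow> complex) set" where "S = {\<lambda>x. of_real (b * D n (c * l x + k)) | b n. True}"
  show ?thesis
  proof (rule smooth_coinduct)
    show "(\<lambda>x. of_real (h (c * l x + k))) \<in> S"
      unfolding S_def by (intro CollectI exI[of _ 1] exI[of _ 0]) (simp add: D)
    fix f assume "f \<in> S"
    then obtain b n where f: "f = (\<lambda>x. of_real (b * D n (c * l x + k)))" by (auto simp: S_def)
    show "\<exists>f'. (\<forall>x. (f has_derivative f' x) (at x)) \<and> (\<forall>v. (\<lambda>x. f' x v) \<in> S)"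
    proof (intro exI[of _ "\<lambda>x v. of_real (b * (D (Suc n) (c * l x + k) * (c * l v)))"] conjI allI)
      fix x
      have 1: "((\<lambda>x. c * l x + k) has_derivative (\<lambda>v. c * l v)) (at x)"
        by (auto intro!: derivative_eq_intros bounded_linear_imp_has_derivative assms(2))
      have 2: "(D n has_derivative (\<lambda>v. D (Suc n) (c * l x + k) * v)) (at (c * l x + k))"
        using D(2) by (simp add: has_field_derivative_def)
      show "(f has_derivative (\<lambda>v. of_real (b * (D (Suc n) (c * l x + k) * (c * l v))))) (at x)"
        unfolding f
        by (intro has_derivative_of_real has_derivative_mult_right has_derivative_compose[OF 1 2])
    next
      fix v
      show "(\<lambda>x. of_real (b * (D (Suc n) (c * l x + k) * (c * l v)))) \<in> S"
        unfolding S_def by (intro CollectI exI[of _ "b * (c * l v)"] exI[of _ "Suc n"]) (simp add: algebra_simps)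
    qed
  qed
qed

text \<open>The flat function \<open>exp (-1/x)\<close> times polynomials in \<open>1/x\<close>, extended by zero to the left:
  a family that is closed under differentiation, also at the origin.\<close>

definition exp_flat :: "real poly \<Rightarrow> real \<Rightarrow> real" where
  "exp_flat p x = (if x > 0 then poly p (1 / x) * exp (- 1 / x) else 0)"

lemma tendsto_poly_div_exp: "((\<lambda>y. poly p y * exp (- y)) \<longlongrightarrow> (0::real)) at_top"
proof -
  have "((\<lambda>y. \<Sum>i\<le>degree p. coeff p i * (y ^ i / exp y)) \<longlongrightarrow> (\<Sum>i\<le>degree p. coeff p i * 0)) at_top"
    by (intro tendsto_sum tendsto_mult tendsto_const tendsto_power_div_exp_0)
  then show ?thesis
    by (simp add: poly_altdef exp_minus divide_simps sum_divide_distrib sum_distrib_right)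
qed

lemma exp_flat_derivative:
  "(exp_flat p has_real_derivative exp_flat ([:0, 0, 1:] * (p - pderiv p)) x) (at x)"
proof -
  consider "x > 0" | "x < 0" | "x = 0" by linarith
  then show ?thesis
  proof cases
    case 1
    have "((\<lambda>x. poly p (1 / x) * exp (- 1 / x)) has_real_derivative 
        exp_flat ([:0, 0, 1:] * (p - pderiv p)) x) (at x)"
      using 1 by (auto intro!: derivative_eq_intros poly_DERIV[THEN DERIV_chain2] 
          simp: exp_flat_def field_simps power2_eq_square)
    then show ?thesis
      by (rule has_field_derivative_transform_within_open[where S="{0<..}"]) (use 1 in \<open>auto simp: exp_flat_def\<close>)
  next
    case 2
    have "((\<lambda>x. 0) has_real_derivative exp_flat ([:0, 0, 1:] * (p - pderiv p)) x) (at x)"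
      using 2 by (simp add: exp_flat_def)
    then show ?thesis
      by (rule has_field_derivative_transform_within_open[where S="{..<0}"]) (use 2 in \<open>auto simp: exp_flat_def\<close>)
  next
    case 3
    have right: "((\<lambda>y. exp_flat p y / y) \<longlongrightarrow> 0) (at_right 0)"
    proof (rule Lim_transform_eventually)
      show "((\<lambda>x::real. poly (pCons 0 p) (inverse x) * exp (- (inverse x))) \<longlongrightarrow> 0) (at_right 0)"
        by (rule filterlim_compose[OF tendsto_poly_div_exp filterlim_inverse_at_top_right])
      show "\<forall>\<^sub>F x in at_right 0. poly (pCons 0 p) (inverse x) * exp (- inverse x) = exp_flat p x / x"
        by (auto simp: eventually_at_filter exp_flat_def divide_simps intro!: always_eventually)
    qed
    have left: "((\<lambda>y. exp_flat p y / y) \<longlongrightarrow> 0) (at_left 0)"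
    proof (rule Lim_transform_eventually[OF tendsto_const])
      show "\<forall>\<^sub>F x in at_left 0. 0 = exp_flat p x / x"
        by (auto simp: eventually_at_filter exp_flat_def intro!: always_eventually)
    qed
    have "((\<lambda>y. exp_flat p y / y) \<longlongrightarrow> 0) (at 0)"
      using filterlim_split_at[OF left right] .
    then show ?thesis using 3 
      by (simp add: has_field_derivative_iff) (simp add: exp_flat_def)
  qed
qed

lemma smooth_real_exp_flat: "smooth_real (exp_flat p)"
  unfolding smooth_real_def
  by (intro exI[of _ "\<lambda>n. exp_flat (((\<lambda>p. [:0, 0, 1:] * (p - pderiv p)) ^^ n) p)"])
     (auto simp del: mult_pCons_left intro: exp_flat_derivative)

abbreviation flat :: "real \<Rightarrow> real" where "flat \<equiv> exp_flat 1"

lemma flat_bounds: "0 \<le> flat x" "flat x \<le> 1" "x > 0 \<Longrightarrow> flat x > 0" "x \<le> 0 \<Longrightarrow> flat x = 0"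
  by (auto simp: exp_flat_def)

text \<open>The flat function tends to 1 at infinity, so its stretched copies tend to the indicator of the half-line, and
  their products are test functions that tend to the indicator of a box.\<close>

lemma flat_limit: "(\<lambda>n. flat (real (Suc n) * x)) \<longlonglongrightarrow> indicator {0<..} x"
proof (cases "x > 0")
  case True
  have "(\<lambda>n. (- 1 / x) * inverse (real (Suc n))) \<longlonglongrightarrow> (- 1 / x) * 0"
    by (intro tendsto_mult tendsto_const LIMSEQ_inverse_real_of_nat)
  then have "(\<lambda>n. exp (- 1 / (real (Suc n) * x))) \<longlonglongrightarrow> exp 0"
    by (intro tendsto_exp) (simp add: divide_inverse mult.commute)
  then show ?thesis using True by (simp add: exp_flat_def)
next
  case False
  then have "flat (real (Suc n) * x) = 0" for n
    by (intro flat_bounds(4) mult_nonneg_nonpos) auto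
  then show ?thesis using False by simp
qed

definition box_bump :: "'a::euclidean_space \<Rightarrow> 'a \<Rightarrow> nat \<Rightarrow> 'a \<Rightarrow> complex" where
  "box_bump a b n x = (\<Prod>i\<in>Basis. of_real (flat (real (Suc n) * (x \<bullet> i - a \<bullet> i))) * of_real (flat (real (Suc n) * (b \<bullet> i - x \<bullet> i))))"

lemma smooth_box_bump: "smooth (box_bump a b n)"
  unfolding box_bump_def
proof (intro smooth_prod smooth_mult finite_Basis)
  fix i :: 'a
  have l: "bounded_linear (\<lambda>x. x \<bullet> i)" by (rule bounded_linear_inner_left)
  show "smooth (\<lambda>x. of_real (flat (real (Suc n) * (x \<bullet> i - a \<bullet> i))))"
    using smooth_of_real[OF smooth_real_exp_flat l, of _ "real (Suc n)" "- real (Suc n) * (a \<bullet> i)"]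
    by (simp add: algebra_simps)
  show "smooth (\<lambda>x. of_real (flat (real (Suc n) * (b \<bullet> i - x \<bullet> i))))"
    using smooth_of_real[OF smooth_real_exp_flat l, of _ "- real (Suc n)" "real (Suc n) * (b \<bullet> i)"]
    by (simp add: algebra_simps)
qed

lemma box_bump_le: "cmod (box_bump a b n x) \<le> indicator (box a b) x"
proof (cases "x \<in> box a b")
  case True
  have "cmod (box_bump a b n x) \<le> 1"
    unfolding box_bump_def norm_mult prod_norm[symmetric]
    by (intro prod_le_1 conjI mult_le_one mult_nonneg_nonneg) (auto simp: flat_bounds)
  then show ?thesis using True by simp
next
  case False
  then obtain i where "i \<in> Basis" "x \<bullet> i \<le> a \<bullet> i \<or> b \<bullet> i \<le> x \<bullet> i"
    by (force simp: mem_box)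
  then have "box_bump a b n x = 0"
    unfolding box_bump_def by (subst prod_zero_iff) (auto intro!: bexI[of _ i] flat_bounds(4) simp: mult_le_0_iff)
  then show ?thesis by simp
qed

lemma box_bump_limit: "(\<lambda>n. box_bump a b n x) \<longlonglongrightarrow> indicator (box a b) x"
proof -
  have "(\<lambda>n. box_bump a b n x) \<longlonglongrightarrow> 
    (\<Prod>i\<in>Basis. of_real (indicator {0<..} (x \<bullet> i - a \<bullet> i)) * of_real (indicator {0<..} (b \<bullet> i - x \<bullet> i)))"
    unfolding box_bump_def by (intro tendsto_prod tendsto_mult tendsto_of_real flat_limit)
  also have "(\<Prod>i\<in>Basis. of_real (indicator {0<..} (x \<bullet> i - a \<bullet> i)) * of_real (indicator {0<..} (b \<bullet> i - x \<bullet> i)))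
     = (indicator (box a b) x :: complex)"
  proof (cases "x \<in> box a b")
    case False
    then obtain i where "i \<in> Basis" "x \<bullet> i \<le> a \<bullet> i \<or> b \<bullet> i \<le> x \<bullet> i"
      by (force simp: mem_box)
    then have "(\<Prod>i\<in>Basis. of_real (indicator {0<..} (x \<bullet> i - a \<bullet> i)) * of_real (indicator {0<..} (b \<bullet> i - x \<bullet> i))) = (0::complex)"
      by (intro prod_zero) (auto intro!: bexI[of _ i])
    then show ?thesis using False by simp
  qed (auto simp: mem_box)
  finally show ?thesis .
qed

lemma not_supp: "x \<notin> supp f \<Longrightarrow> f x = 0"
  unfolding supp_def using closure_subset[of "{x. f x \<noteq> 0}"] by auto

lemma supp_subset_compact:
  fixes f :: "'a::t2_space \<Rightarrow> complex"
  assumes "compact K" "\<And>x. x \<notin> K \<Longrightarrow> f x = 0"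
  shows "compact (supp f)" "supp f \<subseteq> K"
proof -
  show *: "supp f \<subseteq> K"
    unfolding supp_def using assms by (intro closure_minimal compact_imp_closed) auto
  have "compact (K \<inter> supp f)" using assms by (intro compact_Int_closed) (auto simp: supp_def)
  then show "compact (supp f)" using * by (simp add: Int_absorb1)
qed

lemma test_function_box_bump: "test_function UNIV (box_bump a b n)"
proof -
  have "box_bump a b n x = 0" if "x \<notin> cbox a b" for x
    using box_bump_le[of a b n x] box_subset_cbox[of a b] that by (cases "x \<in> box a b") auto
  from supp_subset_compact(1)[OF compact_cbox this] show ?thesis
    by (simp add: test_function_def smooth_box_bump)
qed

lemma test_function_add: 
  assumes "test_function \<Omega> f" "test_function \<Omega> g" 
  shows "test_function \<Omega> (\<lambda>x. f x + g x)"
proof -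
  have "compact (supp f \<union> supp g)" using assms by (intro compact_Un) (auto simp: test_function_def)
  from supp_subset_compact[OF this, of "\<lambda>x. f x + g x"] show ?thesis
    using assms not_supp[of _ f] not_supp[of _ g]
    by (auto simp: test_function_def intro: smooth_add)
qed

lemma test_function_mult: 
  assumes "test_function \<Omega> f" shows "test_function \<Omega> (\<lambda>x. c * f x)"
proof -
  have "compact (supp f)" using assms by (auto simp: test_function_def)
  from supp_subset_compact[OF this, of "\<lambda>x. c * f x"] show ?thesis
    using assms not_supp[of _ f]
    by (auto simp: test_function_def intro: smooth_mult smooth_const)
qed

lemma continuous_compact_support_L2:
  fixes f :: "'a::euclidean_space \<Rightarrow> complex"
  assumes f: "continuous_on UNIV f" and "compact (supp f)"
  shows "f \<in> L2" "\<exists>B. \<forall>x. cmod (f x) \<le> B * indicator (supp f) x"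
proof -
  have "bounded (f ` supp f)"
    using assms by (intro compact_imp_bounded compact_continuous_image) (auto intro: continuous_on_subset)
  then obtain B where B: "\<And>x. x \<in> supp f \<Longrightarrow> cmod (f x) \<le> B" by (auto simp: bounded_iff)
  have bd: "cmod (f x) \<le> B * indicator (supp f) x" for x
    using B not_supp[of x f] by (auto simp: indicator_def)
  then show "\<exists>B. \<forall>x. cmod (f x) \<le> B * indicator (supp f) x" by blast
  have m: "f \<in> borel_measurable borel" using f by (rule borel_measurable_continuous_onI)
  have "integrable lborel (\<lambda>x. B\<^sup>2 * indicator (supp f) x :: real)"
    using emeasure_compact_finite[OF assms(2)] assms(2)
    by (intro integrable_mult_right integrable_real_indicator) (auto intro: borel_compact)
  then have "integrable lborel (\<lambda>x. (cmod (f x))\<^sup>2)"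
  proof (rule Bochner_Integration.integrable_bound)
    have "(cmod (f x))\<^sup>2 \<le> B\<^sup>2 * indicator (supp f) x" for x
      using power_mono[OF bd[of x], of 2] by (cases "x \<in> supp f") auto
    then show "AE x in lborel. norm ((cmod (f x))\<^sup>2) \<le> norm (B\<^sup>2 * indicator (supp f) x :: real)"
      by (intro AE_I2) (auto simp: abs_mult)
  qed (use m in measurable)
  with m show "f \<in> L2" by (simp add: mem_L2)
qed

lemma test_function_L2: "test_function \<Omega> f \<Longrightarrow> f \<in> L2"
  by (intro continuous_compact_support_L2 smooth_continuous) (auto simp: test_function_def)

section \<open>Density of the test functions\<close>

definition L2_approximable :: "('a::euclidean_space \<Rightarrow> complex) \<Rightarrow> bool" where
  "L2_approximable f \<longleftrightarrow> f \<in> L2 \<and> (\<forall>\<eta>>0. \<exists>\<psi>. test_function UNIV \<psi> \<and> L2norm (\<lambda>x. f x - \<psi> x) < \<eta>)"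

lemma L2_approximable_add:
  assumes "L2_approximable f" "L2_approximable g" shows "L2_approximable (\<lambda>x. f x + g x)"
  unfolding L2_approximable_def
proof (intro conjI allI impI)
  show "(\<lambda>x. f x + g x) \<in> L2" using assms by (auto simp: L2_approximable_def)
  fix \<eta> :: real assume "\<eta> > 0"
  then have "\<eta> / 2 > 0" by simp
  then obtain \<phi> \<psi> where 1: "test_function UNIV \<phi>" "L2norm (\<lambda>x. f x - \<phi> x) < \<eta> / 2"
    and 2: "test_function UNIV \<psi>" "L2norm (\<lambda>x. g x - \<psi> x) < \<eta> / 2"
    using assms unfolding L2_approximable_def by meson
  have "L2norm (\<lambda>x. (f x - \<phi> x) + (g x - \<psi> x)) \<le> L2norm (\<lambda>x. f x - \<phi> x) + L2norm (\<lambda>x. g x - \<psi> x)"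
    using assms test_function_L2[OF 1(1)] test_function_L2[OF 2(1)] 
    by (intro L2norm_triangle L2_diff) (auto simp: L2_approximable_def)
  then have "L2norm (\<lambda>x. (f x + g x) - (\<phi> x + \<psi> x)) < \<eta>"
    using 1 2 by (simp add: algebra_simps)
  then show "\<exists>\<psi>. test_function UNIV \<psi> \<and> L2norm (\<lambda>x. f x + g x - \<psi> x) < \<eta>"
    using test_function_add[OF 1(1) 2(1)] by blast
qed

lemma L2_approximable_mult:
  assumes "L2_approximable f" shows "L2_approximable (\<lambda>x. c * f x)"
  unfolding L2_approximable_def
proof (intro conjI allI impI)
  show "(\<lambda>x. c * f x) \<in> L2" using assms by (auto simp: L2_approximable_def)
  fix \<eta> :: real assume "\<eta> > 0"
  then have "\<eta> / (cmod c + 1) > 0" by (simp add: add_nonneg_pos)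
  then obtain \<phi> where 1: "test_function UNIV \<phi>" "L2norm (\<lambda>x. f x - \<phi> x) < \<eta> / (cmod c + 1)"
    using assms unfolding L2_approximable_def by meson
  have "L2norm (\<lambda>x. c * f x - c * \<phi> x) = cmod c * L2norm (\<lambda>x. f x - \<phi> x)"
    by (simp add: L2norm_mult_const[symmetric] right_diff_distrib)
  also have "\<dots> \<le> (cmod c + 1) * L2norm (\<lambda>x. f x - \<phi> x)"
    by (intro mult_right_mono) auto
  also have "\<dots> < \<eta>" using 1(2) by (simp add: pos_less_divide_eq add_nonneg_pos mult.commute)
  finally show "\<exists>\<psi>. test_function UNIV \<psi> \<and> L2norm (\<lambda>x. c * f x - \<psi> x) < \<eta>"
    using test_function_mult[OF 1(1)] by blast
qed

lemma L2_approximable_zero: "L2_approximable (\<lambda>_. 0)"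
proof -
  have "test_function UNIV (\<lambda>_::'a. 0::complex)"
    by (auto simp: test_function_def supp_def smooth_const)
  then show ?thesis unfolding L2_approximable_def by (auto intro!: exI[of _ "\<lambda>_. 0"])
qed

lemma L2_approximable_sum:
  "finite A \<Longrightarrow> (\<And>i. i \<in> A \<Longrightarrow> L2_approximable (f i)) \<Longrightarrow> L2_approximable (\<lambda>x. \<Sum>i\<in>A. f i x)"
  by (induction A rule: finite_induct) (auto intro: L2_approximable_zero L2_approximable_add)

lemma L2_approximable_limit:
  fixes f :: "nat \<Rightarrow> 'a::euclidean_space \<Rightarrow> complex"
  assumes "\<And>n. L2_approximable (f n)" "g \<in> L2" "(\<lambda>n. L2norm (\<lambda>x. f n x - g x)) \<longlonglongrightarrow> 0"
  shows "L2_approximable g"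
  unfolding L2_approximable_def
proof (intro conjI allI impI assms(2))
  fix \<eta> :: real assume "\<eta> > 0"
  then obtain n where n: "L2norm (\<lambda>x. f n x - g x) < \<eta> / 2"
    using order_tendstoD(2)[OF assms(3), of "\<eta> / 2"] by (auto simp: eventually_sequentially)
  from \<open>\<eta> > 0\<close> assms(1)[of n] obtain \<psi> where p: "test_function UNIV \<psi>" "L2norm (\<lambda>x. f n x - \<psi> x) < \<eta> / 2"
    unfolding L2_approximable_def by (meson half_gt_zero)
  have "L2norm (\<lambda>x. g x - \<psi> x) \<le> L2norm (\<lambda>x. g x - f n x) + L2norm (\<lambda>x. f n x - \<psi> x)"
    using assms test_function_L2[OF p(1)] by (intro L2norm_triangle3) (auto simp: L2_approximable_def)
  then show "\<exists>\<psi>. test_function UNIV \<psi> \<and> L2norm (\<lambda>x. g x - \<psi> x) < \<eta>"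
    using n p by (intro exI[of _ \<psi>]) (auto simp: L2norm_minus_commute[of g])
qed

lemma L2_indicator_box: "(\<lambda>x. indicator (box a b) x) \<in> L2"
proof -
  have "integrable lborel (\<lambda>x. indicator (box a b) x :: real)"
    by (intro integrable_real_indicator) (auto simp: emeasure_lborel_box_eq)
  moreover have "(cmod (indicator (box a b) x))\<^sup>2 = indicator (box a b) x" for x
    by (auto simp: indicator_def)
  ultimately show ?thesis by (simp add: mem_L2)
qed

lemma L2_approximable_box: "L2_approximable (\<lambda>x. indicator (box a b) x)"
proof (rule L2_approximable_limit)
  show "L2_approximable (box_bump a b n)" for n
    unfolding L2_approximable_def using test_function_box_bump test_function_L2[OF test_function_box_bump]
    by (auto intro!: exI[of _ "box_bump a b n"])
  show "(\<lambda>n. L2norm (\<lambda>x. box_bump a b n x - indicator (box a b) x)) \<longlonglongrightarrow> 0"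
  proof (rule L2_dominated_convergence(2)[OF _ _ L2_indicator_box[of a b]])
    show "box_bump a b n \<in> borel_measurable borel" for n
      using test_function_L2[OF test_function_box_bump] by (rule L2_measurable)
    show "cmod (box_bump a b n x) \<le> cmod (indicator (box a b) x)" for n x
      using box_bump_le[of a b n x] by (cases "x \<in> box a b") auto
    show "AE x in lborel. (\<lambda>n. box_bump a b n x) \<longlonglongrightarrow> indicator (box a b) x"
      by (intro AE_I2 box_bump_limit)
  qed (intro L2_measurable L2_indicator_box)
qed (rule L2_indicator_box)

text \<open>The Borel sets \<open>A\<close> with this property form a Dynkin system that contains the open boxes, which are stable
  under intersection. The fixed box keeps all measures finite.\<close>

lemma L2_approximable_borel_box:
  assumes "A \<in> sets borel"
  shows "L2_approximable (\<lambda>x. indicator (A \<inter> box a b) x)"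
proof -
  let ?G = "range (\<lambda> (a, b). box a b :: 'a :: euclidean_space set)"
  have "Int_stable ?G" by (auto simp: Int_stable_def box_Int_box)
  moreover have "?G \<subseteq> Pow UNIV" by auto
  moreover have "A \<in> sigma_sets UNIV ?G" using assms by (simp add: borel_eq_box)
  ultimately show ?thesis
  proof (induction A rule: sigma_sets_induct_disjoint)
    case (basic A)
    then show ?case by (auto simp: box_Int_box L2_approximable_box)
  next
    case empty
    show ?case by (simp add: L2_approximable_zero)
  next
    case (compl A)
    have "L2_approximable (\<lambda>x. indicator (box a b) x + (-1) * indicator (A \<inter> box a b) x)"
      by (intro L2_approximable_add L2_approximable_mult L2_approximable_box compl)
    also have "(\<lambda>x. indicator (box a b) x + (-1) * indicator (A \<inter> box a b) x) = (\<lambda>x. indicator ((UNIV - A) \<inter> box a b) x :: complex)"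
      by (auto simp: indicator_def fun_eq_iff)
    finally show ?case .
  next
    case (union A)
    have m: "A i \<in> sets borel" for i using union(2) by (auto simp: borel_eq_box)
    have m': "(\<lambda>x. indicator (A i \<inter> box a b) x :: complex) \<in> borel_measurable borel" for i
      using m[of i] by measurable
    have dis: "disjoint_family (\<lambda>i. A i \<inter> box a b)"
      using union(1) by (auto simp: disjoint_family_on_def)
    have sum: "(\<Sum>i<n. indicator (A i \<inter> box a b) x) = (indicator (\<Union>i<n. A i \<inter> box a b) x :: complex)" for n x
      by (rule indicator_UN_disjoint[symmetric]) (use dis in \<open>auto simp: disjoint_family_on_def\<close>)
    have lim: "(\<lambda>n. \<Sum>i<n. indicator (A i \<inter> box a b) x) \<longlonglongrightarrow> (indicator ((\<Union>i. A i) \<inter> box a b) x :: complex)" for x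
      using LIMSEQ_indicator_UN[of "\<lambda>i. A i \<inter> box a b" x] unfolding sum by (simp add: Int_commute)
    have bd: "cmod (\<Sum>i<n. indicator (A i \<inter> box a b) x) \<le> cmod (indicator (box a b) x)" for n x
      unfolding sum by (auto simp: indicator_def)
    show ?case
    proof (rule L2_approximable_limit)
      show "L2_approximable (\<lambda>x. \<Sum>i<n. indicator (A i \<inter> box a b) x)" for n
        using union by (intro L2_approximable_sum) auto
      show "(\<lambda>x. indicator (\<Union> (range A) \<inter> box a b) x :: complex) \<in> L2"
        by (rule L2_dominated_convergence(1)[where f = "\<lambda>n x. \<Sum>i<n. indicator (A i \<inter> box a b) x", OF _ _ L2_indicator_box _ bd])
           (use m m' lim in \<open>auto intro!: borel_measurable_sum\<close>)
      show "(\<lambda>n. L2norm (\<lambda>x. (\<Sum>i<n. indicator (A i \<inter> box a b) x) - indicator (\<Union> (range A) \<inter> box a b) x)) \<longlonglongrightarrow> 0"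
        by (rule L2_dominated_convergence(2)[OF _ _ L2_indicator_box _ bd])
           (use m m' lim in \<open>auto intro!: borel_measurable_sum\<close>)
    qed
  qed
qed

text \<open>Every function in \<open>L\<^sup>2\<close> is a dominated limit of simple functions supported in boxes.\<close>

lemma L2_test_functions_dense:
  assumes f: "f \<in> L2" shows "L2_approximable f"
proof -
  have fm: "f \<in> borel_measurable borel" using f by (rule L2_measurable)
  from borel_measurable_implies_sequence_metric[OF this, of 0] obtain F where 
    F: "\<And>i. simple_function borel (F i)" "\<And>x. (\<lambda>i. F i x) \<longlonglongrightarrow> f x" "\<And>i x. cmod (F i x) \<le> 2 * cmod (f x)"
    by (auto simp: dist_norm)
  define B :: "nat \<Rightarrow> 'a set" where "B n = box (- (real n *\<^sub>R One)) (real n *\<^sub>R One)" for n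
  define G where "G n x = indicator (B n) x * F n x" for n x
  have Fm: "F n \<in> borel_measurable borel" for n
    using F(1) by (rule borel_measurable_simple_function)
  have Gm: "G n \<in> borel_measurable borel" for n
    unfolding G_def B_def using Fm by measurable
  have G: "L2_approximable (G n)" for n
  proof -
    have fin: "finite (range (F n))" using F(1)[of n] by (simp add: simple_function_def)
    have "L2_approximable (\<lambda>x. \<Sum>y\<in>range (F n). y * indicator (F n -` {y} \<inter> B n) x)"
      unfolding B_def 
    proof (intro L2_approximable_sum fin L2_approximable_mult L2_approximable_borel_box)
      fix y
      show "F n -` {y} \<in> sets borel" using measurable_sets[OF Fm, of "{y}" n] by simp
    qed
    also have "(\<lambda>x. \<Sum>y\<in>range (F n). y * indicator (F n -` {y} \<inter> B n) x) = G n"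
    proof
      fix x
      have "(\<Sum>y\<in>range (F n). y * indicator (F n -` {y} \<inter> B n) x) = (\<Sum>y\<in>range (F n). if y = F n x then indicator (B n) x * F n x else 0)"
        by (intro sum.cong) (auto simp: indicator_def)
      then show "(\<Sum>y\<in>range (F n). y * indicator (F n -` {y} \<inter> B n) x) = G n x"
        using fin by (simp add: G_def)
    qed
    finally show ?thesis .
  qed
  have lim: "(\<lambda>n. G n x) \<longlonglongrightarrow> f x" for x
  proof -
    have "x \<in> (\<Union>n. B n)" unfolding B_def by (simp add: UN_box_eq_UNIV)
    then obtain N where N: "x \<in> B N" by auto
    have "B m \<subseteq> B n" if "m \<le> n" for m n using that unfolding B_def by (auto simp: mem_box; smt (verit) of_nat_mono)
    then have "eventually (\<lambda>n. x \<in> B n) sequentially"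
      using N by (auto simp: eventually_sequentially)
    then have "eventually (\<lambda>n. F n x = G n x) sequentially"
      by eventually_elim (simp add: G_def)
    then show ?thesis by (rule Lim_transform_eventually[OF F(2)])
  qed
  have bd: "cmod (G n x) \<le> cmod (2 * f x)" for n x
    using F(3)[of n x] by (auto simp: G_def indicator_def norm_mult)
  show ?thesis
    by (rule L2_approximable_limit[OF G f L2_dominated_convergence(2)[where f = G, OF Gm fm L2_mult_const[OF f] _ bd]])
       (use lim in auto)
qed

text \<open>The converse of the Cauchy-Schwarz inequality, with test functions only. It converts estimates of the weak
  equation, which are all that is known, into estimates in norm.\<close>

lemma L2norm_le_by_test_functions:
  fixes h :: "'a::euclidean_space \<Rightarrow> complex"
  assumes h: "h \<in> L2" and "0 \<le> M"
    and bd: "\<And>\<psi>. test_function UNIV \<psi> \<Longrightarrow> cmod (\<integral>x. h x * \<psi> x \<partial>lborel) \<le> M * L2norm \<psi>"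
  shows "L2norm h \<le> M"
proof (rule ccontr)
  assume "\<not> L2norm h \<le> M"
  then have gt: "L2norm h > M" by simp
  have hc: "(\<lambda>x. cnj (h x)) \<in> L2" using h by auto
  have "(L2norm h)\<^sup>2 \<le> M * L2norm h"
  proof (rule field_le_epsilon)
    fix e :: real assume e: "e > 0"
    \<comment> \<open>A test function closer than \<open>\<eta>\<close> to the conjugate of \<open>h\<close> makes the total error at most \<open>e\<close>.\<close>
    define \<eta> where "\<eta> = e / (M + L2norm h)"
    have pos: "M + L2norm h > 0" using gt \<open>0 \<le> M\<close> by linarith
    have "\<eta> > 0" using e pos by (simp add: \<eta>_def)
    then obtain \<psi> where \<psi>: "test_function UNIV \<psi>" "L2norm (\<lambda>x. cnj (h x) - \<psi> x) < \<eta>"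
      using L2_test_functions_dense[OF hc] unfolding L2_approximable_def by blast
    have p2: "\<psi> \<in> L2" using \<psi>(1) by (rule test_function_L2)
    have "of_real ((L2norm h)\<^sup>2) = (\<integral>x. h x * \<psi> x \<partial>lborel) + (\<integral>x. h x * (cnj (h x) - \<psi> x) \<partial>lborel)"
      using h hc p2 L2inner_self[OF h] unfolding L2inner_def 
      by (subst Bochner_Integration.integral_add[symmetric]) (auto simp: algebra_simps)
    then have "(L2norm h)\<^sup>2 = cmod ((\<integral>x. h x * \<psi> x \<partial>lborel) + (\<integral>x. h x * (cnj (h x) - \<psi> x) \<partial>lborel))"
      by (metis norm_of_real abs_of_nonneg zero_le_power2)
    also have "\<dots> \<le> M * L2norm \<psi> + L2norm h * L2norm (\<lambda>x. cnj (h x) - \<psi> x)"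
      using h hc p2 by (intro order_trans[OF norm_triangle_ineq] add_mono bd \<psi> Cauchy_Schwarz_bilinear) auto
    also have "\<dots> \<le> M * (L2norm h + \<eta>) + L2norm h * \<eta>"
      using \<psi>(2) L2norm_reverse_triangle[OF hc p2] \<open>0 \<le> M\<close>
      by (intro add_mono mult_left_mono) auto
    also have "\<dots> = M * L2norm h + (M + L2norm h) * \<eta>" by (simp add: algebra_simps)
    also have "\<dots> = M * L2norm h + e" using pos by (simp add: \<eta>_def)
    finally show "(L2norm h)\<^sup>2 \<le> M * L2norm h + e" .
  qed
  then show False using gt \<open>0 \<le> M\<close> by (simp add: power2_eq_square mult_le_cancel_right)
qed

section \<open>Fourier integrals and Gaussians\<close>

lemma lborel_integrable_affine:
  fixes f :: "'a::euclidean_space \<Rightarrow> 'b::{banach, second_countable_topology}"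
  assumes "f \<in> borel_measurable borel" "c \<noteq> 0"
  shows "integrable lborel (\<lambda>x. f (t + c *\<^sub>R x)) \<longleftrightarrow> integrable lborel f"
proof -
  have "integrable lborel f \<longleftrightarrow> integrable lborel (\<lambda>x. \<bar>c\<bar> ^ DIM('a) *\<^sub>R f (t + c *\<^sub>R x))"
    using assms
    by (subst lborel_affine[of c t]) (simp_all add: integrable_density integrable_distr_eq)
  also have "\<dots> \<longleftrightarrow> integrable lborel (\<lambda>x. f (t + c *\<^sub>R x))"
  proof
    assume "integrable lborel (\<lambda>x. \<bar>c\<bar> ^ DIM('a) *\<^sub>R f (t + c *\<^sub>R x))"
    then have "integrable lborel (\<lambda>x. inverse (\<bar>c\<bar> ^ DIM('a)) *\<^sub>R (\<bar>c\<bar> ^ DIM('a) *\<^sub>R f (t + c *\<^sub>R x)))"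
      by (rule integrable_scaleR_right)
    then show "integrable lborel (\<lambda>x. f (t + c *\<^sub>R x))" using assms(2) by simp
  qed (rule integrable_scaleR_right)
  finally show ?thesis by simp
qed

lemma lborel_integral_affine:
  fixes f :: "'a::euclidean_space \<Rightarrow> 'b::{banach, second_countable_topology}"
  assumes "f \<in> borel_measurable borel" "c \<noteq> 0"
  shows "(\<integral>x. f x \<partial>lborel) = \<bar>c\<bar> ^ DIM('a) *\<^sub>R (\<integral>x. f (t + c *\<^sub>R x) \<partial>lborel)"
  using assms
  by (subst lborel_affine[of c t]) (simp_all add: integral_density integral_distr)

lemma lborel_integral_prod:
  fixes f :: "'a::euclidean_space \<Rightarrow> real \<Rightarrow> complex"
  assumes "\<And>i. i \<in> Basis \<Longrightarrow> integrable lborel (f i)"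
  shows "integrable lborel (\<lambda>x. \<Prod>i\<in>Basis. f i (x \<bullet> i))"
    and "(\<integral>x. (\<Prod>i\<in>Basis. f i (x \<bullet> i)) \<partial>lborel) = (\<Prod>i\<in>Basis. \<integral>x. f i x \<partial>lborel)"
proof -
  interpret product_sigma_finite "\<lambda>_::'a. lborel :: real measure" ..
  have m: "(\<lambda>g. \<Sum>b\<in>Basis. g b *\<^sub>R b) \<in> measurable (\<Pi>\<^sub>M b\<in>Basis. lborel) (borel :: 'a measure)"
    by measurable
  have fm: "f i \<in> borel_measurable borel" if "i \<in> Basis" for i
    using assms[OF that] by auto
  have fm': "(\<lambda>x. \<Prod>i\<in>Basis. f i (x \<bullet> i)) \<in> borel_measurable borel"
    using fm by (intro borel_measurable_prod measurable_compose[OF _ fm]) auto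
  have eq: "(\<Prod>i\<in>Basis. f i ((\<Sum>b\<in>Basis. g b *\<^sub>R b) \<bullet> i)) = (\<Prod>i\<in>Basis. f i (g i))" for g
    by (intro prod.cong refl) simp
  show "integrable lborel (\<lambda>x. \<Prod>i\<in>Basis. f i (x \<bullet> i))"
    by (subst lborel_eq) (use assms fm' in \<open>simp add: integrable_distr_eq[OF m] eq product_integrable_prod\<close>)
  show "(\<integral>x. (\<Prod>i\<in>Basis. f i (x \<bullet> i)) \<partial>lborel) = (\<Prod>i\<in>Basis. \<integral>x. f i x \<partial>lborel)"
    by (subst lborel_eq) (use assms fm' in \<open>simp add: integral_distr[OF m] eq product_integral_prod\<close>)
qed

definition fourier_int :: "('a::euclidean_space \<Rightarrow> complex) \<Rightarrow> 'a \<Rightarrow> complex" where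
  "fourier_int f \<xi> = (\<integral>x. cis (- (x \<bullet> \<xi>)) * f x \<partial>lborel)"

definition gauss :: "'a::euclidean_space \<Rightarrow> real" where
  "gauss x = exp (- (x \<bullet> x) / 2)"

text \<open>The square of the factor by which the transform without normalisation changes the \<open>L\<^sup>2\<close> norm.\<close>

definition plancherel_const :: "'a::euclidean_space itself \<Rightarrow> real" where
  "plancherel_const _ = (2 * pi) ^ DIM('a)"

lemma cis_measurable [measurable]: "cis \<in> borel_measurable borel"
  by (intro borel_measurable_continuous_onI continuous_intros)

lemma gauss_measurable [measurable]: "gauss \<in> borel_measurable borel"
  unfolding gauss_def by measurable

text \<open>The characteristic function of the standard normal distribution, without the normalisation.\<close>

lemma gauss_fourier_real:
  shows "integrable lborel (\<lambda>x::real. cis (- (x * w)) * of_real (exp (- x\<^sup>2 / 2)))"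
    and "(\<integral>x. cis (- (x * w)) * of_real (exp (- x\<^sup>2 / 2)) \<partial>lborel) = of_real (sqrt (2 * pi) * exp (- w\<^sup>2 / 2))"
proof -
  have n: "exp (- x\<^sup>2 / 2) = sqrt (2 * pi) * std_normal_density x" for x :: real
    by (simp add: std_normal_density_def)
  have i: "integrable lborel (\<lambda>x::real. exp (- x\<^sup>2 / 2))"
    unfolding n by (intro integrable_mult_right integrable_normal_density) simp
  show "integrable lborel (\<lambda>x::real. cis (- (x * w)) * of_real (exp (- x\<^sup>2 / 2)))"
    by (rule Bochner_Integration.integrable_bound[OF i]) (auto simp: norm_mult)
  have "char std_normal_distribution (- w) = (\<integral>x. std_normal_density x *\<^sub>R iexp (- w * x) \<partial>lborel)"
    unfolding char_def by (subst integral_density) auto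
  then have "complex_of_real (exp (- w\<^sup>2 / 2)) = (\<integral>x. std_normal_density x *\<^sub>R iexp (- w * x) \<partial>lborel)"
    unfolding char_std_normal_distribution by simp
  then have "of_real (sqrt (2 * pi) * exp (- w\<^sup>2 / 2)) = of_real (sqrt (2 * pi)) * (\<integral>x. std_normal_density x *\<^sub>R iexp (- w * x) \<partial>lborel)"
    by simp
  also have "\<dots> = (\<integral>x. of_real (sqrt (2 * pi)) * (std_normal_density x *\<^sub>R iexp (- w * x)) \<partial>lborel)"
    by (rule integral_mult_right_zero[symmetric])
  also have "\<dots> = (\<integral>x. cis (- (x * w)) * of_real (exp (- x\<^sup>2 / 2)) \<partial>lborel)"
    unfolding n by (intro Bochner_Integration.integral_cong refl) 
      (simp add: cis_conv_exp scaleR_conv_of_real mult_ac)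
  finally show "(\<integral>x. cis (- (x * w)) * of_real (exp (- x\<^sup>2 / 2)) \<partial>lborel) = of_real (sqrt (2 * pi) * exp (- w\<^sup>2 / 2))" ..
qed

lemma cis_sum: "finite A \<Longrightarrow> cis (\<Sum>i\<in>A. f i) = (\<Prod>i\<in>A. cis (f i))"
  by (induction A rule: finite_induct) (auto simp: cis_mult[symmetric])

lemma gauss_fourier:
  fixes \<xi> :: "'a::euclidean_space"
  shows "fourier_int (\<lambda>x. of_real (gauss x)) \<xi> = of_real (sqrt (plancherel_const TYPE('a)) * gauss \<xi>)"
    and "integrable lborel (\<lambda>x::'a. gauss x)"
proof -
  let ?g = "\<lambda>w x. cis (- (x * w)) * complex_of_real (exp (- x\<^sup>2 / 2))"
  have eq: "cis (- (x \<bullet> \<xi>)) * of_real (gauss x) = (\<Prod>i\<in>Basis. ?g (\<xi> \<bullet> i) (x \<bullet> i))" for x \<xi> :: 'a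
  proof -
    have "cis (- (x \<bullet> \<xi>)) = (\<Prod>i\<in>Basis. cis (- ((x \<bullet> i) * (\<xi> \<bullet> i))))"
      by (subst euclidean_inner) (simp add: sum_negf[symmetric] cis_sum)
    moreover have "gauss x = (\<Prod>i\<in>Basis. exp (- (x \<bullet> i)\<^sup>2 / 2))"
      unfolding gauss_def
      by (subst euclidean_inner) (simp add: exp_sum[symmetric] sum_negf sum_divide_distrib power2_eq_square)
    ultimately show ?thesis by (simp add: prod.distrib)
  qed
  have "sqrt (plancherel_const TYPE('a)) * gauss \<xi> = (\<Prod>i\<in>(Basis::'a set). sqrt (2 * pi) * exp (- (\<xi> \<bullet> i)\<^sup>2 / 2))"
    unfolding prod.distrib gauss_def plancherel_const_def prod_constant real_sqrt_power
    by (subst euclidean_inner) 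
       (simp add: exp_sum[symmetric] sum_negf sum_divide_distrib power2_eq_square)
  then show "fourier_int (\<lambda>x. of_real (gauss x)) \<xi> = of_real (sqrt (plancherel_const TYPE('a)) * gauss \<xi>)"
    unfolding fourier_int_def eq
    by (subst lborel_integral_prod(2)[OF gauss_fourier_real(1)], simp only: gauss_fourier_real(2)) simp
  have "integrable lborel (\<lambda>x. complex_of_real (gauss (x::'a)))"
    using lborel_integral_prod(1)[OF gauss_fourier_real(1), where 'a='a, of "\<lambda>_. 0"] eq[of _ 0]
    by (simp add: inner_zero_left)
  then show "integrable lborel (\<lambda>x::'a. gauss x)" 
    by (simp add: complex_of_real_integrable_eq)
qed

lemma fourier_int_measurable [measurable]:
  assumes [measurable]: "f \<in> borel_measurable borel"
  shows "fourier_int f \<in> borel_measurable borel"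
  unfolding fourier_int_def by measurable

lemma fourier_int_bound:
  shows "cmod (fourier_int f \<xi>) \<le> (\<integral>x. cmod (f x) \<partial>lborel)"
  unfolding fourier_int_def using integral_norm_bound[of lborel "\<lambda>x. cis (- (x \<bullet> \<xi>)) * f x"]
  by (simp add: norm_mult)

lemma cis_integrable:
  assumes "integrable lborel f" "c \<in> borel_measurable borel"
  shows "integrable lborel (\<lambda>x. cis (c x) * f x)"
  by (rule Bochner_Integration.integrable_bound[OF assms(1)]) (use assms in \<open>auto simp: norm_mult\<close>)

text \<open>Fubini for the kernel \<open>cis (- (x \<bullet> \<xi>))\<close>. The proofs of the Plancherel theorem and of the
  orthogonality of low and high frequencies are applications of this formula.\<close>

lemma fourier_int_multiplication_formula:
  fixes f h :: "'a::euclidean_space \<Rightarrow> complex"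
  assumes f: "integrable lborel f" and h: "integrable lborel h"
  shows "(\<integral>\<xi>. fourier_int f \<xi> * h \<xi> \<partial>lborel) = (\<integral>x. f x * fourier_int h x \<partial>lborel)"
proof -
  have [measurable]: "f \<in> borel_measurable borel" "h \<in> borel_measurable borel"
    using f h by auto
  let ?G = "\<lambda>x \<xi>. cis (- (x \<bullet> \<xi>)) * f x * h \<xi>"
  have "integrable (lborel \<Otimes>\<^sub>M lborel) (case_prod ?G)"
  proof (rule lborel_pair.Fubini_integrable)
    show "integrable lborel (\<lambda>x. \<integral>\<xi>. cmod (case_prod ?G (x, \<xi>)) \<partial>lborel)"
      using f by (simp add: norm_mult)
    show "AE x in lborel. integrable lborel (\<lambda>\<xi>. case_prod ?G (x, \<xi>))"
    proof (intro AE_I2)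
      fix x
      have "integrable lborel (\<lambda>\<xi>. f x * (cis (- (x \<bullet> \<xi>)) * h \<xi>))"
        by (intro integrable_mult_right cis_integrable h) measurable
      then show "integrable lborel (\<lambda>\<xi>. case_prod ?G (x, \<xi>))" by (simp add: mult_ac)
    qed
  qed measurable
  then have "(\<integral>\<xi>. (\<integral>x. ?G x \<xi> \<partial>lborel) \<partial>lborel) = (\<integral>x. (\<integral>\<xi>. ?G x \<xi> \<partial>lborel) \<partial>lborel)"
    by (rule lborel_pair.Fubini_integral)
  moreover have "(\<integral>x. ?G x \<xi> \<partial>lborel) = fourier_int f \<xi> * h \<xi>" for \<xi>
    unfolding fourier_int_def by (rule integral_mult_left_zero)
  moreover have "(\<integral>\<xi>. ?G x \<xi> \<partial>lborel) = f x * fourier_int h x" for x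
  proof -
    have "(\<integral>\<xi>. ?G x \<xi> \<partial>lborel) = (\<integral>\<xi>. f x * (cis (- (\<xi> \<bullet> x)) * h \<xi>) \<partial>lborel)"
      by (intro Bochner_Integration.integral_cong refl) (simp add: mult_ac inner_commute)
    then show ?thesis unfolding fourier_int_def by simp
  qed
  ultimately show ?thesis by (simp only:)
qed

section \<open>The Plancherel theorem\<close>

lemma L2_affine:
  fixes f :: "'a::euclidean_space \<Rightarrow> complex"
  assumes "f \<in> L2" "c \<noteq> 0"
  shows "(\<lambda>x. f (t + c *\<^sub>R x)) \<in> L2" "L2norm f = sqrt (\<bar>c\<bar> ^ DIM('a)) * L2norm (\<lambda>x. f (t + c *\<^sub>R x))"
proof -
  have [measurable]: "f \<in> borel_measurable borel" using assms(1) by (rule L2_measurable)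
  have m: "(\<lambda>x. (cmod (f x))\<^sup>2) \<in> borel_measurable borel" by measurable
  show "(\<lambda>x. f (t + c *\<^sub>R x)) \<in> L2"
    using lborel_integrable_affine[OF m assms(2), of t] assms(1) by (simp add: mem_L2)
  show "L2norm f = sqrt (\<bar>c\<bar> ^ DIM('a)) * L2norm (\<lambda>x. f (t + c *\<^sub>R x))"
    unfolding L2norm_eq by (subst lborel_integral_affine[OF m assms(2), of t]) (simp add: real_sqrt_mult)
qed

lemma L2_shift:
  fixes f :: "'a::euclidean_space \<Rightarrow> complex"
  assumes "f \<in> L2" 
  shows "(\<lambda>x. f (x + t)) \<in> L2" "L2norm (\<lambda>x. f (x + t)) = L2norm f"
  using L2_affine[OF assms, of 1 t] by (simp_all add: add.commute)

lemma L2_reflect: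
  fixes f :: "'a::euclidean_space \<Rightarrow> complex"
  assumes "f \<in> L2" 
  shows "(\<lambda>x. f (- x)) \<in> L2" "L2norm (\<lambda>x. f (- x)) = L2norm f"
  using L2_affine[OF assms, of "-1" 0] by simp_all

lemma test_function_shift_continuous:
  fixes \<psi> :: "'a::euclidean_space \<Rightarrow> complex"
  assumes \<psi>: "test_function UNIV \<psi>" and z: "z \<longlonglongrightarrow> 0"
  shows "(\<lambda>n. L2norm (\<lambda>x. \<psi> (x + z n) - \<psi> x)) \<longlonglongrightarrow> 0"
proof -
  have c: "continuous_on UNIV \<psi>" and comp: "compact (supp \<psi>)" using \<psi> smooth_continuous by (auto simp: test_function_def)
  obtain B where B: "\<And>x. cmod (\<psi> x) \<le> B * indicator (supp \<psi>) x"
    using continuous_compact_support_L2(2)[OF c comp] by blast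
  have "Bseq z" using z by (rule convergentI[THEN convergent_imp_Bseq])
  then obtain Z where Z: "\<And>n. norm (z n) \<le> Z" by (auto simp: Bseq_def)
  obtain R where R: "\<And>x. x \<in> supp \<psi> \<Longrightarrow> norm x \<le> R"
    using compact_imp_bounded[OF comp] by (auto simp: bounded_iff)
  define h :: "'a \<Rightarrow> complex" where "h x = of_real (\<bar>B\<bar> * indicator (cball 0 (R + Z)) x)" for x
  have [measurable]: "\<psi> \<in> borel_measurable borel" using c by (rule borel_measurable_continuous_onI)
  have "integrable lborel (\<lambda>x::'a. B\<^sup>2 * indicator (cball 0 (R + Z)) x :: real)"
    using emeasure_compact_finite[of "cball (0::'a) (R + Z)"]
    by (intro integrable_mult_right integrable_real_indicator) auto
  moreover have "(cmod (h x))\<^sup>2 = B\<^sup>2 * indicator (cball 0 (R + Z)) x" for x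
    by (auto simp: h_def indicator_def)
  moreover have "h \<in> borel_measurable borel" unfolding h_def
    by (intro measurable_compose[OF _ borel_measurable_of_real] borel_measurable_times borel_measurable_const borel_measurable_indicator) auto
  ultimately have h: "h \<in> L2" unfolding mem_L2 by simp
  show ?thesis
  proof (rule L2_dominated_convergence(2)[OF _ _ h])
    show "AE x in lborel. (\<lambda>n. \<psi> (x + z n)) \<longlonglongrightarrow> \<psi> x"
    proof (intro AE_I2)
      fix x
      have "(\<lambda>n. x + z n) \<longlonglongrightarrow> x" using tendsto_add[OF tendsto_const z, of x] by simp
      then show "(\<lambda>n. \<psi> (x + z n)) \<longlonglongrightarrow> \<psi> x"
        using c by (intro isCont_tendsto_compose[of x \<psi>]) (auto simp: continuous_on_eq_continuous_at)
    qed
    fix n x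
    show "cmod (\<psi> (x + z n)) \<le> cmod (h x)"
    proof (cases "x + z n \<in> supp \<psi>")
      case True
      then have "norm (x + z n) \<le> R" by (rule R)
      then have "norm x \<le> R + Z"
        using norm_triangle_ineq4[of "x + z n" "z n"] Z[of n] by simp
      then show ?thesis using B[of "x + z n"] True by (simp add: h_def)
    next
      case False
      then show ?thesis using B[of "x + z n"] by simp
    qed
  qed measurable
qed

text \<open>Translations are continuous in \<open>L\<^sup>2\<close>: this holds for test functions by dominated convergence, and the
  approximation error does not change under translation.\<close>

lemma L2inner_shift_continuous:
  fixes f :: "'a::euclidean_space \<Rightarrow> complex"
  assumes f: "f \<in> L2" and z: "z \<longlonglongrightarrow> 0"
  shows "(\<lambda>n. L2inner f (\<lambda>x. f (x + z n))) \<longlonglongrightarrow> of_real ((L2norm f)\<^sup>2)"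
proof -
  have lim: "(\<lambda>n. L2norm (\<lambda>x. f (x + z n) - f x)) \<longlonglongrightarrow> 0"
  proof (rule LIMSEQ_I)
    fix r :: real assume "r > 0"
    then have "r / 4 > 0" by simp
    then obtain \<psi> where \<psi>: "test_function UNIV \<psi>" "L2norm (\<lambda>x. f x - \<psi> x) < r / 4"
      using L2_test_functions_dense[OF f] unfolding L2_approximable_def by blast
    have p: "\<psi> \<in> L2" using \<psi>(1) by (rule test_function_L2)
    from \<open>r > 0\<close> order_tendstoD(2)[OF test_function_shift_continuous[OF \<psi>(1) z], of "r / 2"] obtain N where 
      N: "\<And>n. n \<ge> N \<Longrightarrow> L2norm (\<lambda>x. \<psi> (x + z n) - \<psi> x) < r / 2"
      by (auto simp: eventually_sequentially)
    show "\<exists>no. \<forall>n\<ge>no. norm (L2norm (\<lambda>x. f (x + z n) - f x) - 0) < r"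
    proof (intro exI[of _ N] allI impI)
      fix n assume n: "n \<ge> N"
      note sh = L2_shift[OF f, of "z n"] L2_shift[OF p, of "z n"] L2_shift[OF L2_diff[OF f p], of "z n"]
      have "L2norm (\<lambda>x. f (x + z n) - f x) \<le> L2norm (\<lambda>x. f (x + z n) - \<psi> (x + z n)) + L2norm (\<lambda>x. \<psi> (x + z n) - f x)"
        by (rule L2norm_triangle3) (use sh f in auto)
      also have "L2norm (\<lambda>x. \<psi> (x + z n) - f x) \<le> L2norm (\<lambda>x. \<psi> (x + z n) - \<psi> x) + L2norm (\<lambda>x. \<psi> x - f x)"
        by (rule L2norm_triangle3) (use sh f p in auto)
      finally show "norm (L2norm (\<lambda>x. f (x + z n) - f x) - 0) < r"
        using \<psi>(2) N[OF n] sh by (simp add: L2norm_minus_commute[of \<psi> f])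
    qed
  qed
  show ?thesis
  proof (rule Lim_transform[OF tendsto_const])
    show "(\<lambda>n. L2inner f (\<lambda>x. f (x + z n)) - of_real ((L2norm f)\<^sup>2)) \<longlonglongrightarrow> 0"
    proof (rule Lim_null_comparison)
      show "(\<lambda>n. L2norm (\<lambda>x. f (x + z n) - f x) * L2norm f) \<longlonglongrightarrow> 0"
        using tendsto_mult[OF lim tendsto_const[of "L2norm f"]] by simp
      show "\<forall>\<^sub>F n in sequentially. cmod (L2inner f (\<lambda>x. f (x + z n)) - of_real ((L2norm f)\<^sup>2)) \<le> L2norm (\<lambda>x. f (x + z n) - f x) * L2norm f"
      proof (intro always_eventually allI)
        fix n
        note sh = L2_shift[OF f, of "z n"]
        have "L2inner (\<lambda>x. f (x + z n)) f - L2inner f f = L2inner (\<lambda>x. f (x + z n) - f x) f"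
          using L2inner_diff_left[OF sh(1) f f] by simp
        then have "cnj (L2inner f (\<lambda>x. f (x + z n)) - of_real ((L2norm f)\<^sup>2)) = L2inner (\<lambda>x. f (x + z n) - f x) f"
          using L2inner_commute[of "\<lambda>x. f (x + z n)" f] L2inner_self[OF f] by simp
        then show "cmod (L2inner f (\<lambda>x. f (x + z n)) - of_real ((L2norm f)\<^sup>2)) \<le> L2norm (\<lambda>x. f (x + z n) - f x) * L2norm f"
          using L2inner_bound[OF L2_diff[OF sh(1) f] f] by (metis complex_mod_cnj)
      qed
    qed
  qed
qed

lemma gauss_bounds: "0 < gauss x" "gauss x \<le> 1" "gauss 0 = 1" "gauss (- x) = gauss x"
  by (auto simp: gauss_def)

lemma gauss_scaled_fourier:
  fixes y x :: "'a::euclidean_space"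
  assumes n: "n > 0"
  shows "integrable lborel (\<lambda>\<xi>::'a. gauss (\<xi> /\<^sub>R n))"
    and "fourier_int (\<lambda>\<xi>. cis (\<xi> \<bullet> x) * of_real (gauss (\<xi> /\<^sub>R n))) y 
      = of_real (n ^ DIM('a) * sqrt (plancherel_const TYPE('a)) * gauss (n *\<^sub>R (y - x)))"
proof -
  show "integrable lborel (\<lambda>\<xi>::'a. gauss (\<xi> /\<^sub>R n))"
    using lborel_integrable_affine[of "gauss::'a \<Rightarrow> real" "inverse n" 0] gauss_fourier(2) n by simp
  have "fourier_int (\<lambda>\<xi>. cis (\<xi> \<bullet> x) * of_real (gauss (\<xi> /\<^sub>R n))) y = 
     (\<integral>\<xi>. cis (- (\<xi> \<bullet> (y - x))) * of_real (gauss (\<xi> /\<^sub>R n)) \<partial>lborel)"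
    unfolding fourier_int_def
    by (intro Bochner_Integration.integral_cong refl) (simp add: mult.assoc[symmetric] cis_mult inner_diff_right)
  also have "\<dots> = \<bar>n\<bar> ^ DIM('a) *\<^sub>R (\<integral>\<xi>. cis (- ((0 + n *\<^sub>R \<xi>) \<bullet> (y - x))) * of_real (gauss ((0 + n *\<^sub>R \<xi>) /\<^sub>R n)) \<partial>lborel)"
    by (rule lborel_integral_affine) (use n in auto)
  also have "\<dots> = n ^ DIM('a) *\<^sub>R fourier_int (\<lambda>x. of_real (gauss x)) (n *\<^sub>R (y - x))"
    unfolding fourier_int_def using n by simp
  finally show "fourier_int (\<lambda>\<xi>. cis (\<xi> \<bullet> x) * of_real (gauss (\<xi> /\<^sub>R n))) y 
      = of_real (n ^ DIM('a) * sqrt (plancherel_const TYPE('a)) * gauss (n *\<^sub>R (y - x)))"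
    by (simp add: gauss_fourier scaleR_conv_of_real)
qed

text \<open>With a Gaussian weight the integral of \<open>|fourier_int f|\<^sup>2\<close> converges absolutely, and two applications of
  the multiplication formula express it by the autocorrelation of \<open>f\<close> averaged at scale \<open>1 / n\<close>.\<close>

lemma gauss_smoothed_plancherel:
  fixes f :: "'a::euclidean_space \<Rightarrow> complex"
  assumes fi: "integrable lborel f" and f2: "f \<in> L2" and n: "n > 0"
  shows "(\<integral>\<xi>. of_real ((cmod (fourier_int f \<xi>))\<^sup>2 * gauss (\<xi> /\<^sub>R n)) \<partial>lborel)
    = (\<integral>w. of_real (sqrt (plancherel_const TYPE('a)) * gauss w) * L2inner f (\<lambda>x. f (x + w /\<^sub>R n)) \<partial>lborel)"
proof -
  have fm [measurable]: "f \<in> borel_measurable borel" using f2 by (rule L2_measurable)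
  \<comment> \<open>\<open>K\<close> is the Fourier transform of the Gaussian weight, an approximate identity of mass \<open>(2 * pi) ^ d\<close>;
    \<open>h\<close> moves one factor of \<open>|fourier_int f|\<^sup>2\<close> and the weight to the other side of the multiplication formula.\<close>
  define K where "K z = n ^ DIM('a) * sqrt (plancherel_const TYPE('a)) * gauss (n *\<^sub>R z)" for z :: 'a
  define h where "h \<xi> = of_real (gauss (\<xi> /\<^sub>R n)) * cnj (fourier_int f \<xi>)" for \<xi>
  have cnjm [measurable]: "(\<lambda>\<xi>. cnj (fourier_int f \<xi>)) \<in> borel_measurable borel"
    by (rule measurable_compose[OF fourier_int_measurable[OF fm] borel_measurable_cnj])
  have gi: "integrable lborel (\<lambda>\<xi>. cis (\<xi> \<bullet> x) * complex_of_real (gauss (\<xi> /\<^sub>R n)))" for x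
    by (rule Bochner_Integration.integrable_bound[OF gauss_scaled_fourier(1)[OF n]]) (auto simp: norm_mult)
  have hi: "integrable lborel h"
  proof (rule Bochner_Integration.integrable_bound)
    show "integrable lborel (\<lambda>\<xi>::'a. (\<integral>x. cmod (f x) \<partial>lborel) * gauss (\<xi> /\<^sub>R n))"
      by (intro integrable_mult_right gauss_scaled_fourier n)
    show "AE \<xi> in lborel. norm (h \<xi>) \<le> norm ((\<integral>x. cmod (f x) \<partial>lborel) * gauss (\<xi> /\<^sub>R n))"
    proof (intro AE_I2)
      fix \<xi> :: 'a
      have "norm (h \<xi>) = gauss (\<xi> /\<^sub>R n) * cmod (fourier_int f \<xi>)"
        using gauss_bounds(1)[of "\<xi> /\<^sub>R n"] by (simp add: h_def norm_mult)
      also have "\<dots> \<le> gauss (\<xi> /\<^sub>R n) * (\<integral>x. cmod (f x) \<partial>lborel)"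
        using gauss_bounds(1)[of "\<xi> /\<^sub>R n"] fourier_int_bound[of f \<xi>] by (intro mult_left_mono) auto
      finally show "norm (h \<xi>) \<le> norm ((\<integral>x. cmod (f x) \<partial>lborel) * gauss (\<xi> /\<^sub>R n))"
        by (simp add: mult.commute)
    qed
  qed (unfold h_def, measurable)
  have "(\<integral>\<xi>. of_real ((cmod (fourier_int f \<xi>))\<^sup>2 * gauss (\<xi> /\<^sub>R n)) \<partial>lborel) = (\<integral>\<xi>. fourier_int f \<xi> * h \<xi> \<partial>lborel)"
    by (intro Bochner_Integration.integral_cong refl) (simp add: h_def complex_norm_square mult_ac del: of_real_power)
  also have "\<dots> = (\<integral>x. f x * fourier_int h x \<partial>lborel)"
    by (rule fourier_int_multiplication_formula[OF fi hi])
  also have "\<dots> = (\<integral>x. (\<integral>w. of_real (sqrt (plancherel_const TYPE('a)) * gauss w) * (f x * cnj (f (x + w /\<^sub>R n))) \<partial>lborel) \<partial>lborel)"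
  proof (intro Bochner_Integration.integral_cong refl)
    fix x
    have "fourier_int h x = cnj (\<integral>\<xi>. fourier_int f \<xi> * (cis (\<xi> \<bullet> x) * of_real (gauss (\<xi> /\<^sub>R n))) \<partial>lborel)"
      unfolding fourier_int_def[of h] h_def
      by (subst Bochner_Integration.integral_cnj[symmetric]) (simp add: cis_cnj mult_ac)
    also have "(\<integral>\<xi>. fourier_int f \<xi> * (cis (\<xi> \<bullet> x) * of_real (gauss (\<xi> /\<^sub>R n))) \<partial>lborel) = (\<integral>y. f y * of_real (K (y - x)) \<partial>lborel)"
      by (subst fourier_int_multiplication_formula[OF fi gi]) (simp add: gauss_scaled_fourier(2)[OF n] K_def)
    also have "\<dots> = \<bar>inverse n\<bar> ^ DIM('a) *\<^sub>R (\<integral>w. f (x + w /\<^sub>R n) * of_real (K ((x + w /\<^sub>R n) - x)) \<partial>lborel)"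
      unfolding K_def by (rule lborel_integral_affine) (use n in auto)
    also have "\<dots> = (\<integral>w. of_real (sqrt (plancherel_const TYPE('a)) * gauss w) * f (x + w /\<^sub>R n) \<partial>lborel)"
      unfolding integral_scaleR_right[symmetric] K_def
      using n by (intro Bochner_Integration.integral_cong refl) (simp add: scaleR_conv_of_real field_simps)
    finally have "f x * fourier_int h x = f x * (\<integral>w. cnj (of_real (sqrt (plancherel_const TYPE('a)) * gauss w) * f (x + w /\<^sub>R n)) \<partial>lborel)"
      by (simp only: Bochner_Integration.integral_cnj)
    also have "\<dots> = (\<integral>w. f x * cnj (of_real (sqrt (plancherel_const TYPE('a)) * gauss w) * f (x + w /\<^sub>R n)) \<partial>lborel)"
      by (rule integral_mult_right_zero[symmetric])
    finally show "f x * fourier_int h x = (\<integral>w. of_real (sqrt (plancherel_const TYPE('a)) * gauss w) * (f x * cnj (f (x + w /\<^sub>R n))) \<partial>lborel)"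
      by (simp add: mult_ac)
  qed
  also have "\<dots> = (\<integral>w. (\<integral>x. of_real (sqrt (plancherel_const TYPE('a)) * gauss w) * (f x * cnj (f (x + w /\<^sub>R n))) \<partial>lborel) \<partial>lborel)"
  proof (rule lborel_pair.Fubini_integral)
    let ?G = "\<lambda>w x. of_real (sqrt (plancherel_const TYPE('a)) * gauss w) * (f x * cnj (f (x + w /\<^sub>R n)))"
    have cm: "(\<lambda>x. cnj (f x)) \<in> borel_measurable borel" 
      by (rule measurable_compose[OF fm borel_measurable_cnj])
    have inti: "integrable lborel (?G w)" for w
      by (intro integrable_mult_right L2_integrable_mult f2 L2_cnj L2_shift)
    show "integrable (lborel \<Otimes>\<^sub>M lborel) (case_prod ?G)"
    proof (rule lborel_pair.Fubini_integrable)
      show "case_prod ?G \<in> borel_measurable (lborel \<Otimes>\<^sub>M lborel)"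
        using measurable_compose[OF _ cm, of "\<lambda>(w, x). x + w /\<^sub>R n" "lborel \<Otimes>\<^sub>M lborel"]
        by (simp add: case_prod_beta') measurable
      show "AE w in lborel. integrable lborel (\<lambda>x. case_prod ?G (w, x))" using inti by auto
      show "integrable lborel (\<lambda>w. \<integral>x. cmod (case_prod ?G (w, x)) \<partial>lborel)"
      proof (rule Bochner_Integration.integrable_bound)
        show "integrable lborel (\<lambda>w::'a. sqrt (plancherel_const TYPE('a)) * gauss w * (L2norm f * L2norm f))"
          by (intro integrable_mult_left integrable_mult_right gauss_fourier)
        show "(\<lambda>w. \<integral>x. cmod (case_prod ?G (w, x)) \<partial>lborel) \<in> borel_measurable lborel"
          using measurable_compose[OF _ cm, of "\<lambda>(w, x). x + w /\<^sub>R n" "lborel \<Otimes>\<^sub>M lborel"]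
          by (simp add: case_prod_beta') measurable
        show "AE w in lborel. norm (\<integral>x. cmod (case_prod ?G (w, x)) \<partial>lborel) \<le> norm (sqrt (plancherel_const TYPE('a)) * gauss w * (L2norm f * L2norm f))"
        proof (intro AE_I2)
          fix w :: 'a
          have "(\<integral>x. cmod (case_prod ?G (w, x)) \<partial>lborel) = sqrt (plancherel_const TYPE('a)) * gauss w * (\<integral>x. cmod (f x) * cmod (f (x + w /\<^sub>R n)) \<partial>lborel)"
            using gauss_bounds(1)[of w] by (simp add: norm_mult plancherel_const_def mult.assoc)
          also have "\<dots> \<le> sqrt (plancherel_const TYPE('a)) * gauss w * (L2norm f * L2norm (\<lambda>x. f (x + w /\<^sub>R n)))"
            using gauss_bounds(1)[of w] by (intro mult_left_mono Cauchy_Schwarz_norm f2 L2_shift) (auto simp: plancherel_const_def)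
          finally show "norm (\<integral>x. cmod (case_prod ?G (w, x)) \<partial>lborel) \<le> norm (sqrt (plancherel_const TYPE('a)) * gauss w * (L2norm f * L2norm f))"
            by (simp add: L2_shift(2)[OF f2] abs_of_nonneg)
        qed
      qed
    qed
  qed
  also have "\<dots> = (\<integral>w. of_real (sqrt (plancherel_const TYPE('a)) * gauss w) * L2inner f (\<lambda>x. f (x + w /\<^sub>R n)) \<partial>lborel)"
    by (simp add: L2inner_def)
  finally show ?thesis .
qed

lemma plancherel_const_pos [simp]: "plancherel_const TYPE('a::euclidean_space) > 0"
  by (simp add: plancherel_const_def)

text \<open>As the Gaussian weight tends to 1, the left side of \<open>gauss_smoothed_plancherel\<close> converges by monotone and the right
  side by dominated convergence.\<close>

theorem plancherel_L1_L2:
  fixes f :: "'a::euclidean_space \<Rightarrow> complex"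
  assumes fi: "integrable lborel f" and f2: "f \<in> L2"
  shows "fourier_int f \<in> L2" "L2norm (fourier_int f) = sqrt (plancherel_const TYPE('a)) * L2norm f"
proof -
  have fm [measurable]: "f \<in> borel_measurable borel" using f2 by (rule L2_measurable)
  let ?c = "sqrt (plancherel_const TYPE('a))"
  define G where "G n \<xi> = (cmod (fourier_int f \<xi>))\<^sup>2 * gauss (\<xi> /\<^sub>R real (Suc n))" for n and \<xi> :: 'a
  define A where "A n = (\<integral>w. of_real (?c * gauss w) * L2inner f (\<lambda>x. f (x + w /\<^sub>R real (Suc n))) \<partial>lborel)" for n :: nat
  have Geq: "complex_of_real (\<integral>\<xi>. G n \<xi> \<partial>lborel) = A n" for n
    unfolding A_def gauss_smoothed_plancherel[OF fi f2 of_nat_0_less_iff[THEN iffD2, OF zero_less_Suc], symmetric] G_def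
    by (simp only: integral_complex_of_real)
  have innerm: "(\<lambda>w. L2inner f (\<lambda>x. f (x + w /\<^sub>R real (Suc n)))) \<in> borel_measurable borel" for n
    unfolding L2inner_def
    by measurable
  have "A \<longlonglongrightarrow> (\<integral>w. of_real (?c * gauss (w::'a)) * of_real ((L2norm f)\<^sup>2) \<partial>lborel)"
    unfolding A_def
  proof (rule integral_dominated_convergence[where w = "\<lambda>w. ?c * gauss w * (L2norm f * L2norm f)"])
    show "integrable lborel (\<lambda>w::'a. ?c * gauss w * (L2norm f * L2norm f))"
      by (intro integrable_mult_left integrable_mult_right gauss_fourier)
    show "AE w in lborel. (\<lambda>n. of_real (?c * gauss w) * L2inner f (\<lambda>x. f (x + w /\<^sub>R real (Suc n))))
      \<longlonglongrightarrow> of_real (?c * gauss w) * of_real ((L2norm f)\<^sup>2)"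
    proof (intro AE_I2 tendsto_mult tendsto_const L2inner_shift_continuous f2)
      fix w :: 'a
      have "(\<lambda>n. inverse (real (Suc n)) *\<^sub>R w) \<longlonglongrightarrow> 0 *\<^sub>R w"
        by (intro tendsto_scaleR tendsto_const LIMSEQ_inverse_real_of_nat)
      then show "(\<lambda>n. w /\<^sub>R real (Suc n)) \<longlonglongrightarrow> 0" by simp
    qed
    show "AE w in lborel. norm (of_real (?c * gauss w) * L2inner f (\<lambda>x. f (x + w /\<^sub>R real (Suc n)))) \<le> ?c * gauss w * (L2norm f * L2norm f)" for n
    proof (intro AE_I2)
      fix w :: 'a
      have "cmod (L2inner f (\<lambda>x. f (x + w /\<^sub>R real (Suc n)))) \<le> L2norm f * L2norm f"
        using L2inner_bound[OF f2 L2_shift(1)[OF f2]] by (simp add: L2_shift(2)[OF f2])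
      then show "norm (of_real (?c * gauss w) * L2inner f (\<lambda>x. f (x + w /\<^sub>R real (Suc n)))) \<le> ?c * gauss w * (L2norm f * L2norm f)"
        using gauss_bounds(1)[of w] by (simp add: norm_mult mult_left_mono plancherel_const_def)
    qed
  qed (use innerm in measurable)
  also have "(\<integral>w. of_real (?c * gauss (w::'a)) * of_real ((L2norm f)\<^sup>2) \<partial>lborel) = complex_of_real (?c * (\<integral>w. gauss (w::'a) \<partial>lborel) * (L2norm f)\<^sup>2)"
    by (simp add: integral_complex_of_real del: of_real_power)
  also have "(\<integral>w. gauss (w::'a) \<partial>lborel) = ?c"
  proof -
    have "complex_of_real (\<integral>w. gauss (w::'a) \<partial>lborel) = fourier_int (\<lambda>x. of_real (gauss x)) (0::'a)"
      unfolding fourier_int_def by (simp add: integral_complex_of_real)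
    then show ?thesis by (simp only: gauss_fourier gauss_bounds of_real_eq_iff mult_1_right)
  qed
  finally have lim: "(\<lambda>n. \<integral>\<xi>. G n \<xi> \<partial>lborel) \<longlonglongrightarrow> ?c * ?c * (L2norm f)\<^sup>2"
    unfolding Geq[symmetric] tendsto_of_real_iff .
  have Gi: "integrable lborel (G n)" for n
  proof (rule Bochner_Integration.integrable_bound)
    show "integrable lborel (\<lambda>\<xi>::'a. (\<integral>x. cmod (f x) \<partial>lborel)\<^sup>2 * gauss (\<xi> /\<^sub>R real (Suc n)))"
      by (intro integrable_mult_right gauss_scaled_fourier) simp
    show "G n \<in> borel_measurable lborel" unfolding G_def by measurable
    show "AE \<xi> in lborel. norm (G n \<xi>) \<le> norm ((\<integral>x. cmod (f x) \<partial>lborel)\<^sup>2 * gauss (\<xi> /\<^sub>R real (Suc n)))"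
    proof (intro AE_I2)
      fix \<xi> :: 'a
      show "norm (G n \<xi>) \<le> norm ((\<integral>x. cmod (f x) \<partial>lborel)\<^sup>2 * gauss (\<xi> /\<^sub>R real (Suc n)))"
        unfolding G_def norm_mult using fourier_int_bound[of f \<xi>] by (intro mult_right_mono) (auto simp: power_mono)
    qed
  qed
  have g_mono: "mono (\<lambda>n. G n \<xi>)" for \<xi>
  proof (rule monoI)
    fix m n :: nat assume "m \<le> n"
    have eq: "(\<xi> /\<^sub>R real (Suc n)) \<bullet> (\<xi> /\<^sub>R real (Suc n)) = (\<xi> \<bullet> \<xi>) * (inverse (real (Suc n)))\<^sup>2" for n
      by (simp add: power2_eq_square)
    have "(inverse (real (Suc n)))\<^sup>2 \<le> (inverse (real (Suc m)))\<^sup>2"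
      using \<open>m \<le> n\<close> by (intro power_mono le_imp_inverse_le) auto
    then have "(\<xi> \<bullet> \<xi>) * (inverse (real (Suc n)))\<^sup>2 \<le> (\<xi> \<bullet> \<xi>) * (inverse (real (Suc m)))\<^sup>2"
      by (intro mult_left_mono) auto
    then have "gauss (\<xi> /\<^sub>R real (Suc m)) \<le> gauss (\<xi> /\<^sub>R real (Suc n))"
      unfolding gauss_def eq by simp
    then show "G m \<xi> \<le> G n \<xi>" unfolding G_def by (intro mult_left_mono) auto
  qed
  have g_lim: "(\<lambda>n. G n \<xi>) \<longlonglongrightarrow> (cmod (fourier_int f \<xi>))\<^sup>2" for \<xi>
  proof -
    have "(\<lambda>n. inverse (real (Suc n)) *\<^sub>R \<xi>) \<longlonglongrightarrow> 0 *\<^sub>R \<xi>"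
      by (intro tendsto_scaleR tendsto_const LIMSEQ_inverse_real_of_nat)
    then have "(\<lambda>n. gauss (\<xi> /\<^sub>R real (Suc n))) \<longlonglongrightarrow> exp (- (0 \<bullet> (0::'a)) / 2)"
      unfolding gauss_def by (intro tendsto_intros) auto
    then have "(\<lambda>n. G n \<xi>) \<longlonglongrightarrow> (cmod (fourier_int f \<xi>))\<^sup>2 * 1"
      unfolding G_def by (intro tendsto_intros) auto
    then show ?thesis by simp
  qed
  have g_pos: "0 \<le> G n \<xi>" for n \<xi>
    unfolding G_def using gauss_bounds(1)[of "\<xi> /\<^sub>R real (Suc n)"] by (intro mult_nonneg_nonneg) auto
  have fm2: "(\<lambda>\<xi>. (cmod (fourier_int f \<xi>))\<^sup>2) \<in> borel_measurable lborel" by measurable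
  have "integrable lborel (\<lambda>\<xi>. (cmod (fourier_int f \<xi>))\<^sup>2)"
    and eq: "(\<integral>\<xi>. (cmod (fourier_int f \<xi>))\<^sup>2 \<partial>lborel) = ?c * ?c * (L2norm f)\<^sup>2"
    using integral_monotone_convergence_nonneg[OF Gi AE_I2[OF g_mono] AE_I2[OF g_pos] AE_I2[OF g_lim] lim fm2]
    by auto
  then show *: "fourier_int f \<in> L2" by (simp add: mem_L2)
  have "L2norm (fourier_int f) = sqrt ((?c * L2norm f)\<^sup>2)"
    unfolding L2norm_eq[of "fourier_int f"] eq by (simp add: power2_eq_square mult_ac)
  then show "L2norm (fourier_int f) = ?c * L2norm f" by (simp add: plancherel_const_def)
qed

text \<open>Truncation to a ball is used on both sides of the transform: in \<open>x\<close> it defines the Plancherel transform, in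
  \<open>\<xi>\<close> it cuts off high frequencies.\<close>

definition trunc :: "real \<Rightarrow> ('a::euclidean_space \<Rightarrow> complex) \<Rightarrow> 'a \<Rightarrow> complex" where
  "trunc R f x = indicator (cball 0 R) x * f x"

lemma trunc_L2:
  assumes f: "f \<in> L2" shows "trunc R f \<in> L2" "L2norm (trunc R f) \<le> L2norm f"
proof -
  have fm: "f \<in> borel_measurable borel" using f by (rule L2_measurable)
  have m: "trunc R f \<in> borel_measurable borel"
    unfolding trunc_def using fm by (intro borel_measurable_times borel_measurable_indicator) auto
  show "trunc R f \<in> L2" "L2norm (trunc R f) \<le> L2norm f"
    by (rule L2_dominated[OF m f]; simp add: trunc_def indicator_def)+
qed

lemma trunc_integrable:
  assumes f: "f \<in> L2" shows "integrable lborel (trunc R f)"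
proof -
  have "integrable lborel (\<lambda>x. indicator (cball (0::'a) R) x :: real)"
    using emeasure_compact_finite[of "cball (0::'a) R"] by (intro integrable_real_indicator) auto
  moreover have "(cmod (indicator (cball 0 R) x))\<^sup>2 = indicator (cball 0 R) x" for x :: 'a
    by (auto simp: indicator_def)
  moreover have "(\<lambda>x::'a. indicator (cball 0 R) x :: complex) \<in> borel_measurable borel"
    by (intro borel_measurable_indicator) auto
  ultimately have "(\<lambda>x::'a. indicator (cball 0 R) x) \<in> L2" by (simp add: mem_L2)
  from L2_integrable_mult[OF this f] show ?thesis by (simp add: trunc_def[abs_def])
qed

lemma trunc_tendsto:
  assumes f: "f \<in> L2" shows "((\<lambda>R. L2norm (\<lambda>x. trunc R f x - f x)) \<longlongrightarrow> 0) at_top"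
proof (rule tendsto_at_topI_sequentially)
  fix X :: "nat \<Rightarrow> real" assume X: "filterlim X at_top sequentially"
  show "(\<lambda>n. L2norm (\<lambda>x. trunc (X n) f x - f x)) \<longlonglongrightarrow> 0"
  proof (rule L2_dominated_convergence(2)[OF _ _ f])
    show "trunc (X n) f \<in> borel_measurable borel" for n using trunc_L2[OF f] by auto
    show "AE x in lborel. (\<lambda>n. trunc (X n) f x) \<longlonglongrightarrow> f x"
    proof (intro AE_I2)
      fix x :: 'a
      have "eventually (\<lambda>n. X n \<ge> norm x) sequentially"
        using X by (auto simp: filterlim_at_top)
      then have "eventually (\<lambda>n. f x = trunc (X n) f x) sequentially"
        by eventually_elim (simp add: trunc_def)
      then show "(\<lambda>n. trunc (X n) f x) \<longlonglongrightarrow> f x" by (rule Lim_transform_eventually[OF tendsto_const])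
    qed
  qed (use f in \<open>auto simp: trunc_def indicator_def\<close>)
qed

lemma trunc_fourier_eq: "trunc_fourier R f = fourier_int (trunc R f)"
  by (rule ext, unfold trunc_fourier_def fourier_int_def trunc_def set_lebesgue_integral_def)
     (intro Bochner_Integration.integral_cong refl, simp add: scaleR_conv_of_real indicator_def)

text \<open>All functions involved are square integrable, so the extended integral in the definition is a squared norm.\<close>

lemma is_fourier_iff:
  "is_fourier f F \<longleftrightarrow> f \<in> L2 \<and> F \<in> L2 \<and> ((\<lambda>R. L2norm (\<lambda>\<xi>. fourier_int (trunc R f) \<xi> - F \<xi>)) \<longlongrightarrow> 0) at_top"
proof (cases "f \<in> L2 \<and> F \<in> L2")
  case True
  have m: "(\<lambda>\<xi>. fourier_int (trunc R f) \<xi> - F \<xi>) \<in> L2" for R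
    using True by (intro L2_diff plancherel_L1_L2 trunc_integrable trunc_L2) auto
  have "((\<lambda>R. ennreal ((L2norm (\<lambda>\<xi>. fourier_int (trunc R f) \<xi> - F \<xi>))\<^sup>2)) \<longlongrightarrow> 0) at_top \<longleftrightarrow>
    ((\<lambda>R. L2norm (\<lambda>\<xi>. fourier_int (trunc R f) \<xi> - F \<xi>)) \<longlongrightarrow> 0) at_top" (is "?A \<longleftrightarrow> ?B")
  proof
    assume ?A
    then have "((\<lambda>R. (L2norm (\<lambda>\<xi>. fourier_int (trunc R f) \<xi> - F \<xi>))\<^sup>2) \<longlongrightarrow> 0) at_top"
      by (simp add: tendsto_ennreal_iff flip: ennreal_0)
    then have "((\<lambda>R. sqrt ((L2norm (\<lambda>\<xi>. fourier_int (trunc R f) \<xi> - F \<xi>))\<^sup>2)) \<longlongrightarrow> sqrt 0) at_top"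
      by (rule tendsto_real_sqrt)
    then show ?B by simp
  next
    assume ?B
    from tendsto_power[OF this, of 2] have "((\<lambda>R. (L2norm (\<lambda>\<xi>. fourier_int (trunc R f) \<xi> - F \<xi>))\<^sup>2) \<longlongrightarrow> 0) at_top"
      by simp
    from tendsto_ennrealI[OF this] show ?A by simp
  qed
  then show ?thesis using True 
    by (simp add: is_fourier_def trunc_fourier_eq nn_integral_L2[OF m])
qed (auto simp: is_fourier_def)

lemma is_fourier_L2: "is_fourier f F \<Longrightarrow> f \<in> L2" "is_fourier f F \<Longrightarrow> F \<in> L2"
  by (auto simp: is_fourier_def)

lemma fourier_int_add:
  "integrable lborel f \<Longrightarrow> integrable lborel g \<Longrightarrow> fourier_int (\<lambda>x. f x + g x) \<xi> = fourier_int f \<xi> + fourier_int g \<xi>"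
  unfolding fourier_int_def 
  by (simp add: distrib_left cis_integrable Bochner_Integration.integral_add)

lemma fourier_int_cmult: "fourier_int (\<lambda>x. c * f x) \<xi> = c * fourier_int f \<xi>"
  unfolding fourier_int_def by (simp add: mult.left_commute)

lemma is_fourier_add:
  assumes "is_fourier f F" "is_fourier g G"
  shows "is_fourier (\<lambda>x. f x + g x) (\<lambda>\<xi>. F \<xi> + G \<xi>)"
proof -
  note L = is_fourier_L2[OF assms(1)] is_fourier_L2[OF assms(2)]
  have tr: "trunc R (\<lambda>x. f x + g x) = (\<lambda>x. trunc R f x + trunc R g x)" for R
    by (auto simp: trunc_def fun_eq_iff distrib_left)
  have FL: "fourier_int (trunc R f) \<in> L2" "fourier_int (trunc R g) \<in> L2" for R
    using L by (auto intro: plancherel_L1_L2 trunc_integrable trunc_L2)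
  have "((\<lambda>R. L2norm (\<lambda>\<xi>. fourier_int (trunc R f) \<xi> - F \<xi>) + L2norm (\<lambda>\<xi>. fourier_int (trunc R g) \<xi> - G \<xi>)) \<longlongrightarrow> 0 + 0) at_top"
    using assms by (intro tendsto_add) (auto simp: is_fourier_iff)
  then have lim: "((\<lambda>R. L2norm (\<lambda>\<xi>. fourier_int (trunc R f) \<xi> - F \<xi>) + L2norm (\<lambda>\<xi>. fourier_int (trunc R g) \<xi> - G \<xi>)) \<longlongrightarrow> 0) at_top"
    by simp
  have "((\<lambda>R. L2norm (\<lambda>\<xi>. fourier_int (trunc R (\<lambda>x. f x + g x)) \<xi> - (F \<xi> + G \<xi>))) \<longlongrightarrow> 0) at_top"
  proof (rule Lim_null_comparison[OF always_eventually lim], rule allI)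
    fix R
    have "L2norm (\<lambda>\<xi>. (fourier_int (trunc R f) \<xi> - F \<xi>) + (fourier_int (trunc R g) \<xi> - G \<xi>)) \<le>
      L2norm (\<lambda>\<xi>. fourier_int (trunc R f) \<xi> - F \<xi>) + L2norm (\<lambda>\<xi>. fourier_int (trunc R g) \<xi> - G \<xi>)"
      using FL[of R] L by (intro L2norm_triangle) auto
    then show "norm (L2norm (\<lambda>\<xi>. fourier_int (trunc R (\<lambda>x. f x + g x)) \<xi> - (F \<xi> + G \<xi>))) \<le>
      L2norm (\<lambda>\<xi>. fourier_int (trunc R f) \<xi> - F \<xi>) + L2norm (\<lambda>\<xi>. fourier_int (trunc R g) \<xi> - G \<xi>)"
      using L by (simp add: tr fourier_int_add trunc_integrable algebra_simps)
  qed
  then show ?thesis using L by (auto simp: is_fourier_iff)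
qed

lemma is_fourier_cmult:
  assumes "is_fourier f F" 
  shows "is_fourier (\<lambda>x. c * f x) (\<lambda>\<xi>. c * F \<xi>)"
proof -
  note L = is_fourier_L2[OF assms(1)] 
  have tr: "trunc R (\<lambda>x. c * f x) = (\<lambda>x. c * trunc R f x)" for R
    by (auto simp: trunc_def fun_eq_iff)
  have eq: "L2norm (\<lambda>\<xi>. fourier_int (trunc R (\<lambda>x. c * f x)) \<xi> - c * F \<xi>) = cmod c * L2norm (\<lambda>\<xi>. fourier_int (trunc R f) \<xi> - F \<xi>)" for R
    by (simp add: tr fourier_int_cmult L2norm_mult_const[symmetric] right_diff_distrib)
  have "((\<lambda>R. cmod c * L2norm (\<lambda>\<xi>. fourier_int (trunc R f) \<xi> - F \<xi>)) \<longlongrightarrow> cmod c * 0) at_top"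
    using assms by (intro tendsto_mult tendsto_const) (auto simp: is_fourier_iff)
  then show ?thesis using L by (auto simp: is_fourier_iff eq)
qed

lemma is_fourier_diff:
  assumes "is_fourier f F" "is_fourier g G"
  shows "is_fourier (\<lambda>x. f x - g x) (\<lambda>\<xi>. F \<xi> - G \<xi>)"
  using is_fourier_add[OF assms(1) is_fourier_cmult[OF assms(2), of "-1"]] by simp

lemma fourier_int_trunc_tendsto:
  assumes "is_fourier f F"
  shows "((\<lambda>R. L2norm (\<lambda>\<xi>. fourier_int (trunc R f) \<xi> - F \<xi>)) \<longlongrightarrow> 0) at_top"
  using assms by (simp add: is_fourier_iff)

lemma plancherel:
  fixes f :: "'a::euclidean_space \<Rightarrow> complex"
  assumes "is_fourier f F"
  shows "L2norm F = sqrt (plancherel_const TYPE('a)) * L2norm f"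
proof -
  note L = is_fourier_L2[OF assms(1)] 
  have FL: "fourier_int (trunc R f) \<in> L2" for R
    using L by (auto intro: plancherel_L1_L2 trunc_integrable trunc_L2)
  have "((\<lambda>R. L2norm (fourier_int (trunc R f))) \<longlongrightarrow> L2norm F) at_top"
    by (rule L2norm_tendsto[OF FL L(2) fourier_int_trunc_tendsto[OF assms]])
  moreover have "((\<lambda>R. sqrt (plancherel_const TYPE('a)) * L2norm (trunc R f)) \<longlongrightarrow> sqrt (plancherel_const TYPE('a)) * L2norm f) at_top"
    by (intro tendsto_mult tendsto_const L2norm_tendsto trunc_L2 L trunc_tendsto)
  moreover have "L2norm (fourier_int (trunc R f)) = sqrt (plancherel_const TYPE('a)) * L2norm (trunc R f)" for R
    by (rule plancherel_L1_L2[OF trunc_integrable[OF L(1)] trunc_L2(1)[OF L(1)]])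
  ultimately show ?thesis by (auto intro: tendsto_unique[rotated])
qed

lemma is_fourier_unique:
  assumes "is_fourier f F" "is_fourier f G"
  shows "AE \<xi> in lborel. F \<xi> = G \<xi>"
proof -
  have "is_fourier (\<lambda>x. f x - f x) (\<lambda>\<xi>. F \<xi> - G \<xi>)" using assms by (rule is_fourier_diff)
  from plancherel[OF this] L2norm_eq_0_AE[OF is_fourier_L2(2)[OF this]] show ?thesis by simp
qed

text \<open>Polarisation: the real part of the inner product is a combination of squared norms, and the imaginary part is the
  real part after multiplication by \<open>\<i>\<close>.\<close>

lemma parseval:
  fixes f :: "'a::euclidean_space \<Rightarrow> complex"
  assumes f: "is_fourier f F" and g: "is_fourier g G"
  shows "L2inner F G = of_real (plancherel_const TYPE('a)) * L2inner f g"
proof -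
  let ?c = "plancherel_const TYPE('a)"
  have re: "Re (L2inner F G) = ?c * Re (L2inner f g)" if f: "is_fourier f F" and g: "is_fourier g G" for f F g G :: "'a \<Rightarrow> complex"
  proof -
    note L = is_fourier_L2[OF f] is_fourier_L2[OF g]
    have sq: "(L2norm H)\<^sup>2 = ?c * (L2norm h)\<^sup>2" if "is_fourier h H" for h H :: "'a \<Rightarrow> complex"
      using plancherel[OF that] by (simp add: power_mult_distrib less_imp_le)
    have "(L2norm (\<lambda>\<xi>. F \<xi> + G \<xi>))\<^sup>2 = ?c * (L2norm (\<lambda>x. f x + g x))\<^sup>2"
      by (rule sq[OF is_fourier_add[OF f g]])
    then have "2 * Re (L2inner F G) = 2 * (?c * Re (L2inner f g))"
      using L sq[OF f] sq[OF g] by (simp add: L2norm_add_sq algebra_simps)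
    then show ?thesis by simp
  qed
  have "Re (L2inner (\<lambda>\<xi>. \<i> * F \<xi>) G) = ?c * Re (L2inner (\<lambda>x. \<i> * f x) g)"
    by (rule re[OF is_fourier_cmult[OF f] g])
  then have "Im (L2inner F G) = ?c * Im (L2inner f g)"
    by (simp add: L2inner_mult_left)
  with re[OF f g] show ?thesis by (simp add: complex_eq_iff)
qed

section \<open>Splitting into low and high frequencies\<close>

text \<open>The inverse Fourier integral of the truncated transform, written with the forward integral at \<open>- x\<close>.\<close>

definition low_pass :: "real \<Rightarrow> ('a::euclidean_space \<Rightarrow> complex) \<Rightarrow> 'a \<Rightarrow> complex" where
  "low_pass A F x = fourier_int (trunc A F) (- x) / of_real (plancherel_const TYPE('a))"

lemma low_pass_bound: 
  fixes F :: "'a::euclidean_space \<Rightarrow> complex"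
  shows "cmod (low_pass A F x) \<le> (\<integral>\<xi>. cmod (trunc A F \<xi>) \<partial>lborel) / plancherel_const TYPE('a)"
  unfolding low_pass_def using fourier_int_bound[of "trunc A F" "- x"]
  by (simp add: norm_divide divide_right_mono less_imp_le abs_of_pos[OF plancherel_const_pos])

lemma low_pass_L2:
  fixes F :: "'a::euclidean_space \<Rightarrow> complex"
  assumes "F \<in> L2" 
  shows "low_pass A F \<in> L2" "L2norm (low_pass A F) = L2norm (trunc A F) / sqrt (plancherel_const TYPE('a))"
proof -
  note P = plancherel_L1_L2[OF trunc_integrable[OF assms, of A] trunc_L2(1)[OF assms, of A]]
  note Q = L2_reflect[OF P(1)]
  show "low_pass A F \<in> L2" unfolding low_pass_def[abs_def] by (intro L2_divide Q)
  have sq: "sqrt (plancherel_const TYPE('a)) * sqrt (plancherel_const TYPE('a)) = plancherel_const TYPE('a)" by (simp add: plancherel_const_def)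
  have "sqrt (plancherel_const TYPE('a)) * L2norm (trunc A F) / (sqrt (plancherel_const TYPE('a)) * sqrt (plancherel_const TYPE('a))) = L2norm (trunc A F) / sqrt (plancherel_const TYPE('a))"
    by (rule mult_divide_mult_cancel_left) (simp add: plancherel_const_def)
  then show "L2norm (low_pass A F) = L2norm (trunc A F) / sqrt (plancherel_const TYPE('a))"
    unfolding low_pass_def[abs_def] L2norm_divide Q P norm_of_real abs_of_pos[OF plancherel_const_pos] sq .
qed

lemma L2inner_tendsto:
  assumes "\<And>i. f i \<in> L2" "g \<in> L2" "h \<in> L2" "((\<lambda>i. L2norm (\<lambda>x. f i x - g x)) \<longlongrightarrow> 0) F"
  shows "((\<lambda>i. L2inner (f i) h) \<longlongrightarrow> L2inner g h) F"
proof (rule Lim_transform[OF tendsto_const])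
  show "((\<lambda>i. L2inner (f i) h - L2inner g h) \<longlongrightarrow> 0) F"
  proof (rule Lim_null_comparison[OF always_eventually])
    show "((\<lambda>i. L2norm (\<lambda>x. f i x - g x) * L2norm h) \<longlongrightarrow> 0) F"
      using tendsto_mult[OF assms(4) tendsto_const[of "L2norm h"]] by simp
    show "\<forall>i. cmod (L2inner (f i) h - L2inner g h) \<le> L2norm (\<lambda>x. f i x - g x) * L2norm h"
      using L2inner_bound[OF L2_diff[OF assms(1,2)] assms(3)] L2inner_diff_left[OF assms(1,2,3)] by simp
  qed
qed

text \<open>Expanding the square leaves the inner product of \<open>f\<close> with its low frequencies, which the multiplication formula
  moves to the Fourier side. This takes the place of an inversion theorem.\<close>

lemma high_pass_norm:
  fixes f :: "'a::euclidean_space \<Rightarrow> complex"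
  assumes f: "is_fourier f F" 
  shows "(L2norm (\<lambda>x. f x - low_pass A F x))\<^sup>2 = (L2norm (\<lambda>\<xi>. F \<xi> - trunc A F \<xi>))\<^sup>2 / plancherel_const TYPE('a)"
proof -
  let ?c = "plancherel_const TYPE('a)" and ?P = "trunc A F"
  note L = is_fourier_L2[OF f]
  have PL: "?P \<in> L2" "integrable lborel ?P" using L by (auto intro: trunc_L2 trunc_integrable)
  have cl: "cnj (low_pass A F x) = fourier_int (\<lambda>\<xi>. cnj (?P \<xi>)) x / of_real ?c" for x
    unfolding low_pass_def fourier_int_def 
    by (simp add: Bochner_Integration.integral_cnj[symmetric] cis_cnj)
  have eqR: "L2inner (trunc R f) (low_pass A F) = L2inner (fourier_int (trunc R f)) ?P / of_real ?c" for R
  proof -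
    have ci: "integrable lborel (\<lambda>\<xi>. cnj (?P \<xi>))" using PL(2) by simp
    have "L2inner (trunc R f) (low_pass A F) = (\<integral>x. trunc R f x * fourier_int (\<lambda>\<xi>. cnj (?P \<xi>)) x \<partial>lborel) / of_real ?c"
      unfolding L2inner_def cl by simp
    also have "(\<integral>x. trunc R f x * fourier_int (\<lambda>\<xi>. cnj (?P \<xi>)) x \<partial>lborel) = (\<integral>\<xi>. fourier_int (trunc R f) \<xi> * cnj (?P \<xi>) \<partial>lborel)"
      by (rule fourier_int_multiplication_formula[OF trunc_integrable[OF L(1)] ci, symmetric])
    finally show ?thesis by (simp add: L2inner_def)
  qed
  have FL: "fourier_int (trunc R f) \<in> L2" for R
    using L by (auto intro: plancherel_L1_L2 trunc_integrable trunc_L2)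
  have "((\<lambda>R. L2inner (trunc R f) (low_pass A F)) \<longlongrightarrow> L2inner f (low_pass A F)) at_top"
    by (intro L2inner_tendsto trunc_L2 trunc_tendsto L low_pass_L2)
  moreover have "((\<lambda>R. L2inner (fourier_int (trunc R f)) ?P / of_real ?c) \<longlongrightarrow> L2inner F ?P / of_real ?c) at_top"
    by (intro tendsto_divide tendsto_const L2inner_tendsto FL L PL fourier_int_trunc_tendsto[OF f])
       (simp add: plancherel_const_def)
  ultimately have eq: "L2inner f (low_pass A F) = L2inner F ?P / of_real ?c"
    unfolding eqR by (auto intro: tendsto_unique[rotated])
  have self: "L2inner F ?P = of_real ((L2norm ?P)\<^sup>2)"
  proof -
    have "L2inner F ?P = L2inner ?P ?P"
      unfolding L2inner_def by (intro Bochner_Integration.integral_cong) (auto simp: trunc_def indicator_def)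
    then show ?thesis by (simp add: L2inner_self PL)
  qed
  have diff_sq: "(L2norm (\<lambda>x. u x - v x))\<^sup>2 = (L2norm u)\<^sup>2 - 2 * Re (L2inner u v) + (L2norm v)\<^sup>2"
    if "u \<in> L2" "v \<in> L2" for u v :: "'a \<Rightarrow> complex"
    using L2norm_add_sq[OF that(1) L2_uminus[OF that(2)]] by (simp add: L2norm_uminus L2inner_def)
  have lp: "(L2norm (low_pass A F))\<^sup>2 = (L2norm ?P)\<^sup>2 / ?c"
    by (simp add: low_pass_L2 L power_divide less_imp_le)
  have ff: "(L2norm F)\<^sup>2 = ?c * (L2norm f)\<^sup>2"
    using plancherel[OF f] by (simp add: power_mult_distrib less_imp_le)
  have "(L2norm (\<lambda>x. f x - low_pass A F x))\<^sup>2 = (L2norm f)\<^sup>2 - 2 * ((L2norm ?P)\<^sup>2 / ?c) + (L2norm ?P)\<^sup>2 / ?c"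
    by (subst diff_sq[OF L(1) low_pass_L2(1)[OF L(2)]]) (simp add: eq self lp flip: of_real_divide of_real_power)
  moreover have "(L2norm (\<lambda>\<xi>. F \<xi> - ?P \<xi>))\<^sup>2 = (L2norm F)\<^sup>2 - 2 * (L2norm ?P)\<^sup>2 + (L2norm ?P)\<^sup>2"
    by (subst diff_sq[OF L(2) PL(1)]) (simp add: self flip: of_real_power)
  ultimately have "(L2norm (\<lambda>\<xi>. F \<xi> - ?P \<xi>))\<^sup>2 = ?c * (L2norm (\<lambda>x. f x - low_pass A F x))\<^sup>2"
    using less_imp_neq[OF plancherel_const_pos[where 'a='a]] by (simp add: ff field_simps)
  then show ?thesis
    using less_imp_neq[OF plancherel_const_pos[where 'a='a]] by simp
qed

section \<open>The fractional Sobolev inequality\<close>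

lemma nn_integral_lborel_scale:
  fixes f :: "'a::euclidean_space \<Rightarrow> ennreal"
  assumes "f \<in> borel_measurable borel" "c > 0"
  shows "(\<integral>\<^sup>+x. f x \<partial>lborel) = ennreal (c ^ DIM('a)) * (\<integral>\<^sup>+x. f (c *\<^sub>R x) \<partial>lborel)"
  using assms by (subst lborel_affine[of c 0]) (simp_all add: nn_integral_density nn_integral_distr nn_integral_cmult)

lemma ennreal_le_suminf: "t n \<le> (\<Sum>n. t n :: ennreal)"
  using sum_le_suminf[OF summableI, of "{n}" t] by simp

text \<open>Summation over dyadic shells; the condition \<open>2 s < d\<close> makes the geometric series converge.\<close>

lemma inverse_power_ball_finite:
  assumes s: "s > 0" "real DIM('a::euclidean_space) > 2 * s"
  shows "(\<integral>\<^sup>+(\<xi>::'a). indicator (cball 0 1) \<xi> * ennreal (norm \<xi> powr (- 2 * s)) \<partial>lborel) < \<infinity>"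
proof -
  let ?d = "real DIM('a)"
  define a where "a n = 2 powr (2 * s * (real n + 1))" for n
  define q where "q = 2 powr (2 * s - ?d)"
  define v where "v = unit_ball_vol ?d"
  have q: "0 < q" "q < 1" using s by (auto simp: q_def powr_less_one)
  have v: "v \<ge> 0" unfolding v_def by (simp add: unit_ball_vol_nonneg)
  have "(\<integral>\<^sup>+(\<xi>::'a). indicator (cball 0 1) \<xi> * ennreal (norm \<xi> powr (- 2 * s)) \<partial>lborel)
    \<le> (\<integral>\<^sup>+(\<xi>::'a). (\<Sum>n. ennreal (a n) * indicator (cball 0 (2 powr - real n)) \<xi>) \<partial>lborel)"
  proof (rule nn_integral_mono)
    fix \<xi> :: 'a
    show "indicator (cball 0 1) \<xi> * ennreal (norm \<xi> powr (- 2 * s)) \<le> (\<Sum>n. ennreal (a n) * indicator (cball 0 (2 powr - real n)) \<xi>)"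
    proof (cases "\<xi> = 0 \<or> norm \<xi> > 1")
      case False
      \<comment> \<open>\<open>n\<close> is the dyadic shell of \<open>\<xi>\<close>: \<open>2 powr -(n + 1) < norm \<xi> \<le> 2 powr -n\<close>.\<close>
      define n where "n = nat \<lfloor>- log 2 (norm \<xi>)\<rfloor>"
      have pos: "norm \<xi> > 0" "norm \<xi> \<le> 1" using False by auto
      then have "log 2 (norm \<xi>) \<le> 0" by simp
      then have n: "real n \<le> - log 2 (norm \<xi>)" "- log 2 (norm \<xi>) < real n + 1"
        unfolding n_def by linarith+
      have "log 2 (norm \<xi>) \<le> - real n" using n by linarith
      then have 1: "norm \<xi> \<le> 2 powr (- real n)" using pos by (simp add: log_le_iff)
      have "norm \<xi> powr (- 2 * s) = 2 powr (log 2 (norm \<xi>) * (- 2 * s))"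
        using pos by (simp add: powr_def log_def)
      also have "\<dots> \<le> 2 powr (2 * s * (real n + 1))"
      proof (rule powr_mono)
        have "(2 * s) * (- log 2 (norm \<xi>)) \<le> (2 * s) * (real n + 1)"
          using n s by (intro mult_left_mono) auto
        then show "log 2 (norm \<xi>) * (- 2 * s) \<le> 2 * s * (real n + 1)" by (simp add: algebra_simps)
      qed simp
      finally have "indicator (cball 0 1) \<xi> * ennreal (norm \<xi> powr (- 2 * s)) \<le> ennreal (a n) * indicator (cball 0 (2 powr - real n)) \<xi>"
        using pos 1 by (simp add: a_def ennreal_leI)
      also have "\<dots> \<le> (\<Sum>n. ennreal (a n) * indicator (cball 0 (2 powr - real n)) \<xi>)"
        by (rule ennreal_le_suminf)
      finally show ?thesis .
    qed auto
  qed
  also have "\<dots> = (\<Sum>n. ennreal (a n) * emeasure lborel (cball (0::'a) (2 powr - real n)))"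
    by (subst nn_integral_suminf) (auto simp: nn_integral_cmult_indicator intro!: borel_measurable_times_ennreal borel_measurable_indicator)
  also have "\<dots> = (\<Sum>n. ennreal (2 powr (2 * s) * v * q ^ n))"
  proof (intro suminf_cong)
    fix n
    have eq: "a n * (v * (2 powr - real n) ^ DIM('a)) = 2 powr (2 * s) * v * q ^ n"
      unfolding a_def q_def
      by (simp add: powr_realpow[symmetric] powr_powr powr_add[symmetric] algebra_simps)
    have "emeasure lborel (cball (0::'a) (2 powr - real n)) = ennreal (v * (2 powr - real n) ^ DIM('a))"
      unfolding v_def by (rule emeasure_cball) simp
    then show "ennreal (a n) * emeasure lborel (cball (0::'a) (2 powr - real n)) = ennreal (2 powr (2 * s) * v * q ^ n)"
      unfolding eq[symmetric] by (simp only: ennreal_mult'[symmetric] a_def powr_ge_zero)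
  qed
  also have "\<dots> < \<infinity>"
  proof -
    have "summable (\<lambda>n. 2 powr (2 * s) * v * q ^ n)"
      by (rule summable_mult[OF summable_geometric]) (use q in simp)
    then have "(\<Sum>n. ennreal (2 powr (2 * s) * v * q ^ n)) = ennreal (\<Sum>n. 2 powr (2 * s) * v * q ^ n)"
      using q v by (intro suminf_ennreal2 mult_nonneg_nonneg zero_le_power) auto
    then show ?thesis by (simp only: ennreal_less_top infinity_ennreal_def)
  qed
  finally show ?thesis .
qed

text \<open>Cauchy-Schwarz with the weight \<open>|\<xi>|\<^sup>s\<close>, whose inverse is square integrable on balls. The power of \<open>A\<close>
  comes from scaling and is the one that makes the Sobolev exponent critical.\<close>

lemma low_frequency_bound:
  assumes s: "s > 0" "real DIM('a::euclidean_space) > 2 * s"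
  shows "\<exists>c>0. \<forall>A>0. \<forall>F::'a \<Rightarrow> complex. F \<in> L2 \<longrightarrow> (\<lambda>\<xi>. of_real (norm \<xi> powr s) * F \<xi>) \<in> L2 \<longrightarrow>
     (\<integral>\<xi>. cmod (trunc A F \<xi>) \<partial>lborel) \<le> c * A powr ((real DIM('a) - 2 * s) / 2) * L2norm (\<lambda>\<xi>. of_real (norm \<xi> powr s) * F \<xi>)"
proof -
  let ?d = "real DIM('a)"
  define J where "J A = (\<integral>\<^sup>+(\<xi>::'a). indicator (cball 0 A) \<xi> * ennreal (norm \<xi> powr (- 2 * s)) \<partial>lborel)" for A
  have J1: "J 1 < \<infinity>" unfolding J_def by (rule inverse_power_ball_finite[OF s])
  define \<kappa> where "\<kappa> = enn2real (J 1)"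
  have \<kappa>: "J 1 = ennreal \<kappa>" "\<kappa> \<ge> 0" using J1 by (auto simp: \<kappa>_def less_top)
  have JA: "J A = ennreal (A powr (?d - 2 * s) * \<kappa>)" if A: "A > 0" for A
  proof -
    have [measurable]: "cball (0::'a) r \<in> sets borel" for r by simp
    have m: "(\<lambda>\<xi>::'a. indicator (cball 0 A) \<xi> * ennreal (norm \<xi> powr (- 2 * s))) \<in> borel_measurable borel"
      by measurable
    have "J A = ennreal (A ^ DIM('a)) * (\<integral>\<^sup>+(\<xi>::'a). indicator (cball 0 A) (A *\<^sub>R \<xi>) * ennreal (norm (A *\<^sub>R \<xi>) powr (- 2 * s)) \<partial>lborel)"
      unfolding J_def by (rule nn_integral_lborel_scale[OF m A])
    also have "(\<integral>\<^sup>+(\<xi>::'a). indicator (cball 0 A) (A *\<^sub>R \<xi>) * ennreal (norm (A *\<^sub>R \<xi>) powr (- 2 * s)) \<partial>lborel)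
      = (\<integral>\<^sup>+(\<xi>::'a). ennreal (A powr (- 2 * s)) * (indicator (cball 0 1) \<xi> * ennreal (norm \<xi> powr (- 2 * s))) \<partial>lborel)"
    proof (intro nn_integral_cong)
      fix \<xi> :: 'a
      have "A *\<^sub>R \<xi> \<in> cball 0 A \<longleftrightarrow> \<xi> \<in> cball 0 1" using A by simp
      then show "indicator (cball 0 A) (A *\<^sub>R \<xi>) * ennreal (norm (A *\<^sub>R \<xi>) powr (- 2 * s))
        = ennreal (A powr (- 2 * s)) * (indicator (cball 0 1) \<xi> * ennreal (norm \<xi> powr (- 2 * s)))"
        using A by (auto simp: indicator_def powr_mult ennreal_mult')
    qed
    also have "\<dots> = ennreal (A powr (- 2 * s)) * J 1"
      unfolding J_def
      by (rule nn_integral_cmult) measurable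
    also have "ennreal (A ^ DIM('a)) * \<dots> = ennreal (A ^ DIM('a) * (A powr (- 2 * s) * \<kappa>))"
      using A \<kappa> by (simp add: ennreal_mult'[symmetric])
    also have "A ^ DIM('a) * (A powr (- 2 * s) * \<kappa>) = A powr (?d - 2 * s) * \<kappa>"
      using A by (simp add: powr_realpow[symmetric] powr_add[symmetric])
    finally show ?thesis .
  qed
  \<comment> \<open>The summand 1 makes the constant positive.\<close>
  define c where "c = sqrt (\<kappa> + 1)"
  show ?thesis
  proof (intro exI[of _ c] conjI allI impI)
    show "c > 0" using \<kappa> by (simp add: c_def)
    fix A :: real and F :: "'a \<Rightarrow> complex"
    assume A: "A > 0" and F: "F \<in> L2" and DF: "(\<lambda>\<xi>. of_real (norm \<xi> powr s) * F \<xi>) \<in> L2"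
    define g where "g \<xi> = indicator (cball 0 A) \<xi> * complex_of_real (norm \<xi> powr (- s))" for \<xi> :: 'a
    have gm: "g \<in> borel_measurable borel" unfolding g_def
      by (intro borel_measurable_times borel_measurable_indicator measurable_compose[OF _ borel_measurable_of_real]) auto
    have gn: "(\<integral>\<^sup>+\<xi>. ennreal ((cmod (g \<xi>))\<^sup>2) \<partial>lborel) = J A"
      unfolding J_def
    proof (intro nn_integral_cong)
      fix \<xi> :: 'a
      have "(norm \<xi> powr (- s))\<^sup>2 = norm \<xi> powr (- 2 * s)"
        by (simp add: power2_eq_square powr_add[symmetric])
      then show "ennreal ((cmod (g \<xi>))\<^sup>2) = indicator (cball 0 A) \<xi> * ennreal (norm \<xi> powr (- 2 * s))"
        by (auto simp: g_def indicator_def norm_mult)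
    qed
    have "(\<integral>\<^sup>+\<xi>. ennreal ((cmod (g \<xi>))\<^sup>2) \<partial>lborel) \<le> ennreal ((c * A powr ((?d - 2 * s) / 2))\<^sup>2)"
    proof -
      have "(A powr ((?d - 2 * s) / 2))\<^sup>2 = A powr (?d - 2 * s)"
        by (simp add: power2_eq_square powr_add[symmetric])
      then show ?thesis unfolding gn JA[OF A] using \<kappa> 
        by (intro ennreal_leI) (simp add: c_def power_mult_distrib mult.commute mult_right_mono)
    qed
    from L2_norm_leI[OF gm this] \<kappa> have g: "g \<in> L2" "L2norm g \<le> c * A powr ((?d - 2 * s) / 2)"
      by (auto simp: c_def)
    have "(\<integral>\<xi>. cmod (trunc A F \<xi>) \<partial>lborel) = (\<integral>\<xi>. cmod (g \<xi>) * cmod (of_real (norm \<xi> powr s) * F \<xi>) \<partial>lborel)"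
    proof (rule integral_cong_AE)
      show "(\<lambda>\<xi>. cmod (trunc A F \<xi>)) \<in> borel_measurable lborel"
        using L2_measurable[OF trunc_L2(1)[OF F, of A]] by simp
      show "(\<lambda>\<xi>. cmod (g \<xi>) * cmod (of_real (norm \<xi> powr s) * F \<xi>)) \<in> borel_measurable lborel"
        using gm L2_measurable[OF DF] by simp
      show "AE \<xi> in lborel. cmod (trunc A F \<xi>) = cmod (g \<xi>) * cmod (of_real (norm \<xi> powr s) * F \<xi>)"
        using AE_lborel_singleton[of "0::'a"]
      proof eventually_elim
        case (elim \<xi>)
        have "norm \<xi> powr (- s) * norm \<xi> powr s = 1" using elim by (simp add: powr_add[symmetric])
        then have "norm \<xi> powr (- s) * (norm \<xi> powr s * cmod (F \<xi>)) = cmod (F \<xi>)"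
          by (simp add: mult.assoc[symmetric])
        then show ?case by (auto simp: g_def trunc_def indicator_def norm_mult)
      qed
    qed
    also have "\<dots> \<le> L2norm g * L2norm (\<lambda>\<xi>. of_real (norm \<xi> powr s) * F \<xi>)"
      by (rule Cauchy_Schwarz_norm[OF g(1) DF])
    also have "\<dots> \<le> c * A powr ((?d - 2 * s) / 2) * L2norm (\<lambda>\<xi>. of_real (norm \<xi> powr s) * F \<xi>)"
      using g(2) by (rule mult_right_mono) simp
    finally show "(\<integral>\<xi>. cmod (trunc A F \<xi>) \<partial>lborel) \<le> c * A powr ((?d - 2 * s) / 2) * L2norm (\<lambda>\<xi>. of_real (norm \<xi> powr s) * F \<xi>)" .
  qed
qed

lemma nn_integral_powr_from_0:
  assumes "q > 0" "b \<ge> 0"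
  shows "(\<integral>\<^sup>+l. indicator {0..b} l * ennreal (l powr (q - 1)) \<partial>lborel) = ennreal (b powr q / q)"
proof -
  have "((\<lambda>l. l powr (q - 1)) has_integral (b powr q / q)) {0..b}"
    using has_integral_powr_from_0[of "q - 1" b] assms by simp
  from nn_integral_has_integral_lebesgue[OF _ this] show ?thesis
    by (simp add: ennreal_mult' ennreal_indicator)
qed

text \<open>The proof of Chemin and Xu. The integral of \<open>|f| powr p\<close> is written by the measures of the level sets
  \<open>|f| \<ge> l\<close>. At each level the frequencies are cut at a height that depends on \<open>l\<close> in such a way that the low
  frequencies stay below \<open>l / 2\<close>; the level set is then controlled by the \<open>L\<^sup>2\<close> norm of the high frequencies.
  Integrating over \<open>l\<close> first leaves a power of \<open>|\<xi>|\<close>, which is \<open>|\<xi>| powr (2 * s)\<close> for the critical exponent.\<close>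

theorem sobolev_inequality:
  assumes s: "s > 0" "real DIM('a::euclidean_space) > 2 * s"
  defines "p \<equiv> 2 * real DIM('a) / (real DIM('a) - 2 * s)"
  shows "\<exists>C>0. \<forall>(f::'a \<Rightarrow> complex) F. is_fourier f F \<longrightarrow> (\<lambda>\<xi>. of_real (norm \<xi> powr s) * F \<xi>) \<in> L2 \<longrightarrow>
     (\<integral>\<^sup>+x. ennreal (cmod (f x) powr p) \<partial>lborel) \<le> ennreal ((C * L2norm (\<lambda>\<xi>. of_real (norm \<xi> powr s) * F \<xi>)) powr p)"
proof -
  let ?d = "real DIM('a)" and ?c = "plancherel_const TYPE('a)"
  define \<beta> where "\<beta> = (?d - 2 * s) / 2"
  have \<beta>: "\<beta> > 0" using s by (simp add: \<beta>_def)
  have d: "?d = 2 * s + 2 * \<beta>" by (simp add: \<beta>_def field_simps)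
  have p: "p = 2 + 2 * s / \<beta>" using \<beta> unfolding p_def d by (simp add: field_simps)
  have p2: "p > 2" using \<beta> s p by simp
  obtain c0 where c0: "c0 > 0" and low: "\<And>A F. A > 0 \<Longrightarrow> F \<in> L2 \<Longrightarrow> (\<lambda>\<xi>. of_real (norm \<xi> powr s) * F \<xi>) \<in> L2 \<Longrightarrow>
     (\<integral>(\<xi>::'a). cmod (trunc A F \<xi>) \<partial>lborel) \<le> c0 * A powr \<beta> * L2norm (\<lambda>\<xi>. of_real (norm \<xi> powr s) * F \<xi>)"
    using low_frequency_bound[OF s] unfolding \<beta>_def by blast
  define c1 where "c1 = 2 * c0 / ?c"
  have c1: "c1 > 0" using c0 by (simp add: c1_def)
  define C1 where "C1 = 4 * p / ?c * (c1 powr (p - 2) / (p - 2))"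
  have C1: "C1 > 0" using p2 c1 by (simp add: C1_def)
  show ?thesis
  proof (intro exI[of _ "C1 powr (1 / p)"] conjI allI impI)
    show "C1 powr (1 / p) > 0" using C1 by simp
    fix f F :: "'a \<Rightarrow> complex"
    assume fF: "is_fourier f F" and DF: "(\<lambda>\<xi>. of_real (norm \<xi> powr s) * F \<xi>) \<in> L2"
    define K where "K = L2norm (\<lambda>\<xi>. of_real (norm \<xi> powr s) * F \<xi>)"
    note L = is_fourier_L2[OF fF]
    have [measurable]: "f \<in> borel_measurable borel" "F \<in> borel_measurable borel" using L by (auto intro: L2_measurable)
    have main: "(\<integral>\<^sup>+x. ennreal (cmod (f x) powr p) \<partial>lborel) \<le> ennreal (C1 * K powr p)"
    proof (cases "K = 0")
      case True
      have "AE \<xi> in lborel. F \<xi> = 0"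
        using L2norm_eq_0_AE[OF DF True[unfolded K_def]] AE_lborel_singleton[of "0::'a"] 
        by eventually_elim auto
      then have "L2norm F = 0" 
        using L2norm_cong_AE[of F "\<lambda>_. 0"] by simp
      then have "L2norm f = 0" using plancherel[OF fF] by (simp add: plancherel_const_def)
      from L2norm_eq_0_AE[OF L(1) this] have "(\<integral>\<^sup>+x. ennreal (cmod (f x) powr p) \<partial>lborel) = (\<integral>\<^sup>+(x::'a). 0 \<partial>lborel)"
        using p2 by (intro nn_integral_cong_AE) auto
      then show ?thesis by simp
    next
      case False
      then have K: "K > 0" unfolding K_def using L2norm_nonneg[of "\<lambda>\<xi>. of_real (norm \<xi> powr s) * F \<xi>"] by linarith
      define M where "M = c1 * K"
      have M: "M > 0" using c1 K by (simp add: M_def)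
      define A where "A l = (l / M) powr (1 / \<beta>)" for l
      \<comment> \<open>The cut-off frequency \<open>A l\<close> is chosen such that the low frequencies are bounded by
        \<open>l / 2\<close>; where \<open>|f| \<ge> l\<close>, the high frequencies then exceed \<open>l / 2\<close>, and Chebyshev applies.\<close>
      have level: "(\<integral>\<^sup>+x. indicator {0..cmod (f x)} l \<partial>lborel) \<le> 
          ennreal (4 / (l\<^sup>2 * ?c)) * (\<integral>\<^sup>+\<xi>. indicator {0..M * norm \<xi> powr \<beta>} l * ennreal ((cmod (F \<xi>))\<^sup>2) \<partial>lborel)" if l: "l > 0" for l
      proof -
        have A: "A l > 0" using l M by (simp add: A_def)
        define h where "h x = f x - low_pass (A l) F x" for x
        have h2: "h \<in> L2" unfolding h_def[abs_def] using L by (intro L2_diff low_pass_L2)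
        have lowb: "cmod (low_pass (A l) F x) \<le> l / 2" for x
        proof -
          have "cmod (low_pass (A l) F x) \<le> c0 * A l powr \<beta> * K / ?c"
            unfolding K_def by (rule order_trans[OF low_pass_bound divide_right_mono[OF low[OF A L(2) DF]]]) (simp add: less_imp_le)
          also have "A l powr \<beta> = l / M" using \<beta> l M by (simp add: A_def powr_powr)
          also have "c0 * (l / M) * K / ?c = l / 2"
            using c0 K by (simp add: M_def c1_def field_simps plancherel_const_def)
          finally show ?thesis .
        qed
        have pt: "(indicator {0..cmod (f x)} l :: ennreal) \<le> ennreal (4 / l\<^sup>2) * ennreal ((cmod (h x))\<^sup>2)" for x
        proof (cases "l \<le> cmod (f x)")
          case True
          have "l / 2 \<le> cmod (h x)"
            using True lowb[of x] norm_triangle_ineq2[of "f x" "low_pass (A l) F x"] unfolding h_def by linarith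
          then have "(l / 2)\<^sup>2 \<le> (cmod (h x))\<^sup>2" using l by (intro power_mono) auto
          then have "1 \<le> 4 / l\<^sup>2 * (cmod (h x))\<^sup>2" using l by (simp add: field_simps)
          then show ?thesis using True l by (simp add: ennreal_mult'[symmetric] ennreal_leI flip: ennreal_1)
        qed (use l in auto)
        have "(\<integral>\<^sup>+x. indicator {0..cmod (f x)} l \<partial>lborel) \<le> (\<integral>\<^sup>+x. ennreal (4 / l\<^sup>2) * ennreal ((cmod (h x))\<^sup>2) \<partial>lborel)"
          by (intro nn_integral_mono pt)
        also have "\<dots> = ennreal (4 / l\<^sup>2) * ennreal ((L2norm h)\<^sup>2)"
          using h2 by (subst nn_integral_cmult) (auto simp: nn_integral_L2 L2_measurable)
        also have "(L2norm h)\<^sup>2 = (L2norm (\<lambda>\<xi>. F \<xi> - trunc (A l) F \<xi>))\<^sup>2 / ?c"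
          unfolding h_def[abs_def] by (rule high_pass_norm[OF fF])
        also have "ennreal (4 / l\<^sup>2) * ennreal ((L2norm (\<lambda>\<xi>. F \<xi> - trunc (A l) F \<xi>))\<^sup>2 / ?c) = 
            ennreal (4 / (l\<^sup>2 * ?c)) * ennreal ((L2norm (\<lambda>\<xi>. F \<xi> - trunc (A l) F \<xi>))\<^sup>2)"
          using l by (simp add: ennreal_mult'[symmetric] less_imp_le)
        also have "ennreal ((L2norm (\<lambda>\<xi>. F \<xi> - trunc (A l) F \<xi>))\<^sup>2) = (\<integral>\<^sup>+\<xi>. ennreal ((cmod (F \<xi> - trunc (A l) F \<xi>))\<^sup>2) \<partial>lborel)"
          using L by (intro nn_integral_L2[symmetric] L2_diff trunc_L2)
        also have "\<dots> \<le> (\<integral>\<^sup>+\<xi>. indicator {0..M * norm \<xi> powr \<beta>} l * ennreal ((cmod (F \<xi>))\<^sup>2) \<partial>lborel)"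
        proof (intro nn_integral_mono)
          fix \<xi> :: 'a
          show "ennreal ((cmod (F \<xi> - trunc (A l) F \<xi>))\<^sup>2) \<le> indicator {0..M * norm \<xi> powr \<beta>} l * ennreal ((cmod (F \<xi>))\<^sup>2)"
          proof (cases "norm \<xi> \<le> A l")
            case False
            then have "A l powr \<beta> \<le> norm \<xi> powr \<beta>" using A \<beta> by (intro powr_mono2) auto
            then have "l / M \<le> norm \<xi> powr \<beta>" using \<beta> l M by (simp add: A_def powr_powr)
            then have "l \<le> M * norm \<xi> powr \<beta>" using M by (simp add: field_simps)
            then show ?thesis using l False by (simp add: trunc_def)
          qed (simp add: trunc_def)
        qed
        finally show ?thesis by (simp add: mult_left_mono)
      qed
      have "(\<integral>\<^sup>+x. ennreal (cmod (f x) powr p) \<partial>lborel) = 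
          (\<integral>\<^sup>+x. (\<integral>\<^sup>+l. ennreal (p * l powr (p - 1)) * indicator {0..cmod (f x)} l \<partial>lborel) \<partial>lborel)"
      proof (intro nn_integral_cong)
        fix x
        have "(\<integral>\<^sup>+l. ennreal (p * l powr (p - 1)) * indicator {0..cmod (f x)} l \<partial>lborel) = 
          (\<integral>\<^sup>+l. ennreal p * (indicator {0..cmod (f x)} l * ennreal (l powr (p - 1))) \<partial>lborel)"
          using p2 by (intro nn_integral_cong) (simp add: ennreal_mult' mult_ac)
        also have "\<dots> = ennreal p * ennreal (cmod (f x) powr p / p)"
          using p2 by (subst nn_integral_cmult) (auto simp: nn_integral_powr_from_0)
        also have "\<dots> = ennreal (cmod (f x) powr p)"
          using p2 by (simp add: ennreal_mult'[symmetric])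
        finally show "ennreal (cmod (f x) powr p) = (\<integral>\<^sup>+l. ennreal (p * l powr (p - 1)) * indicator {0..cmod (f x)} l \<partial>lborel)" ..
      qed
      also have "\<dots> = (\<integral>\<^sup>+l. (\<integral>\<^sup>+x. ennreal (p * l powr (p - 1)) * indicator {0..cmod (f x)} l \<partial>lborel) \<partial>lborel)"
        by (rule lborel_pair.Fubini') (simp add: case_prod_beta' atLeastAtMost_iff indicator_def, measurable)
      also have "\<dots> \<le> (\<integral>\<^sup>+l. (\<integral>\<^sup>+\<xi>. ennreal (4 * p / ?c) * ennreal ((cmod (F \<xi>))\<^sup>2) * (indicator {0..M * norm \<xi> powr \<beta>} l * ennreal (l powr (p - 2 - 1))) \<partial>lborel) \<partial>lborel)"
      proof (rule nn_integral_mono)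
        fix l :: real
        show "(\<integral>\<^sup>+x. ennreal (p * l powr (p - 1)) * indicator {0..cmod (f x)} l \<partial>lborel) \<le> 
          (\<integral>\<^sup>+\<xi>. ennreal (4 * p / ?c) * ennreal ((cmod (F \<xi>))\<^sup>2) * (indicator {0..M * norm \<xi> powr \<beta>} l * ennreal (l powr (p - 2 - 1))) \<partial>lborel)"
        proof (cases "l > 0")
          case True
          have "(\<integral>\<^sup>+x. ennreal (p * l powr (p - 1)) * indicator {0..cmod (f x)} l \<partial>lborel) = ennreal (p * l powr (p - 1)) * (\<integral>\<^sup>+x. indicator {0..cmod (f x)} l \<partial>lborel)"
            by (rule nn_integral_cmult) (simp add: atLeastAtMost_iff indicator_def)
          also have "\<dots> \<le> ennreal (p * l powr (p - 1)) * (ennreal (4 / (l\<^sup>2 * ?c)) * (\<integral>\<^sup>+\<xi>. indicator {0..M * norm \<xi> powr \<beta>} l * ennreal ((cmod (F \<xi>))\<^sup>2) \<partial>lborel))"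
            by (intro mult_left_mono level True) simp
          also have "\<dots> = ennreal (4 * p / ?c * l powr (p - 2 - 1)) * (\<integral>\<^sup>+\<xi>. indicator {0..M * norm \<xi> powr \<beta>} l * ennreal ((cmod (F \<xi>))\<^sup>2) \<partial>lborel)"
          proof -
            have "l powr (p - 1) = l\<^sup>2 * l powr (p - 2 - 1)"
              using powr_add[of l 2 "p - 2 - 1"] True by simp
            then have "p * l powr (p - 1) * (4 / (l\<^sup>2 * ?c)) = 4 * p / ?c * l powr (p - 2 - 1)"
              using True by (simp add: field_simps)
            then have "ennreal (p * l powr (p - 1)) * ennreal (4 / (l\<^sup>2 * ?c)) = ennreal (4 * p / ?c * l powr (p - 2 - 1))"
              using p2 by (subst ennreal_mult'[symmetric]) auto
            then show ?thesis by (simp add: mult.assoc[symmetric])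
          qed
          also have "\<dots> = (\<integral>\<^sup>+\<xi>. ennreal (4 * p / ?c * l powr (p - 2 - 1)) * (indicator {0..M * norm \<xi> powr \<beta>} l * ennreal ((cmod (F \<xi>))\<^sup>2)) \<partial>lborel)"
            by (rule nn_integral_cmult[symmetric]) (simp add: atLeastAtMost_iff indicator_def, measurable)
          also have "\<dots> = (\<integral>\<^sup>+\<xi>. ennreal (4 * p / ?c) * ennreal ((cmod (F \<xi>))\<^sup>2) * (indicator {0..M * norm \<xi> powr \<beta>} l * ennreal (l powr (p - 2 - 1))) \<partial>lborel)"
          proof (intro nn_integral_cong)
            fix \<xi> :: 'a
            have "ennreal (4 * p / ?c * l powr (p - 2 - 1)) = ennreal (4 * p / ?c) * ennreal (l powr (p - 2 - 1))"
              using p2 by (intro ennreal_mult) (auto simp: less_imp_le)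
            then show "ennreal (4 * p / ?c * l powr (p - 2 - 1)) * (indicator {0..M * norm \<xi> powr \<beta>} l * ennreal ((cmod (F \<xi>))\<^sup>2)) = 
              ennreal (4 * p / ?c) * ennreal ((cmod (F \<xi>))\<^sup>2) * (indicator {0..M * norm \<xi> powr \<beta>} l * ennreal (l powr (p - 2 - 1)))"
              by (simp only: mult_ac)
          qed
          finally show ?thesis .
        next
          case False
          then have eq: "ennreal (p * l powr (p - 1)) * indicator {0..cmod (f x)} l = 0" for x
            by (cases "l = 0") auto
          have "(\<integral>\<^sup>+x. ennreal (p * l powr (p - 1)) * indicator {0..cmod (f x)} l \<partial>lborel) = (\<integral>\<^sup>+(x::'a). 0 \<partial>lborel)"
            by (intro nn_integral_cong eq)
          then show ?thesis by (simp only: nn_integral_const mult_zero_left zero_le)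
        qed
      qed
      also have "\<dots> = (\<integral>\<^sup>+\<xi>. (\<integral>\<^sup>+l. ennreal (4 * p / ?c) * ennreal ((cmod (F \<xi>))\<^sup>2) * (indicator {0..M * norm \<xi> powr \<beta>} l * ennreal (l powr (p - 2 - 1))) \<partial>lborel) \<partial>lborel)"
        by (rule lborel_pair.Fubini') (simp add: case_prod_beta' atLeastAtMost_iff indicator_def, measurable)
      also have "\<dots> = (\<integral>\<^sup>+\<xi>. ennreal (C1 * K powr (p - 2)) * ennreal ((cmod (of_real (norm \<xi> powr s) * F \<xi>))\<^sup>2) \<partial>lborel)"
      proof (intro nn_integral_cong)
        fix \<xi> :: 'a
        have nn: "(\<integral>\<^sup>+l. indicator {0..M * norm \<xi> powr \<beta>} l * ennreal (l powr (p - 2 - 1)) \<partial>lborel) = ennreal ((M * norm \<xi> powr \<beta>) powr (p - 2) / (p - 2))"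
          by (rule nn_integral_powr_from_0) (use p2 M in auto)
        have "(\<integral>\<^sup>+l. ennreal (4 * p / ?c) * ennreal ((cmod (F \<xi>))\<^sup>2) * (indicator {0..M * norm \<xi> powr \<beta>} l * ennreal (l powr (p - 2 - 1))) \<partial>lborel)
          = ennreal (4 * p / ?c) * ennreal ((cmod (F \<xi>))\<^sup>2) * ennreal ((M * norm \<xi> powr \<beta>) powr (p - 2) / (p - 2))"
          unfolding nn[symmetric] by (rule nn_integral_cmult) measurable
        also have "\<dots> = ennreal (4 * p / ?c * (cmod (F \<xi>))\<^sup>2 * ((M * norm \<xi> powr \<beta>) powr (p - 2) / (p - 2)))"
          using p2 by (simp add: ennreal_mult'[symmetric] less_imp_le)
        also have "4 * p / ?c * (cmod (F \<xi>))\<^sup>2 * ((M * norm \<xi> powr \<beta>) powr (p - 2) / (p - 2)) = C1 * K powr (p - 2) * (cmod (of_real (norm \<xi> powr s) * F \<xi>))\<^sup>2"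
        proof -
          have e: "\<beta> * (p - 2) = s + s" using \<beta> by (simp add: p)
          have "(M * norm \<xi> powr \<beta>) powr (p - 2) = M powr (p - 2) * norm \<xi> powr (s + s)"
            using M by (simp add: powr_mult powr_powr e)
          also have "\<dots> = c1 powr (p - 2) * K powr (p - 2) * (norm \<xi> powr s)\<^sup>2"
            using c1 K powr_add[of "norm \<xi>" s s] by (simp add: M_def powr_mult power2_eq_square)
          finally show ?thesis by (simp add: C1_def norm_mult power_mult_distrib)
        qed
        finally show "(\<integral>\<^sup>+l. ennreal (4 * p / ?c) * ennreal ((cmod (F \<xi>))\<^sup>2) * (indicator {0..M * norm \<xi> powr \<beta>} l * ennreal (l powr (p - 2 - 1))) \<partial>lborel)
          = ennreal (C1 * K powr (p - 2)) * ennreal ((cmod (of_real (norm \<xi> powr s) * F \<xi>))\<^sup>2)"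
          using C1 by (simp add: ennreal_mult'[symmetric])
      qed
      also have "\<dots> = ennreal (C1 * K powr (p - 2)) * ennreal (K\<^sup>2)"
        unfolding K_def using DF by (subst nn_integral_cmult) (auto simp: nn_integral_L2 L2_measurable)
      also have "\<dots> = ennreal (C1 * K powr p)"
      proof -
        have "K powr p = K powr (p - 2) * K\<^sup>2" using powr_add[of K "p - 2" 2] K by simp
        then show ?thesis using C1 by (simp add: ennreal_mult'[symmetric])
      qed
      finally show ?thesis .
    qed
    also have "C1 * K powr p = (C1 powr (1 / p) * K) powr p"
      using C1 p2 by (simp add: powr_mult powr_powr K_def)
    finally show "(\<integral>\<^sup>+x. ennreal (cmod (f x) powr p) \<partial>lborel) \<le> ennreal ((C1 powr (1 / p) * L2norm (\<lambda>\<xi>. of_real (norm \<xi> powr s) * F \<xi>)) powr p)"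
      by (simp add: K_def)
  qed
qed

text \<open>Bounds \<open>U\<close>, \<open>V\<close> for the norms are given instead of the norms. Enlarging them by \<open>\<delta>\<close> avoids the case
  of a vanishing norm in the normalisation for Young's inequality.\<close>

lemma nn_integral_Holder:
  fixes f g :: "'a \<Rightarrow> real"
  assumes m[measurable]: "f \<in> borel_measurable M" "g \<in> borel_measurable M" and nn: "\<And>x. 0 \<le> f x" "\<And>x. 0 \<le> g x"
    and PQ: "P > 1" "Q > 1" "1 / P + 1 / Q = 1" and U: "0 \<le> U" and V: "0 \<le> V"
    and fU: "(\<integral>\<^sup>+x. ennreal (f x powr P) \<partial>M) \<le> ennreal (U powr P)"
    and gV: "(\<integral>\<^sup>+x. ennreal (g x powr Q) \<partial>M) \<le> ennreal (V powr Q)"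
  shows "(\<integral>\<^sup>+x. ennreal (f x * g x) \<partial>M) \<le> ennreal (U * V)"
proof -
  have step: "(\<integral>\<^sup>+x. ennreal (f x * g x) \<partial>M) \<le> ennreal ((U + \<delta>) * (V + \<delta>))" if \<delta>: "\<delta> > 0" for \<delta>
  proof -
    define u v where "u = U + \<delta>" and "v = V + \<delta>"
    have uv: "u > 0" "v > 0" using U V \<delta> by (auto simp: u_def v_def)
    have a: "(\<integral>\<^sup>+x. ennreal (f x powr P / (P * u powr P)) \<partial>M) \<le> ennreal (1 / P)"
    proof -
      have "(\<integral>\<^sup>+x. ennreal (f x powr P / (P * u powr P)) \<partial>M) = (\<integral>\<^sup>+x. ennreal (1 / (P * u powr P)) * ennreal (f x powr P) \<partial>M)"
        using PQ by (intro nn_integral_cong) (simp add: ennreal_mult'[symmetric])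
      also have "\<dots> = ennreal (1 / (P * u powr P)) * (\<integral>\<^sup>+x. ennreal (f x powr P) \<partial>M)" by (rule nn_integral_cmult) measurable
      also have "\<dots> \<le> ennreal (1 / (P * u powr P)) * ennreal (u powr P)"
        using fU U \<delta> PQ by (intro mult_left_mono order_trans[OF fU] ennreal_leI powr_mono2) (auto simp: u_def)
      also have "\<dots> = ennreal (1 / P)" using PQ uv by (subst ennreal_mult'[symmetric]) auto
      finally show ?thesis .
    qed
    have b: "(\<integral>\<^sup>+x. ennreal (g x powr Q / (Q * v powr Q)) \<partial>M) \<le> ennreal (1 / Q)"
    proof -
      have "(\<integral>\<^sup>+x. ennreal (g x powr Q / (Q * v powr Q)) \<partial>M) = (\<integral>\<^sup>+x. ennreal (1 / (Q * v powr Q)) * ennreal (g x powr Q) \<partial>M)"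
        using PQ by (intro nn_integral_cong) (simp add: ennreal_mult'[symmetric])
      also have "\<dots> = ennreal (1 / (Q * v powr Q)) * (\<integral>\<^sup>+x. ennreal (g x powr Q) \<partial>M)" by (rule nn_integral_cmult) measurable
      also have "\<dots> \<le> ennreal (1 / (Q * v powr Q)) * ennreal (v powr Q)"
        using gV V \<delta> PQ by (intro mult_left_mono order_trans[OF gV] ennreal_leI powr_mono2) (auto simp: v_def)
      also have "\<dots> = ennreal (1 / Q)" using PQ uv by (subst ennreal_mult'[symmetric]) auto
      finally show ?thesis .
    qed
    have "(\<integral>\<^sup>+x. ennreal (f x * g x) \<partial>M) \<le> (\<integral>\<^sup>+x. ennreal (u * v) * (ennreal (f x powr P / (P * u powr P)) + ennreal (g x powr Q / (Q * v powr Q))) \<partial>M)"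
    proof (intro nn_integral_mono)
      fix x
      have "(f x / u) * (g x / v) \<le> (f x / u) powr P / P + (g x / v) powr Q / Q"
        using PQ nn uv by (intro Youngs_inequality) auto
      also have "\<dots> = f x powr P / (P * u powr P) + g x powr Q / (Q * v powr Q)"
        using nn uv by (simp add: powr_divide mult.commute)
      finally have "f x * g x \<le> (u * v) * (f x powr P / (P * u powr P) + g x powr Q / (Q * v powr Q))"
        using uv by (simp add: field_simps)
      then show "ennreal (f x * g x) \<le> ennreal (u * v) * (ennreal (f x powr P / (P * u powr P)) + ennreal (g x powr Q / (Q * v powr Q)))"
        using uv PQ by (simp add: ennreal_mult'[symmetric] ennreal_leI flip: ennreal_plus)
    qed
    also have "\<dots> = ennreal (u * v) * ((\<integral>\<^sup>+x. ennreal (f x powr P / (P * u powr P)) \<partial>M) + (\<integral>\<^sup>+x. ennreal (g x powr Q / (Q * v powr Q)) \<partial>M))"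
      by (subst nn_integral_cmult, measurable) (subst nn_integral_add, auto)
    also have "\<dots> \<le> ennreal (u * v) * (ennreal (1 / P) + ennreal (1 / Q))"
      by (intro mult_left_mono add_mono a b) simp
    also have "\<dots> = ennreal (u * v)" using PQ by (simp flip: ennreal_plus)
    finally show ?thesis by (simp add: u_def v_def)
  qed
  have "((\<lambda>\<delta>. ennreal ((U + \<delta>) * (V + \<delta>))) \<longlongrightarrow> ennreal ((U + 0) * (V + 0))) (at_right 0)"
    by (intro tendsto_ennrealI tendsto_intros)
  then have "(\<integral>\<^sup>+x. ennreal (f x * g x) \<partial>M) \<le> ennreal ((U + 0) * (V + 0))"
    by (rule tendsto_lowerbound) (use step in \<open>auto simp: eventually_at_filter intro!: always_eventually\<close>)
  then show ?thesis by simp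
qed

section \<open>Fractional Sobolev spaces\<close>

text \<open>The operator \<open>(-\<Delta>) powr (\<sigma> / 2)\<close> with the symbol \<open>|\<xi>| powr \<sigma>\<close>, which is the one in the norm of
  \<open>Hs \<sigma>\<close>; in particular \<open>Dfrac (2 * s)\<close> is \<open>frac_laplacian s\<close>.\<close>

abbreviation Dfrac :: "real \<Rightarrow> ('a::euclidean_space \<Rightarrow> complex) \<Rightarrow> 'a \<Rightarrow> complex" where
  "Dfrac \<sigma> \<equiv> frac_laplacian (\<sigma> / 2)"

lemma is_frac_laplacian_iff:
  "is_frac_laplacian (\<sigma> / 2) f g \<longleftrightarrow> (\<exists>F. is_fourier f F \<and> is_fourier g (\<lambda>\<xi>. of_real (norm \<xi> powr \<sigma>) * F \<xi>))"
  by (simp add: is_frac_laplacian_def)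

lemma mem_Hs: "f \<in> elems (Hs \<sigma>) \<longleftrightarrow> (\<exists>g. is_frac_laplacian (\<sigma> / 2) f g)"
  by (auto simp: Hs_def is_frac_laplacian_def dest: is_fourier_L2)

lemma Hs_norm: "fnorm (Hs \<sigma>) f = L2norm f + L2norm (Dfrac \<sigma> f)"
  by (simp add: Hs_def)

lemma Dfrac_fourier:
  assumes "f \<in> elems (Hs \<sigma>)"
  obtains F where "is_fourier f F" "is_fourier (Dfrac \<sigma> f) (\<lambda>\<xi>. of_real (norm \<xi> powr \<sigma>) * F \<xi>)"
proof -
  have "is_frac_laplacian (\<sigma> / 2) f (Dfrac \<sigma> f)"
    using assms unfolding mem_Hs frac_laplacian_def by (rule someI_ex)
  then show thesis using that by (auto simp: is_frac_laplacian_iff)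
qed

lemma Hs_L2: "f \<in> elems (Hs \<sigma>) \<Longrightarrow> f \<in> L2" "f \<in> elems (Hs \<sigma>) \<Longrightarrow> Dfrac \<sigma> f \<in> L2"
  by (auto elim!: Dfrac_fourier dest: is_fourier_L2)

text \<open>Representatives of transforms and of fractional Laplacians are determined only almost everywhere, which is why
  the algebraic rules below hold almost everywhere.\<close>

lemma fourier_multiplier_unique:
  assumes "is_fourier f F" "is_fourier f F'" 
    "is_fourier g (\<lambda>\<xi>. m \<xi> * F \<xi>)" "is_fourier g' (\<lambda>\<xi>. m \<xi> * F' \<xi>)"
  shows "AE x in lborel. g x = g' x"
proof -
  have AE: "AE \<xi> in lborel. F \<xi> = F' \<xi>" by (rule is_fourier_unique[OF assms(1,2)])
  note d = is_fourier_diff[OF assms(3,4)]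
  have "L2norm (\<lambda>\<xi>. m \<xi> * F \<xi> - m \<xi> * F' \<xi>) = L2norm (\<lambda>_::'a. 0)"
    by (rule L2norm_cong_AE) (use AE L2_measurable[OF is_fourier_L2(2)[OF d]] in auto)
  then have "L2norm (\<lambda>x. g x - g' x) = 0" using plancherel[OF d] by (simp add: plancherel_const_def)
  from L2norm_eq_0_AE[OF is_fourier_L2(1)[OF d] this] show ?thesis by simp
qed

lemma Dfrac_eqI:
  assumes "is_fourier f F" "is_fourier g (\<lambda>\<xi>. of_real (norm \<xi> powr \<sigma>) * F \<xi>)"
  shows "f \<in> elems (Hs \<sigma>)" "AE x in lborel. Dfrac \<sigma> f x = g x"
proof -
  show f: "f \<in> elems (Hs \<sigma>)" using assms by (auto simp: mem_Hs is_frac_laplacian_iff)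
  obtain F' where F': "is_fourier f F'" "is_fourier (Dfrac \<sigma> f) (\<lambda>\<xi>. of_real (norm \<xi> powr \<sigma>) * F' \<xi>)"
    using Dfrac_fourier[OF f] .
  show "AE x in lborel. Dfrac \<sigma> f x = g x"
    by (rule fourier_multiplier_unique[OF F'(1) assms(1) F'(2) assms(2)])
qed

lemma Dfrac_add:
  assumes "f \<in> elems (Hs \<sigma>)" "g \<in> elems (Hs \<sigma>)"
  shows "(\<lambda>x. f x + g x) \<in> elems (Hs \<sigma>)" "AE x in lborel. Dfrac \<sigma> (\<lambda>x. f x + g x) x = Dfrac \<sigma> f x + Dfrac \<sigma> g x"
proof -
  obtain F where F: "is_fourier f F" "is_fourier (Dfrac \<sigma> f) (\<lambda>\<xi>. of_real (norm \<xi> powr \<sigma>) * F \<xi>)"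
    using Dfrac_fourier[OF assms(1)] .
  obtain G where G: "is_fourier g G" "is_fourier (Dfrac \<sigma> g) (\<lambda>\<xi>. of_real (norm \<xi> powr \<sigma>) * G \<xi>)"
    using Dfrac_fourier[OF assms(2)] .
  have "is_fourier (\<lambda>x. Dfrac \<sigma> f x + Dfrac \<sigma> g x) (\<lambda>\<xi>. of_real (norm \<xi> powr \<sigma>) * (F \<xi> + G \<xi>))"
    using is_fourier_add[OF F(2) G(2)] by (simp add: distrib_left)
  from Dfrac_eqI[OF is_fourier_add[OF F(1) G(1)] this]
  show "(\<lambda>x. f x + g x) \<in> elems (Hs \<sigma>)" "AE x in lborel. Dfrac \<sigma> (\<lambda>x. f x + g x) x = Dfrac \<sigma> f x + Dfrac \<sigma> g x" .
qed

lemma Dfrac_cmult: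
  assumes "f \<in> elems (Hs \<sigma>)"
  shows "(\<lambda>x. c * f x) \<in> elems (Hs \<sigma>)" "AE x in lborel. Dfrac \<sigma> (\<lambda>x. c * f x) x = c * Dfrac \<sigma> f x"
proof -
  obtain F where F: "is_fourier f F" "is_fourier (Dfrac \<sigma> f) (\<lambda>\<xi>. of_real (norm \<xi> powr \<sigma>) * F \<xi>)"
    using Dfrac_fourier[OF assms(1)] .
  have "is_fourier (\<lambda>x. c * Dfrac \<sigma> f x) (\<lambda>\<xi>. of_real (norm \<xi> powr \<sigma>) * (c * F \<xi>))"
    using is_fourier_cmult[OF F(2), of c] by (simp add: mult.left_commute)
  from Dfrac_eqI[OF is_fourier_cmult[OF F(1)] this]
  show "(\<lambda>x. c * f x) \<in> elems (Hs \<sigma>)" "AE x in lborel. Dfrac \<sigma> (\<lambda>x. c * f x) x = c * Dfrac \<sigma> f x" .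
qed

lemma Dfrac_diff:
  assumes "f \<in> elems (Hs \<sigma>)" "g \<in> elems (Hs \<sigma>)"
  shows "(\<lambda>x. f x - g x) \<in> elems (Hs \<sigma>)" "AE x in lborel. Dfrac \<sigma> (\<lambda>x. f x - g x) x = Dfrac \<sigma> f x - Dfrac \<sigma> g x"
proof -
  note a = Dfrac_add[OF assms(1) Dfrac_cmult(1)[OF assms(2), of "-1"]]
  show "(\<lambda>x. f x - g x) \<in> elems (Hs \<sigma>)" using a(1) by simp
  show "AE x in lborel. Dfrac \<sigma> (\<lambda>x. f x - g x) x = Dfrac \<sigma> f x - Dfrac \<sigma> g x"
    using a(2) Dfrac_cmult(2)[OF assms(2), of "-1"] by eventually_elim (simp add: algebra_simps)
qed

lemma Dfrac_divide:
  assumes "f \<in> elems (Hs \<sigma>)"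
  shows "(\<lambda>x. f x / c) \<in> elems (Hs \<sigma>)" "AE x in lborel. Dfrac \<sigma> (\<lambda>x. f x / c) x = Dfrac \<sigma> f x / c"
  using Dfrac_cmult[OF assms, of "1 / c"] by simp_all

lemma Dfrac_cong_AE:
  assumes f: "f \<in> elems (Hs \<sigma>)" and g: "g \<in> L2" and eq: "AE x in lborel. f x = g x"
  shows "g \<in> elems (Hs \<sigma>)" "AE x in lborel. Dfrac \<sigma> g x = Dfrac \<sigma> f x"
proof -
  obtain F where F: "is_fourier f F" "is_fourier (Dfrac \<sigma> f) (\<lambda>\<xi>. of_real (norm \<xi> powr \<sigma>) * F \<xi>)"
    using Dfrac_fourier[OF f] .
  have "fourier_int (trunc R g) = fourier_int (trunc R f)" for R
  proof
    fix \<xi>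
    have [measurable]: "trunc R f \<in> borel_measurable borel" "trunc R g \<in> borel_measurable borel"
      using Hs_L2(1)[OF f] g by (auto intro: L2_measurable trunc_L2)
    have m: "(\<lambda>x. cis (- (x \<bullet> \<xi>)) * trunc R f x) \<in> borel_measurable lborel" "(\<lambda>x. cis (- (x \<bullet> \<xi>)) * trunc R g x) \<in> borel_measurable lborel"
      by measurable
    show "fourier_int (trunc R g) \<xi> = fourier_int (trunc R f) \<xi>"
      unfolding fourier_int_def
      by (rule integral_cong_AE[OF m(2,1)]) (use eq in \<open>auto simp: trunc_def elim: eventually_mono\<close>)
  qed
  then have "is_fourier g F" using F(1) g by (simp add: is_fourier_iff)
  from Dfrac_eqI[OF this F(2)] show "g \<in> elems (Hs \<sigma>)" "AE x in lborel. Dfrac \<sigma> g x = Dfrac \<sigma> f x" .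
qed

text \<open>This is what makes data in \<open>Hs (2 * s)\<close> usable in the energy, which contains only the derivative of order \<open>s\<close>.\<close>

lemma Dfrac_interpolation:
  fixes f :: "'a::euclidean_space \<Rightarrow> complex"
  assumes s: "s > 0" and f: "f \<in> elems (Hs s)" "f \<in> elems (Hs (2 * s))"
  shows "L2norm (Dfrac s f) \<le> fnorm (Hs (2 * s)) f"
proof -
  obtain F where F: "is_fourier f F" "is_fourier (Dfrac s f) (\<lambda>\<xi>. of_real (norm \<xi> powr s) * F \<xi>)"
    using Dfrac_fourier[OF f(1)] .
  obtain G where G: "is_fourier f G" "is_fourier (Dfrac (2 * s) f) (\<lambda>\<xi>. of_real (norm \<xi> powr (2 * s)) * G \<xi>)"
    using Dfrac_fourier[OF f(2)] .
  let ?c = "sqrt (plancherel_const TYPE('a))"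
  \<comment> \<open>\<open>|\<xi>|\<^sup>s \<le> 1 + |\<xi>|\<^sup>2\<^sup>s\<close>, applied to the transform.\<close>
  define H where "H \<xi> = complex_of_real (cmod (G \<xi>)) + of_real (cmod (of_real (norm \<xi> powr (2 * s)) * G \<xi>))" for \<xi>
  have n2: "(\<lambda>\<xi>. complex_of_real (cmod (g \<xi>))) \<in> L2" "L2norm (\<lambda>\<xi>. complex_of_real (cmod (g \<xi>))) = L2norm g" if "g \<in> L2" for g :: "'a \<Rightarrow> complex"
    using that by (auto simp: mem_L2 L2norm_eq)
  note g1 = n2[OF is_fourier_L2(2)[OF G(1)]] and g2 = n2[OF is_fourier_L2(2)[OF G(2)]]
  have H: "H \<in> L2" "L2norm H \<le> L2norm G + L2norm (\<lambda>\<xi>. of_real (norm \<xi> powr (2 * s)) * G \<xi>)"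
    unfolding H_def[abs_def] using L2_add[OF g1(1) g2(1)] L2norm_triangle[OF g1(1) g2(1)] g1(2) g2(2) by auto
  have Gm: "(\<lambda>\<xi>. of_real (norm \<xi> powr s) * G \<xi>) \<in> borel_measurable borel"
    using L2_measurable[OF is_fourier_L2(2)[OF G(1)]] by measurable
  have "?c * L2norm (Dfrac s f) = L2norm (\<lambda>\<xi>. of_real (norm \<xi> powr s) * F \<xi>)"
    by (rule plancherel[OF F(2), symmetric])
  also have "\<dots> = L2norm (\<lambda>\<xi>. of_real (norm \<xi> powr s) * G \<xi>)"
    using is_fourier_unique[OF F(1) G(1)] L2_measurable[OF is_fourier_L2(2)[OF F(2)]] Gm
    by (intro L2norm_cong_AE) (auto elim: eventually_mono)
  also have "\<dots> \<le> L2norm H"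
  proof (rule L2_dominated(2)[OF Gm H(1)])
    fix \<xi> :: 'a
    have "norm \<xi> powr s \<le> 1 + norm \<xi> powr (2 * s)"
    proof -
      have "norm \<xi> powr (2 * s) = (norm \<xi> powr s)\<^sup>2" by (simp add: power2_eq_square powr_add[symmetric])
      moreover have "norm \<xi> powr s \<le> 1 + (norm \<xi> powr s)\<^sup>2"
        using sum_squares_bound[of 1 "norm \<xi> powr s"] powr_ge_zero[of "norm \<xi>" s] unfolding power_one mult_1_right by linarith
      ultimately show ?thesis by simp
    qed
    then have "norm \<xi> powr s * cmod (G \<xi>) \<le> (1 + norm \<xi> powr (2 * s)) * cmod (G \<xi>)"
      by (intro mult_right_mono) auto
    moreover have "cmod (H \<xi>) = cmod (G \<xi>) + norm \<xi> powr (2 * s) * cmod (G \<xi>)"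
      unfolding H_def of_real_add[symmetric] norm_of_real by (simp add: norm_mult)
    ultimately show "cmod (of_real (norm \<xi> powr s) * G \<xi>) \<le> cmod (H \<xi>)"
      by (simp add: norm_mult algebra_simps)
  qed
  also have "\<dots> \<le> ?c * L2norm f + ?c * L2norm (Dfrac (2 * s) f)"
    using H(2) plancherel[OF G(1)] plancherel[OF G(2)] by simp
  finally have "?c * L2norm (Dfrac s f) \<le> ?c * fnorm (Hs (2 * s)) f"
    by (simp add: Hs_norm distrib_left)
  then show ?thesis by (rule mult_left_le_imp_le) (simp add: plancherel_const_def)
qed

text \<open>The fractional integration by parts behind the energy: both sides are
  \<open>\<integral> |\<xi>|\<^sup>2\<^sup>s Z cnj Y\<close> up to the same constant.\<close>

lemma Dfrac_form:
  fixes z y :: "'a::euclidean_space \<Rightarrow> complex"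
  assumes s: "s > 0" and z: "z \<in> elems (Hs s)" "z \<in> elems (Hs (2 * s))" and y: "y \<in> elems (Hs s)"
  shows "L2inner (frac_laplacian s z) y = L2inner (Dfrac s z) (Dfrac s y)"
proof -
  obtain Z where Z: "is_fourier z Z" "is_fourier (Dfrac s z) (\<lambda>\<xi>. of_real (norm \<xi> powr s) * Z \<xi>)"
    using Dfrac_fourier[OF z(1)] .
  obtain Z' where Z': "is_fourier z Z'" "is_fourier (frac_laplacian s z) (\<lambda>\<xi>. of_real (norm \<xi> powr (2 * s)) * Z' \<xi>)"
    using Dfrac_fourier[OF z(2), unfolded nonzero_mult_div_cancel_left[OF zero_neq_numeral[symmetric]]] by blast
  obtain Y where Y: "is_fourier y Y" "is_fourier (Dfrac s y) (\<lambda>\<xi>. of_real (norm \<xi> powr s) * Y \<xi>)"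
    using Dfrac_fourier[OF y] .
  let ?c = "complex_of_real (plancherel_const TYPE('a))"
  have [measurable]: "Z \<in> borel_measurable borel" "Z' \<in> borel_measurable borel" "Y \<in> borel_measurable borel"
     "(\<lambda>\<xi>. cnj (Y \<xi>)) \<in> borel_measurable borel"
    using Z(1) Z'(1) Y(1) by (auto intro!: L2_measurable dest: is_fourier_L2)
  have "?c * L2inner (frac_laplacian s z) y = L2inner (\<lambda>\<xi>. of_real (norm \<xi> powr (2 * s)) * Z' \<xi>) Y"
    by (rule parseval[OF Z'(2) Y(1), symmetric])
  also have "\<dots> = L2inner (\<lambda>\<xi>. of_real (norm \<xi> powr s) * Z \<xi>) (\<lambda>\<xi>. of_real (norm \<xi> powr s) * Y \<xi>)"
    unfolding L2inner_def
  proof (rule integral_cong_AE)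
    show "AE \<xi> in lborel. of_real (norm \<xi> powr (2 * s)) * Z' \<xi> * cnj (Y \<xi>) = 
      of_real (norm \<xi> powr s) * Z \<xi> * cnj (of_real (norm \<xi> powr s) * Y \<xi>)"
      using is_fourier_unique[OF Z(1) Z'(1)]
    proof eventually_elim
      case (elim \<xi>)
      have "complex_of_real (norm \<xi> powr (2 * s)) = of_real (norm \<xi> powr s) * of_real (norm \<xi> powr s)"
        by (simp add: powr_add[symmetric] flip: of_real_mult)
      then show ?case using elim by (simp add: mult_ac)
    qed
  qed simp_all
  also have "\<dots> = ?c * L2inner (Dfrac s z) (Dfrac s y)"
    by (rule parseval[OF Z(2) Y(2)])
  finally show ?thesis using less_imp_neq[OF plancherel_const_pos[where 'a='a]] by simp
qed

section \<open>Multiplication by functions in Lebesgue spaces\<close>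

lemma Lp_norm_facts:
  assumes "c \<in> elems (Lp q)" "q > 0"
  shows "c \<in> borel_measurable borel" "0 \<le> fnorm (Lp q) c" 
    "(\<integral>\<^sup>+x. ennreal (cmod (c x) powr q) \<partial>lborel) = ennreal (fnorm (Lp q) c powr q)"
proof -
  show "c \<in> borel_measurable borel" using assms by (simp add: Lp_def)
  show "0 \<le> fnorm (Lp q) c" by (simp add: Lp_def)
  have "integrable lborel (\<lambda>x. cmod (c x) powr q)" using assms by (simp add: Lp_def)
  then have "(\<integral>\<^sup>+x. ennreal (cmod (c x) powr q) \<partial>lborel) = ennreal (\<integral>x. cmod (c x) powr q \<partial>lborel)"
    by (intro nn_integral_eq_integral) auto
  also have "(\<integral>x. cmod (c x) powr q \<partial>lborel) = fnorm (Lp q) c powr q"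
    using assms(2) by (simp add: Lp_def powr_powr)
  finally show "(\<integral>\<^sup>+x. ennreal (cmod (c x) powr q) \<partial>lborel) = ennreal (fnorm (Lp q) c powr q)" .
qed

text \<open>Hoelder's inequality and the Sobolev inequality. It covers the two ways in which the coefficients enter:
  \<open>w = |c|\<^sup>2\<close> with \<open>c\<close> in \<open>Lp (d / s)\<close>, and \<open>w = a\<close> with \<open>a\<close> in \<open>Lp (d / (2 * s))\<close>.\<close>

theorem weighted_sobolev:
  assumes s: "s > 0" "real DIM('a::euclidean_space) > 2 * s"
  defines "d \<equiv> real DIM('a)"
  shows "\<exists>C>0. \<forall>(f::'a \<Rightarrow> complex) w W. f \<in> elems (Hs s) \<longrightarrow> w \<in> borel_measurable borel \<longrightarrow> (\<forall>x. 0 \<le> w x) \<longrightarrow> 0 \<le> W \<longrightarrow>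
     (\<integral>\<^sup>+x. ennreal (w x powr (d / (2 * s))) \<partial>lborel) \<le> ennreal (W powr (d / (2 * s))) \<longrightarrow>
     (\<integral>\<^sup>+x. ennreal (w x * (cmod (f x))\<^sup>2) \<partial>lborel) \<le> ennreal (W * (C * L2norm (Dfrac s f))\<^sup>2)"
proof -
  define p where "p = 2 * d / (d - 2 * s)"
  define P Q where "P = d / (2 * s)" and "Q = d / (d - 2 * s)"
  have ds: "d > 2 * s" using s by (simp add: d_def)
  have PQ: "P > 1" "Q > 1" "1 / P + 1 / Q = 1" using s(1) ds by (auto simp: P_def Q_def field_simps)
  let ?c = "sqrt (plancherel_const TYPE('a))"
  from sobolev_inequality[OF s, folded d_def p_def[unfolded d_def]] obtain C where C: "C > 0" and
    sob: "\<And>(f::'a \<Rightarrow> complex) F. is_fourier f F \<Longrightarrow> (\<lambda>\<xi>. of_real (norm \<xi> powr s) * F \<xi>) \<in> L2 \<Longrightarrow>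
     (\<integral>\<^sup>+x. ennreal (cmod (f x) powr p) \<partial>lborel) \<le> ennreal ((C * L2norm (\<lambda>\<xi>. of_real (norm \<xi> powr s) * F \<xi>)) powr p)"
    unfolding p_def d_def by blast
  show ?thesis
  proof (intro exI[of _ "C * ?c"] conjI allI impI)
    show "C * ?c > 0" using C by simp
    fix f :: "'a \<Rightarrow> complex" and w :: "'a \<Rightarrow> real" and W :: real
    assume f: "f \<in> elems (Hs s)" and w: "w \<in> borel_measurable borel" "\<forall>x. 0 \<le> w x" and W: "0 \<le> W"
      and wW: "(\<integral>\<^sup>+x. ennreal (w x powr (d / (2 * s))) \<partial>lborel) \<le> ennreal (W powr (d / (2 * s)))"
    obtain F where F: "is_fourier f F" "is_fourier (Dfrac s f) (\<lambda>\<xi>. of_real (norm \<xi> powr s) * F \<xi>)"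
      using Dfrac_fourier[OF f] .
    define K where "K = C * ?c * L2norm (Dfrac s f)"
    have K: "K \<ge> 0" using C by (simp add: K_def plancherel_const_def)
    \<comment> \<open>\<open>Q\<close> is half the Sobolev exponent, so that Hoelder sees \<open>|f|\<^sup>2\<close> in \<open>L\<^sup>Q\<close> exactly as \<open>f\<close> in \<open>L\<^sup>p\<close>.\<close>
    have pQ: "((cmod (f x))\<^sup>2) powr Q = cmod (f x) powr p" for x
    proof -
      have "(cmod (f x))\<^sup>2 = cmod (f x) powr 2" by simp
      then show ?thesis unfolding Q_def p_def by (simp add: powr_powr del: powr_numeral)
    qed
    have KQ: "(K\<^sup>2) powr Q = K powr p"
    proof -
      have "K\<^sup>2 = K powr 2" using K by simp
      then show ?thesis unfolding Q_def p_def by (simp add: powr_powr del: powr_numeral)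
    qed
    have "(\<integral>\<^sup>+x. ennreal (w x * (cmod (f x))\<^sup>2) \<partial>lborel) \<le> ennreal (W * K\<^sup>2)"
    proof (rule nn_integral_Holder[where P=P and Q=Q])
      show "(\<lambda>x. (cmod (f x))\<^sup>2) \<in> borel_measurable lborel" using L2_measurable[OF Hs_L2(1)[OF f]] by measurable
      show "(\<integral>\<^sup>+x. ennreal (w x powr P) \<partial>lborel) \<le> ennreal (W powr P)" using wW by (simp add: P_def)
      have "L2norm (\<lambda>\<xi>. of_real (norm \<xi> powr s) * F \<xi>) = ?c * L2norm (Dfrac s f)" by (rule plancherel[OF F(2)])
      then show "(\<integral>\<^sup>+x. ennreal (((cmod (f x))\<^sup>2) powr Q) \<partial>lborel) \<le> ennreal ((K\<^sup>2) powr Q)"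
        using sob[OF F(1) is_fourier_L2(2)[OF F(2)]] unfolding pQ KQ by (simp add: K_def mult.assoc)
    qed (use w W K PQ in auto)
    then show "(\<integral>\<^sup>+x. ennreal (w x * (cmod (f x))\<^sup>2) \<partial>lborel) \<le> ennreal (W * (C * ?c * L2norm (Dfrac s f))\<^sup>2)"
      by (simp add: K_def)
  qed
qed

text \<open>One constant serves all coefficients and all functions; that it does not depend on the parameter of the nets is
  what carries negligibility through the estimates.\<close>

definition sobolev_const :: "real \<Rightarrow> real \<Rightarrow> 'a::euclidean_space itself \<Rightarrow> bool" where
  "sobolev_const s C _ \<longleftrightarrow> 0 < C \<and> 
    (\<forall>(f::'a \<Rightarrow> complex) c. f \<in> elems (Hs s) \<longrightarrow> c \<in> elems (Lp (real DIM('a) / s)) \<longrightarrow> 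
       (\<lambda>x. c x * f x) \<in> L2 \<and> L2norm (\<lambda>x. c x * f x) \<le> C * fnorm (Lp (real DIM('a) / s)) c * L2norm (Dfrac s f)) \<and>
    (\<forall>(f::'a \<Rightarrow> complex) a. f \<in> elems (Hs s) \<longrightarrow> a \<in> elems (Lp (real DIM('a) / (2 * s))) \<longrightarrow> 
       (\<lambda>x. of_real (sqrt (cmod (a x))) * f x) \<in> L2 \<and> 
       L2norm (\<lambda>x. of_real (sqrt (cmod (a x))) * f x) \<le> C * sqrt (fnorm (Lp (real DIM('a) / (2 * s))) a) * L2norm (Dfrac s f))"

theorem sobolev_const_exists:
  assumes s: "s > 0" "real DIM('a::euclidean_space) > 2 * s"
  shows "\<exists>C. sobolev_const s C TYPE('a)"
proof -
  let ?d = "real DIM('a)"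
  obtain C where C: "C > 0" and
    sob: "\<And>(f::'a \<Rightarrow> complex) w W. f \<in> elems (Hs s) \<Longrightarrow> w \<in> borel_measurable borel \<Longrightarrow> (\<forall>x. 0 \<le> w x) \<Longrightarrow> 0 \<le> W \<Longrightarrow>
     (\<integral>\<^sup>+x. ennreal (w x powr (?d / (2 * s))) \<partial>lborel) \<le> ennreal (W powr (?d / (2 * s))) \<Longrightarrow>
     (\<integral>\<^sup>+x. ennreal (w x * (cmod (f x))\<^sup>2) \<partial>lborel) \<le> ennreal (W * (C * L2norm (Dfrac s f))\<^sup>2)"
    using weighted_sobolev[OF s] by blast
  have sq: "(r\<^sup>2) powr (?d / (2 * s)) = r powr (?d / s)" if "r \<ge> 0" for r :: real
  proof -
    have "r\<^sup>2 = r powr 2" using that by simp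
    then show ?thesis by (simp add: powr_powr del: powr_numeral)
  qed
  have 1: "(\<lambda>x. c x * f x) \<in> L2 \<and> L2norm (\<lambda>x. c x * f x) \<le> C * fnorm (Lp (?d / s)) c * L2norm (Dfrac s f)" 
    if f: "f \<in> elems (Hs s)" and c: "c \<in> elems (Lp (?d / s))" for f c :: "'a \<Rightarrow> complex"
  proof -
    note cp = Lp_norm_facts[OF c divide_pos_pos[OF _ s(1)], simplified]
    have [measurable]: "c \<in> borel_measurable borel" "f \<in> borel_measurable borel" using cp(1) L2_measurable[OF Hs_L2(1)[OF f]] by auto
    let ?W = "(fnorm (Lp (?d / s)) c)\<^sup>2"
    have "(\<integral>\<^sup>+x. ennreal ((cmod (c x))\<^sup>2 * (cmod (f x))\<^sup>2) \<partial>lborel) \<le> ennreal (?W * (C * L2norm (Dfrac s f))\<^sup>2)"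
      by (rule sob[OF f]) (use cp sq in auto)
    then have "(\<integral>\<^sup>+x. ennreal ((cmod (c x * f x))\<^sup>2) \<partial>lborel) \<le> ennreal ((C * fnorm (Lp (?d / s)) c * L2norm (Dfrac s f))\<^sup>2)"
      by (simp add: norm_mult power_mult_distrib mult_ac)
    from L2_norm_leI[OF _ this] show ?thesis using C cp(2) by auto
  qed
  have 2: "(\<lambda>x. of_real (sqrt (cmod (a x))) * f x) \<in> L2 \<and> L2norm (\<lambda>x. of_real (sqrt (cmod (a x))) * f x) \<le> C * sqrt (fnorm (Lp (?d / (2 * s))) a) * L2norm (Dfrac s f)" 
    if f: "f \<in> elems (Hs s)" and a: "a \<in> elems (Lp (?d / (2 * s)))" for f a :: "'a \<Rightarrow> complex"
  proof -
    note ap = Lp_norm_facts[OF a divide_pos_pos[OF _ mult_pos_pos[OF zero_less_numeral s(1)]], simplified]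
    have [measurable]: "a \<in> borel_measurable borel" "f \<in> borel_measurable borel" using ap(1) L2_measurable[OF Hs_L2(1)[OF f]] by auto
    let ?W = "fnorm (Lp (?d / (2 * s))) a"
    have "(\<integral>\<^sup>+x. ennreal (cmod (a x) * (cmod (f x))\<^sup>2) \<partial>lborel) \<le> ennreal (?W * (C * L2norm (Dfrac s f))\<^sup>2)"
      by (rule sob[OF f]) (use ap in auto)
    then have "(\<integral>\<^sup>+x. ennreal ((cmod (of_real (sqrt (cmod (a x))) * f x))\<^sup>2) \<partial>lborel) \<le> ennreal ((C * sqrt ?W * L2norm (Dfrac s f))\<^sup>2)"
      using ap(2) by (simp add: norm_mult power_mult_distrib mult_ac)
    from L2_norm_leI[OF _ this] show ?thesis using C ap(2) by auto
  qed
  show ?thesis unfolding sobolev_const_def using C 1 2 by blast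
qed

section \<open>Weak derivatives in time\<close>

definition time_bump :: "real \<Rightarrow> real \<Rightarrow> real" where
  "time_bump \<delta> x = flat (\<delta> + x) * flat (\<delta> - x)"

lemma time_bump_values:
  "0 \<le> time_bump \<delta> x" "\<bar>x\<bar> \<ge> \<delta> \<Longrightarrow> time_bump \<delta> x = 0" "\<bar>x\<bar> < \<delta> \<Longrightarrow> 0 < time_bump \<delta> x"
  using flat_bounds[of "\<delta> + x"] flat_bounds[of "\<delta> - x"] by (auto simp: time_bump_def abs_if split: if_splits)

lemma smooth_time_bump_shift: "smooth (\<lambda>t::real. complex_of_real (time_bump \<delta> (t - r)))"
proof -
  have "smooth (\<lambda>t::real. complex_of_real (flat (1 * t + (\<delta> - r))) * complex_of_real (flat (- 1 * t + (\<delta> + r))))"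
    by (intro smooth_mult smooth_of_real smooth_real_exp_flat bounded_linear_ident)
  then show ?thesis by (simp add: time_bump_def algebra_simps)
qed

lemma continuous_time_bump: "continuous_on A (time_bump \<delta>)"
proof -
  have "continuous_on A (\<lambda>t. Re (complex_of_real (time_bump \<delta> (t - 0))))"
    by (intro continuous_intros smooth_continuous[OF smooth_time_bump_shift])
  then show ?thesis by simp
qed

text \<open>Starting the integral at \<open>- 1\<close>, to the left of the support, gives a global antiderivative that vanishes on the
  left and is constant on the right.\<close>

lemma time_bump_antiderivative:
  assumes \<delta>: "0 < \<delta>" "\<delta> \<le> 1 / 2"
  obtains R c where "0 < c" "\<And>x. (R has_real_derivative time_bump \<delta> x) (at x)" 
    "\<And>x. x \<le> - \<delta> \<Longrightarrow> R x = 0" "\<And>x. x \<ge> \<delta> \<Longrightarrow> R x = c"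
proof -
  define R where "R x = integral {-1..x} (time_bump \<delta>)" for x
  have low: "R x = 0" if "x \<le> - \<delta>" for x
  proof -
    have "R x = integral {-1..x} (\<lambda>_. 0)"
      unfolding R_def using that by (intro integral_cong time_bump_values(2)) auto
    then show ?thesis by simp
  qed
  have high: "R x = R \<delta>" if "x \<ge> \<delta>" for x
  proof -
    have "R \<delta> + integral {\<delta>..x} (time_bump \<delta>) = R x"
      unfolding R_def using that \<delta> continuous_time_bump
      by (intro Henstock_Kurzweil_Integration.integral_combine integrable_continuous_real) auto
    moreover have "integral {\<delta>..x} (time_bump \<delta>) = integral {\<delta>..x} (\<lambda>_. 0)"
      by (intro integral_cong time_bump_values(2)) auto
    ultimately show ?thesis by simp
  qed
  have deriv: "(R has_real_derivative time_bump \<delta> x) (at x)" for x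
  proof (cases "x < - \<delta>")
    case True
    have "((\<lambda>_. 0) has_real_derivative time_bump \<delta> x) (at x)"
      using True by (simp add: time_bump_values(2))
    then show ?thesis
      by (rule has_field_derivative_transform_within_open[where S = "{..<-\<delta>}"]) (use True low in auto)
  next
    case False
    have "(R has_real_derivative time_bump \<delta> x) (at x within {-1..x + 1})"
      unfolding R_def using False \<delta> by (intro integral_has_real_derivative continuous_time_bump) auto
    moreover have "at x within {-1..x + 1} = at x"
      using False \<delta> by (intro at_within_interior) auto
    ultimately show ?thesis by simp
  qed
  have "R (- \<delta>) < R \<delta>"
  proof (rule DERIV_pos_imp_increasing_open[where f = R])
    show "continuous_on {- \<delta>..\<delta>} R"
      using deriv by (intro continuous_at_imp_continuous_on) (auto dest: DERIV_isCont)
  qed (use \<delta> deriv time_bump_values(3)[of _ \<delta>] in \<open>auto intro!: exI\<close>)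
  then have "0 < R \<delta>" using low[of "- \<delta>"] by simp
  then show thesis by (rule that[OF _ deriv low high])
qed

text \<open>A test function on the open interval together with its first two derivatives. Its support keeps away from both ends,
  so no boundary terms arise.\<close>

definition time_test :: "real \<Rightarrow> (real \<Rightarrow> complex) \<Rightarrow> (real \<Rightarrow> complex) \<Rightarrow> (real \<Rightarrow> complex) \<Rightarrow> bool" where
  "time_test T \<theta> \<theta>' \<theta>'' \<longleftrightarrow> smooth \<theta> \<and> continuous_on UNIV \<theta>'' \<and>
     (\<forall>t. (\<theta> has_vector_derivative \<theta>' t) (at t)) \<and> (\<forall>t. (\<theta>' has_vector_derivative \<theta>'' t) (at t)) \<and>
     (\<exists>r0 r1. 0 < r0 \<and> r1 < T \<and> (\<forall>t. t \<notin> {r0..r1} \<longrightarrow> \<theta> t = 0 \<and> \<theta>' t = 0))"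

lemma smooth_vector_derivative:
  assumes "smooth (f :: real \<Rightarrow> complex)"
  obtains f' where "\<And>t. (f has_vector_derivative f' t) (at t)" "smooth f'"
proof -
  show thesis
  proof (rule that)
    show "(f has_vector_derivative frechet_derivative f (at t) 1) (at t)" for t
    proof -
      note d = smooth_step(1)[OF assms, of t]
      then have "frechet_derivative f (at t) = (\<lambda>x. x *\<^sub>R frechet_derivative f (at t) 1)"
        by (metis has_derivative_bounded_linear linear_cmul bounded_linear.linear mult.right_neutral real_scaleR_def)
      with d show ?thesis unfolding has_vector_derivative_def by metis
    qed
    show "smooth (\<lambda>t. frechet_derivative f (at t) 1)" by (rule smooth_step(2)[OF assms])
  qed
qed

lemma smooth_antiderivative:
  assumes d: "\<And>t. (f has_vector_derivative f' t) (at t)" and "smooth (f' :: real \<Rightarrow> complex)"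
  shows "smooth f"
proof (rule smooth_coinduct)
  show "f \<in> insert f {g. smooth g}" by simp
  fix g assume "g \<in> insert f {g. smooth g}"
  then consider "g = f" | "smooth g" by auto
  then show "\<exists>g'. (\<forall>x. (g has_derivative g' x) (at x)) \<and> (\<forall>v. (\<lambda>x. g' x v) \<in> insert f {g. smooth g})"
  proof cases
    case 1
    have "smooth (\<lambda>x. of_real v * f' x)" for v by (intro smooth_mult smooth_const assms)
    then show ?thesis using d unfolding 1 has_vector_derivative_def
      by (intro exI[of _ "\<lambda>x v. v *\<^sub>R f' x"]) (auto simp: scaleR_conv_of_real)
  next
    case 2
    then show ?thesis using smooth_step[OF 2]
      by (intro exI[of _ "\<lambda>x. frechet_derivative g (at x)"]) auto
  qed
qed

lemma LINT_Ioo_eq_integral: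
  fixes h :: "real \<Rightarrow> complex"
  assumes "continuous_on {0..T} h"
  shows "(LINT t:{0<..<T}|lborel. h t) = integral {0..T} h"
proof -
  have "set_integrable lborel {0<..<T} h"
    by (rule set_integrable_subset[OF borel_integrable_atLeastAtMost'[OF assms]]) auto
  from set_borel_integral_eq_integral(2)[OF this] show ?thesis
    by (simp add: integral_open_interval_real)
qed

lemma time_bump_average:
  fixes k :: "real \<Rightarrow> complex"
  assumes \<delta>: "0 < \<delta>" and R: "\<And>x. (R has_real_derivative time_bump \<delta> x) (at x)" 
    "\<And>x. x \<le> - \<delta> \<Longrightarrow> R x = 0" "\<And>x. x \<ge> \<delta> \<Longrightarrow> R x = c"
    and r: "\<delta> \<le> r" "r \<le> T - \<delta>" and k: "continuous_on {0..T} k"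
    and \<eta>: "\<And>t. t \<in> {0..T} \<Longrightarrow> \<bar>t - r\<bar> \<le> \<delta> \<Longrightarrow> cmod (k t - k r) \<le> \<eta>"
  shows "cmod (integral {0..T} (\<lambda>t. of_real (time_bump \<delta> (t - r)) * k t) - of_real c * k r) \<le> \<eta> * c"
proof -
  have cb: "continuous_on A (\<lambda>t. time_bump \<delta> (t - r))" for A
    by (rule continuous_on_compose2[OF continuous_time_bump[of UNIV]]) (auto intro!: continuous_intros)
  have "((\<lambda>t. time_bump \<delta> (t - r)) has_integral (R (T - r) - R (0 - r))) {0..T}"
  proof (rule fundamental_theorem_of_calculus)
    fix t assume "t \<in> {0..T}"
    have "((\<lambda>t. R (t - r)) has_real_derivative time_bump \<delta> (t - r)) (at t)"
      using DERIV_chain2[OF R(1) DERIV_diff[OF DERIV_ident DERIV_const]] by simp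
    then show "((\<lambda>t. R (t - r)) has_vector_derivative time_bump \<delta> (t - r)) (at t within {0..T})"
      by (simp add: has_real_derivative_iff_has_vector_derivative has_vector_derivative_at_within)
  qed (use \<delta> r in auto)
  then have I: "((\<lambda>t. time_bump \<delta> (t - r)) has_integral c) {0..T}"
    using R(2)[of "0 - r"] R(3)[of "T - r"] r by simp
  have Ic: "((\<lambda>t. of_real (time_bump \<delta> (t - r)) * k r) has_integral of_real c * k r) {0..T}"
    by (rule has_integral_mult_left[OF has_integral_of_real[OF I]])
  have int: "(\<lambda>t. of_real (time_bump \<delta> (t - r)) * k t) integrable_on {0..T}"
    by (intro integrable_continuous_real continuous_intros cb k)
  have "integral {0..T} (\<lambda>t. of_real (time_bump \<delta> (t - r)) * k t) - of_real c * k r = 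
    integral {0..T} (\<lambda>t. of_real (time_bump \<delta> (t - r)) * k t - of_real (time_bump \<delta> (t - r)) * k r)"
    by (simp only: Henstock_Kurzweil_Integration.integral_diff[OF int has_integral_integrable[OF Ic]] integral_unique[OF Ic])
  also have "cmod \<dots> \<le> integral {0..T} (\<lambda>t. \<eta> * time_bump \<delta> (t - r))"
  proof (rule Henstock_Kurzweil_Integration.integral_norm_bound_integral)
    show "(\<lambda>t. of_real (time_bump \<delta> (t - r)) * k t - of_real (time_bump \<delta> (t - r)) * k r) integrable_on {0..T}"
      by (intro integrable_continuous_real continuous_intros cb k)
    show "(\<lambda>t. \<eta> * time_bump \<delta> (t - r)) integrable_on {0..T}"
      by (intro integrable_continuous_real continuous_intros cb)
    fix t assume t: "t \<in> {0..T}"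
    have "cmod (of_real (time_bump \<delta> (t - r)) * k t - of_real (time_bump \<delta> (t - r)) * k r) = time_bump \<delta> (t - r) * cmod (k t - k r)"
      unfolding right_diff_distrib[symmetric] norm_mult using time_bump_values(1) by simp
    also have "\<dots> \<le> time_bump \<delta> (t - r) * \<eta>"
    proof (cases "\<bar>t - r\<bar> \<le> \<delta>")
      case True
      then show ?thesis by (intro mult_left_mono \<eta> t time_bump_values)
    qed (simp add: time_bump_values)
    finally show "cmod (of_real (time_bump \<delta> (t - r)) * k t - of_real (time_bump \<delta> (t - r)) * k r) \<le> \<eta> * time_bump \<delta> (t - r)"
      by (simp add: mult.commute)
  qed
  also have "\<dots> = \<eta> * c" using integral_unique[OF I] by simp
  finally show ?thesis .
qed

text \<open>If \<open>p'' = - \<gamma>\<close> holds against test functions and \<open>p' = m\<close> is continuous, then \<open>m\<close> is differentiable up to the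
  end points.\<close>

lemma du_bois_reymond:
  fixes p m \<gamma> :: "real \<Rightarrow> complex"
  assumes T: "T > 0"
    and p': "\<And>t. t \<in> {0..T} \<Longrightarrow> (p has_vector_derivative m t) (at t within {0..T})"
    and mc: "continuous_on {0..T} m" and gc: "continuous_on {0..T} \<gamma>"
    and weak: "\<And>\<theta> \<theta>' \<theta>''. time_test T \<theta> \<theta>' \<theta>'' \<Longrightarrow> (LINT t:{0<..<T}|lborel. \<theta>'' t * p t + \<theta> t * \<gamma> t) = 0"
    and t: "t \<in> {0..T}"
  shows "(m has_vector_derivative - \<gamma> t) (at t within {0..T})"
proof -
  \<comment> \<open>Two integrations by parts turn the weak equation into \<open>\<integral> \<theta>' k = 0\<close>, where \<open>k = m + \<Gamma>\<close> should be constant.\<close>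
  define \<Gamma> where "\<Gamma> t = integral {0..t} \<gamma>" for t
  define k where "k t = m t + \<Gamma> t" for t
  have \<Gamma>': "(\<Gamma> has_vector_derivative \<gamma> t) (at t within {0..T})" if "t \<in> {0..T}" for t
    unfolding \<Gamma>_def using integral_has_vector_derivative[OF gc that] .
  have \<Gamma>c: "continuous_on {0..T} \<Gamma>"
    using \<Gamma>' by (intro continuous_on_vector_derivative) auto
  have pc: "continuous_on {0..T} p"
    using p' by (intro continuous_on_vector_derivative) auto
  have kc: "continuous_on {0..T} k" unfolding k_def by (intro continuous_intros mc \<Gamma>c)
  have weak2: "integral {0..T} (\<lambda>t. \<theta>' t * k t) = 0" if \<theta>: "time_test T \<theta> \<theta>' \<theta>''" for \<theta> \<theta>' \<theta>''
  proof -
    from \<theta> have d: "\<And>t. (\<theta> has_vector_derivative \<theta>' t) (at t within {0..T})" "\<And>t. (\<theta>' has_vector_derivative \<theta>'' t) (at t within {0..T})"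
      and c'': "continuous_on UNIV \<theta>''"
      by (auto simp: time_test_def has_vector_derivative_at_within)
    from \<theta> have z: "\<theta> 0 = 0" "\<theta> T = 0" "\<theta>' 0 = 0" "\<theta>' T = 0" by (auto simp: time_test_def)
    have c: "continuous_on {0..T} \<theta>" "continuous_on {0..T} \<theta>'" "continuous_on {0..T} \<theta>''"
      using d c'' by (auto intro: continuous_on_vector_derivative continuous_on_subset)
    define W where "W t = \<theta>' t * p t + \<theta> t * \<Gamma> t" for t
    have "((\<lambda>t. (\<theta>'' t * p t + \<theta> t * \<gamma> t) + \<theta>' t * k t) has_integral (W T - W 0)) {0..T}"
    proof (rule fundamental_theorem_of_calculus)
      fix t assume t: "t \<in> {0..T}"
      have "(W has_vector_derivative (\<theta>' t * m t + \<theta>'' t * p t) + (\<theta> t * \<gamma> t + \<theta>' t * \<Gamma> t)) (at t within {0..T})"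
        unfolding W_def by (intro has_vector_derivative_add has_vector_derivative_mult d p' \<Gamma>' t)
      then show "(W has_vector_derivative (\<theta>'' t * p t + \<theta> t * \<gamma> t) + \<theta>' t * k t) (at t within {0..T})"
        by (simp add: k_def algebra_simps)
    qed (use T in simp)
    then have "integral {0..T} (\<lambda>t. (\<theta>'' t * p t + \<theta> t * \<gamma> t) + \<theta>' t * k t) = 0"
      by (simp add: W_def z integral_unique)
    moreover have "integral {0..T} (\<lambda>t. (\<theta>'' t * p t + \<theta> t * \<gamma> t) + \<theta>' t * k t) = 
      integral {0..T} (\<lambda>t. \<theta>'' t * p t + \<theta> t * \<gamma> t) + integral {0..T} (\<lambda>t. \<theta>' t * k t)"
      by (intro Henstock_Kurzweil_Integration.integral_add integrable_continuous_real continuous_intros c pc gc kc)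
    moreover have "integral {0..T} (\<lambda>t. \<theta>'' t * p t + \<theta> t * \<gamma> t) = 0"
      using weak[OF \<theta>] by (subst LINT_Ioo_eq_integral[symmetric]) (auto intro!: continuous_intros c pc gc)
    ultimately show ?thesis by simp
  qed
  have const: "k r = k r'" if r: "0 < r" "r < T" "0 < r'" "r' < T" for r r'
  proof -
    have "cmod (k r - k r') \<le> 0 + e" if "e > 0" for e
    proof -
      have e2: "e / 2 > 0" using that by simp
      have "\<exists>d>0. \<forall>t\<in>{0..T}. \<bar>t - x\<bar> < d \<longrightarrow> cmod (k t - k x) < e / 2" if "x \<in> {0..T}" for x
        using kc e2 that unfolding continuous_on_iff dist_norm real_norm_def by blast
      then obtain d d' where d: "d > 0" "\<And>t. t \<in> {0..T} \<Longrightarrow> \<bar>t - r\<bar> < d \<Longrightarrow> cmod (k t - k r) < e / 2"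
        and d': "d' > 0" "\<And>t. t \<in> {0..T} \<Longrightarrow> \<bar>t - r'\<bar> < d' \<Longrightarrow> cmod (k t - k r') < e / 2"
        using r by (metis atLeastAtMost_iff less_imp_le)
      \<comment> \<open>Bumps of this radius stay inside the interval and inside the regions where \<open>k\<close> varies by less than \<open>e / 2\<close>.\<close>
      define \<delta> where "\<delta> = Min {1/2, d/2, d'/2, r/2, r'/2, (T - r)/2, (T - r')/2}"
      have \<delta>0: "\<delta> > 0" unfolding \<delta>_def using r d d' by (subst Min_gr_iff) auto
      have D: "\<delta> \<le> 1/2" "\<delta> \<le> d/2" "\<delta> \<le> d'/2" "\<delta> \<le> r/2" "\<delta> \<le> r'/2" "\<delta> \<le> (T - r)/2" "\<delta> \<le> (T - r')/2"
        unfolding \<delta>_def by (intro Min_le; simp)+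
      have \<delta>: "0 < \<delta>" "\<delta> \<le> 1/2" "\<delta> < d" "\<delta> < d'" "\<delta> < r" "\<delta> < r'"
        using \<delta>0 D(1-5) d(1) d'(1) r by linarith+
      have \<delta>T: "\<delta> < T - r" "\<delta> < T - r'"
        using \<delta>0 D(6,7) by auto
      obtain R c where R: "0 < c" "\<And>x. (R has_real_derivative time_bump \<delta> x) (at x)" 
        "\<And>x. x \<le> - \<delta> \<Longrightarrow> R x = 0" "\<And>x. x \<ge> \<delta> \<Longrightarrow> R x = c"
        by (rule time_bump_antiderivative[OF \<delta>(1,2)]; rule that; assumption)
      \<comment> \<open>The derivative of \<open>\<theta>\<close> is a bump at \<open>r\<close> minus the same bump at \<open>r'\<close>. Its total mass is zero,
        so that \<open>\<theta>\<close> itself has compact support, and it compares the averages of \<open>k\<close> near \<open>r\<close> and \<open>r'\<close>.\<close>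
      define \<theta> \<theta>' where "\<theta> t = complex_of_real (R (t - r) - R (t - r'))" 
        and "\<theta>' t = complex_of_real (time_bump \<delta> (t - r)) + (-1) * complex_of_real (time_bump \<delta> (t - r'))" for t
      have s': "smooth \<theta>'" unfolding \<theta>'_def[abs_def]
        by (intro smooth_add smooth_mult smooth_const smooth_time_bump_shift)
      have sh: "((\<lambda>t. R (t - q)) has_real_derivative time_bump \<delta> (t - q)) (at t)" for q t
        using DERIV_chain2[OF R(2) DERIV_diff[OF DERIV_ident DERIV_const]] by simp
      have d1: "(\<theta> has_vector_derivative \<theta>' t) (at t)" for t
      proof -
        have "((\<lambda>t. R (t - r) - R (t - r')) has_real_derivative (time_bump \<delta> (t - r) - time_bump \<delta> (t - r'))) (at t)"
          by (intro derivative_intros sh)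
        from has_vector_derivative_of_real[OF this] show ?thesis by (simp add: \<theta>_def[abs_def] \<theta>'_def)
      qed
      obtain \<theta>'' where d2: "\<And>t. (\<theta>' has_vector_derivative \<theta>'' t) (at t)" "smooth \<theta>''"
        using smooth_vector_derivative[OF s'] by blast
      have "time_test T \<theta> \<theta>' \<theta>''"
        unfolding time_test_def
      proof (intro conjI allI d1 d2(1) smooth_antiderivative[OF d1 s'] smooth_continuous[OF d2(2)])
        show "\<exists>r0 r1. 0 < r0 \<and> r1 < T \<and> (\<forall>t. t \<notin> {r0..r1} \<longrightarrow> \<theta> t = 0 \<and> \<theta>' t = 0)"
        proof (rule exI[of _ "min r r' - \<delta>"], rule exI[of _ "max r r' + \<delta>"], intro conjI allI impI)
          fix t assume "t \<notin> {min r r' - \<delta>..max r r' + \<delta>}"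
          then consider "t - r \<le> - \<delta>" "t - r' \<le> - \<delta>" | "t - r \<ge> \<delta>" "t - r' \<ge> \<delta>" by fastforce
          then have "R (t - r) = R (t - r') \<and> \<delta> \<le> \<bar>t - r\<bar> \<and> \<delta> \<le> \<bar>t - r'\<bar>"
          proof cases
            case 1
            then show ?thesis using R(3)[OF 1(1)] R(3)[OF 1(2)] by (auto simp: abs_real_def)
          next
            case 2
            then show ?thesis using R(4)[OF 2(1)] R(4)[OF 2(2)] by (auto simp: abs_real_def)
          qed
          then show "\<theta> t = 0" "\<theta>' t = 0"
            by (simp_all add: \<theta>_def \<theta>'_def time_bump_values(2))
        qed (use \<delta> \<delta>T in auto)
      qed
      from weak2[OF this] have "integral {0..T} (\<lambda>t. \<theta>' t * k t) = 0" .
      moreover have "integral {0..T} (\<lambda>t. \<theta>' t * k t) = integral {0..T} (\<lambda>t. of_real (time_bump \<delta> (t - r)) * k t) - integral {0..T} (\<lambda>t. of_real (time_bump \<delta> (t - r')) * k t)"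
        unfolding \<theta>'_def
        by (subst Henstock_Kurzweil_Integration.integral_diff[symmetric])
           (auto intro!: integrable_continuous_real continuous_intros kc continuous_on_compose2[OF continuous_time_bump[of UNIV]] simp: algebra_simps)
      ultimately have eq: "integral {0..T} (\<lambda>t. of_real (time_bump \<delta> (t - r)) * k t) = integral {0..T} (\<lambda>t. of_real (time_bump \<delta> (t - r')) * k t)"
        by simp
      have A: "cmod (integral {0..T} (\<lambda>t. of_real (time_bump \<delta> (t - r)) * k t) - of_real c * k r) \<le> e / 2 * c"
        by (rule time_bump_average[OF \<delta>(1) R(2-4) _ _ kc]) (use \<delta> \<delta>T d(2) in \<open>auto intro: less_imp_le\<close>)
      have B: "cmod (integral {0..T} (\<lambda>t. of_real (time_bump \<delta> (t - r')) * k t) - of_real c * k r') \<le> e / 2 * c"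
        by (rule time_bump_average[OF \<delta>(1) R(2-4) _ _ kc]) (use \<delta> \<delta>T d'(2) in \<open>auto intro: less_imp_le\<close>)
      have "c * cmod (k r - k r') = cmod (of_real c * k r - of_real c * k r')"
        unfolding right_diff_distrib[symmetric] norm_mult using R(1) by simp
      also have "\<dots> \<le> e / 2 * c + e / 2 * c"
        using norm_triangle_le_diff[OF order_trans[OF order_refl add_mono[OF B[folded eq] A]]] by simp
      finally have "c * cmod (k r - k r') \<le> c * e" by (simp add: algebra_simps)
      then show ?thesis using R(1) by simp
    qed
    then have "cmod (k r - k r') \<le> 0" by (rule field_le_epsilon)
    then show ?thesis by simp
  qed
  have kconst: "k t = k (T / 2)" if t: "t \<in> {0..T}" for t
  proof (rule continuous_constant_on_closure[of "{0<..<T}"])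
    show "continuous_on (closure {0<..<T}) k" using kc T by simp
    show "k x = k (T / 2)" if "x \<in> {0<..<T}" for x using const[of x "T / 2"] that T by auto
  qed (use t T in simp)
  have "((\<lambda>t. k (T / 2) - \<Gamma> t) has_vector_derivative 0 - \<gamma> t) (at t within {0..T})"
    by (intro has_vector_derivative_diff has_vector_derivative_const \<Gamma>' t)
  then have deriv: "((\<lambda>t. k (T / 2) - \<Gamma> t) has_vector_derivative - \<gamma> t) (at t within {0..T})" by simp
  show ?thesis
  proof (rule has_vector_derivative_transform[OF t _ deriv])
    fix x assume "x \<in> {0..T}"
    from kconst[OF this] show "m x = k (T / 2) - \<Gamma> x" by (simp add: k_def eq_diff_eq)
  qed
qed

section \<open>Weak solutions are differentiable curves\<close>

text \<open>One-sided at the end points of an interval \<open>S\<close>. Curves consist of representatives and need not be jointly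
  measurable, so differentiability is expressed by difference quotients in norm and never by integrals in time.\<close>

definition has_L2_derivative ::
  "(real \<Rightarrow> 'a::euclidean_space \<Rightarrow> complex) \<Rightarrow> ('a \<Rightarrow> complex) \<Rightarrow> real \<Rightarrow> real set \<Rightarrow> bool" where
  "has_L2_derivative u v t S \<longleftrightarrow>
     ((\<lambda>\<tau>. L2norm (\<lambda>x. (u \<tau> x - u t x) / of_real (\<tau> - t) - v x)) \<longlongrightarrow> 0) (at t within S)"

definition L2_continuous :: "(real \<Rightarrow> 'a::euclidean_space \<Rightarrow> complex) \<Rightarrow> real \<Rightarrow> real set \<Rightarrow> bool" where
  "L2_continuous g t S \<longleftrightarrow> ((\<lambda>\<tau>. L2norm (\<lambda>x. g \<tau> x - g t x)) \<longlongrightarrow> 0) (at t within S)"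

lemma tendsto_null_within:
  fixes f g :: "real \<Rightarrow> real"
  assumes "(g \<longlongrightarrow> 0) (at t within S)" "\<And>\<tau>. \<tau> \<in> S \<Longrightarrow> \<tau> \<noteq> t \<Longrightarrow> 0 \<le> f \<tau> \<and> f \<tau> \<le> g \<tau>"
  shows "(f \<longlongrightarrow> 0) (at t within S)"
proof (rule Lim_null_comparison[OF _ assms(1)])
  show "\<forall>\<^sub>F x in at t within S. norm (f x) \<le> g x"
    unfolding eventually_at_filter by (rule always_eventually) (use assms(2) in auto)
qed

lemma cancel_quotient: "c \<noteq> 0 \<Longrightarrow> c * (p / c - q) = p - c * q" for c p q :: complex
  by (simp add: right_diff_distrib)

lemma pairing_has_derivative:
  fixes u :: "real \<Rightarrow> 'a::euclidean_space \<Rightarrow> complex"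
  assumes u: "\<And>\<tau>. \<tau> \<in> S \<Longrightarrow> u \<tau> \<in> L2" and t: "t \<in> S" and v: "v \<in> L2" 
    and d: "has_L2_derivative u v t S" and \<psi>: "\<psi> \<in> L2"
  shows "((\<lambda>\<tau>. \<integral>x. u \<tau> x * \<psi> x \<partial>lborel) has_vector_derivative (\<integral>x. v x * \<psi> x \<partial>lborel)) (at t within S)"
  unfolding has_vector_derivative_def has_derivative_within
proof (intro conjI bounded_linear_scaleR_left)
  let ?p = "\<lambda>\<tau>. \<integral>x. u \<tau> x * \<psi> x \<partial>lborel" and ?m = "\<integral>x. v x * \<psi> x \<partial>lborel"
  have lim: "((\<lambda>\<tau>. L2norm (\<lambda>x. (u \<tau> x - u t x) / of_real (\<tau> - t) - v x) * L2norm \<psi>) \<longlongrightarrow> 0) (at t within S)"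
    using tendsto_mult[OF d[unfolded has_L2_derivative_def] tendsto_const[of "L2norm \<psi>"]] by simp
  have "((\<lambda>\<tau>. norm ((1 / norm (\<tau> - t)) *\<^sub>R (?p \<tau> - (?p t + (\<tau> - t) *\<^sub>R ?m)))) \<longlongrightarrow> 0) (at t within S)"
  proof (rule tendsto_null_within[OF lim], intro conjI norm_ge_zero)
    fix \<tau> assume \<tau>: "\<tau> \<in> S" "\<tau> \<noteq> t"
    let ?D = "\<lambda>x. (u \<tau> x - u t x) / of_real (\<tau> - t) - v x"
    have D: "?D \<in> L2" using u[OF \<tau>(1)] u[OF t] v by (intro L2_diff L2_divide)
    have "of_real (\<tau> - t) * (\<integral>x. ?D x * \<psi> x \<partial>lborel) = (\<integral>x. of_real (\<tau> - t) * (?D x * \<psi> x) \<partial>lborel)"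
      by (rule integral_mult_right_zero[symmetric])
    also have "\<dots> = (\<integral>x. u \<tau> x * \<psi> x - u t x * \<psi> x - of_real (\<tau> - t) * (v x * \<psi> x) \<partial>lborel)"
    proof (rule Bochner_Integration.integral_cong[OF refl])
      fix x
      have "complex_of_real (\<tau> - t) \<noteq> 0" using \<tau> by simp
      then have eq: "of_real (\<tau> - t) * ?D x = u \<tau> x - u t x - of_real (\<tau> - t) * v x"
        by (rule cancel_quotient)
      have "of_real (\<tau> - t) * (?D x * \<psi> x) = (u \<tau> x - u t x - of_real (\<tau> - t) * v x) * \<psi> x"
        by (simp only: mult.assoc[symmetric] eq)
      then show "of_real (\<tau> - t) * (?D x * \<psi> x) = u \<tau> x * \<psi> x - u t x * \<psi> x - of_real (\<tau> - t) * (v x * \<psi> x)"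
        by (simp add: left_diff_distrib mult.assoc del: of_real_diff)
    qed
    also have "\<dots> = ?p \<tau> - ?p t - of_real (\<tau> - t) * ?m"
      using L2_integrable_mult[OF u[OF \<tau>(1)] \<psi>] L2_integrable_mult[OF u[OF t] \<psi>] L2_integrable_mult[OF v \<psi>] by simp
    finally have eq: "?p \<tau> - (?p t + (\<tau> - t) *\<^sub>R ?m) = of_real (\<tau> - t) * (\<integral>x. ?D x * \<psi> x \<partial>lborel)"
      by (simp only: scaleR_conv_of_real diff_diff_eq)
    have "norm ((1 / norm (\<tau> - t)) *\<^sub>R (?p \<tau> - (?p t + (\<tau> - t) *\<^sub>R ?m))) = cmod (\<integral>x. ?D x * \<psi> x \<partial>lborel)"
      unfolding eq norm_scaleR norm_mult norm_of_real using \<tau> by simp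
    also have "\<dots> \<le> L2norm ?D * L2norm \<psi>" by (rule Cauchy_Schwarz_bilinear[OF D \<psi>])
    finally show "norm ((1 / norm (\<tau> - t)) *\<^sub>R (?p \<tau> - (?p t + (\<tau> - t) *\<^sub>R ?m))) \<le> L2norm ?D * L2norm \<psi>" .
  qed
  then show "((\<lambda>\<tau>. (1 / norm (\<tau> - t)) *\<^sub>R (?p \<tau> - (?p t + (\<tau> - t) *\<^sub>R ?m))) \<longlongrightarrow> 0) (at t within S)"
    by (rule tendsto_norm_zero_cancel)
qed

lemma pairing_continuous:
  fixes g :: "real \<Rightarrow> 'a::euclidean_space \<Rightarrow> complex"
  assumes g: "\<And>\<tau>. \<tau> \<in> S \<Longrightarrow> g \<tau> \<in> L2" and c: "\<And>t. t \<in> S \<Longrightarrow> L2_continuous g t S" and \<psi>: "\<psi> \<in> L2"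
  shows "continuous_on S (\<lambda>\<tau>. \<integral>x. g \<tau> x * \<psi> x \<partial>lborel)"
  unfolding continuous_on_def
proof
  fix t assume t: "t \<in> S"
  let ?p = "\<lambda>\<tau>. \<integral>x. g \<tau> x * \<psi> x \<partial>lborel"
  have lim: "((\<lambda>\<tau>. L2norm (\<lambda>x. g \<tau> x - g t x) * L2norm \<psi>) \<longlongrightarrow> 0) (at t within S)"
    using tendsto_mult[OF c[OF t, unfolded L2_continuous_def] tendsto_const[of "L2norm \<psi>"]] by simp
  have "((\<lambda>\<tau>. norm (?p \<tau> - ?p t)) \<longlongrightarrow> 0) (at t within S)"
  proof (rule tendsto_null_within[OF lim], intro conjI norm_ge_zero)
    fix \<tau> assume \<tau>: "\<tau> \<in> S"
    have "?p \<tau> - ?p t = (\<integral>x. (g \<tau> x - g t x) * \<psi> x \<partial>lborel)"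
      using L2_integrable_mult[OF g[OF \<tau>] \<psi>] L2_integrable_mult[OF g[OF t] \<psi>] by (simp add: left_diff_distrib)
    then show "norm (?p \<tau> - ?p t) \<le> L2norm (\<lambda>x. g \<tau> x - g t x) * L2norm \<psi>"
      using Cauchy_Schwarz_bilinear[OF L2_diff[OF g[OF \<tau>] g[OF t]] \<psi>] by simp
  qed
  then have "((\<lambda>\<tau>. ?p \<tau> - ?p t) \<longlongrightarrow> 0) (at t within S)" by (rule tendsto_norm_zero_cancel)
  then show "(?p \<longlongrightarrow> ?p t) (at t within S)" by (rule LIM_zero_cancel)
qed

text \<open>Tested with \<open>\<psi>\<close>, the equation becomes an ordinary differential equation for scalar functions. The mean value
  inequality bounds the difference quotients of \<open>v\<close> against \<open>\<psi>\<close> by the modulus of continuity of \<open>g\<close>, uniformly in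
  \<open>\<psi>\<close>; duality makes this a bound in \<open>L\<^sup>2\<close>.\<close>

lemma L2_derivative_of_weak_equation:
  fixes u v g :: "real \<Rightarrow> 'a::euclidean_space \<Rightarrow> complex"
  assumes T: "T > 0"
    and L2: "\<And>t. t \<in> {0..T} \<Longrightarrow> u t \<in> L2" "\<And>t. t \<in> {0..T} \<Longrightarrow> v t \<in> L2" "\<And>t. t \<in> {0..T} \<Longrightarrow> g t \<in> L2"
    and u': "\<And>t. t \<in> {0..T} \<Longrightarrow> has_L2_derivative u (v t) t {0..T}"
    and vc: "\<And>t. t \<in> {0..T} \<Longrightarrow> L2_continuous v t {0..T}"
    and gc: "\<And>t. t \<in> {0..T} \<Longrightarrow> L2_continuous g t {0..T}"
    and weak: "\<And>\<psi> \<theta> \<theta>' \<theta>''. test_function UNIV \<psi> \<Longrightarrow> time_test T \<theta> \<theta>' \<theta>'' \<Longrightarrow> 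
      (LINT t:{0<..<T}|lborel. \<theta>'' t * (\<integral>x. u t x * \<psi> x \<partial>lborel) + \<theta> t * (\<integral>x. g t x * \<psi> x \<partial>lborel)) = 0"
    and t: "t \<in> {0..T}"
  shows "has_L2_derivative v (\<lambda>x. - g t x) t {0..T}"
  unfolding has_L2_derivative_def
proof (rule tendstoI)
  fix e :: real assume e: "e > 0"
  have e2: "e / 2 > 0" using e by simp
  from tendstoD[OF gc[OF t, unfolded L2_continuous_def] e2] obtain d where d: "d > 0"
    "\<And>\<tau>. \<tau> \<in> {0..T} \<Longrightarrow> \<tau> \<noteq> t \<Longrightarrow> dist \<tau> t < d \<Longrightarrow> L2norm (\<lambda>x. g \<tau> x - g t x) < e / 2"
    unfolding eventually_at by auto
  have dd: "L2norm (\<lambda>x. g \<tau> x - g t x) \<le> e / 2" if "\<tau> \<in> {0..T}" "dist \<tau> t < d" for \<tau>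
    using d(2)[OF that(1)] that(2) e by (cases "\<tau> = t") (auto intro: less_imp_le)
  have step: "L2norm (\<lambda>x. (v \<tau> x - v t x) / of_real (\<tau> - t) - (- g t x)) \<le> e / 2" 
    if \<tau>: "\<tau> \<in> {0..T}" "\<tau> \<noteq> t" "dist \<tau> t < d" for \<tau>
  proof -
    let ?H = "\<lambda>x. (v \<tau> x - v t x) / of_real (\<tau> - t) - (- g t x)"
    have H: "?H \<in> L2" using L2(2)[OF \<tau>(1)] L2(2)[OF t] L2(3)[OF t] by (intro L2_diff L2_divide L2_uminus)
    show ?thesis
    proof (rule L2norm_le_by_test_functions[OF H])
      fix \<psi> :: "'a \<Rightarrow> complex" assume tf: "test_function UNIV \<psi>"
      have \<psi>: "\<psi> \<in> L2" using tf by (rule test_function_L2)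
      let ?m = "\<lambda>\<tau>. \<integral>x. v \<tau> x * \<psi> x \<partial>lborel" and ?\<gamma> = "\<lambda>\<tau>. \<integral>x. g \<tau> x * \<psi> x \<partial>lborel"
      have m': "(?m has_vector_derivative - ?\<gamma> \<sigma>) (at \<sigma> within {0..T})" if "\<sigma> \<in> {0..T}" for \<sigma>
        by (rule du_bois_reymond[OF T pairing_has_derivative[OF L2(1) _ L2(2) u' \<psi>] pairing_continuous[OF L2(2) vc \<psi>]
              pairing_continuous[OF L2(3) gc \<psi>] weak[OF tf] that])
      have seg: "closed_segment t \<tau> \<subseteq> {0..T}" using t \<tau>(1) by (auto simp: closed_segment_eq_real_ivl)
      have "norm (?m \<tau> - ?m t - (\<tau> - t) *\<^sub>R (- ?\<gamma> t)) \<le> norm (\<tau> - t) * (e / 2 * L2norm \<psi>)"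
      proof (rule vector_differentiable_bound_linearization[where S = "closed_segment t \<tau>"])
        show "(?m has_vector_derivative - ?\<gamma> \<sigma>) (at \<sigma> within closed_segment t \<tau>)" if "\<sigma> \<in> closed_segment t \<tau>" for \<sigma>
          by (rule has_vector_derivative_within_subset[OF m' seg]) (use that seg in auto)
        fix \<sigma> assume \<sigma>: "\<sigma> \<in> closed_segment t \<tau>"
        then have \<sigma>T: "\<sigma> \<in> {0..T}" using seg by auto
        have "dist \<sigma> t < d" using \<sigma> \<tau>(3) by (auto simp: closed_segment_eq_real_ivl dist_real_def split: if_splits)
        from dd[OF \<sigma>T this] have gb: "L2norm (\<lambda>x. g \<sigma> x - g t x) \<le> e / 2" .
        have "- ?\<gamma> \<sigma> - - ?\<gamma> t = - (\<integral>x. (g \<sigma> x - g t x) * \<psi> x \<partial>lborel)"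
          using L2_integrable_mult[OF L2(3)[OF \<sigma>T] \<psi>] L2_integrable_mult[OF L2(3)[OF t] \<psi>] by (simp add: left_diff_distrib)
        then have "norm (- ?\<gamma> \<sigma> - - ?\<gamma> t) \<le> L2norm (\<lambda>x. g \<sigma> x - g t x) * L2norm \<psi>"
          using Cauchy_Schwarz_bilinear[OF L2_diff[OF L2(3)[OF \<sigma>T] L2(3)[OF t]] \<psi>] by simp
        also have "\<dots> \<le> e / 2 * L2norm \<psi>" by (intro mult_right_mono gb) simp
        finally show "norm (- ?\<gamma> \<sigma> - - ?\<gamma> t) \<le> e / 2 * L2norm \<psi>" .
      qed auto
      moreover have "?m \<tau> - ?m t - (\<tau> - t) *\<^sub>R (- ?\<gamma> t) = of_real (\<tau> - t) * (\<integral>x. ?H x * \<psi> x \<partial>lborel)"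
      proof -
        have "of_real (\<tau> - t) * (\<integral>x. ?H x * \<psi> x \<partial>lborel) = (\<integral>x. of_real (\<tau> - t) * (?H x * \<psi> x) \<partial>lborel)"
          by (rule integral_mult_right_zero[symmetric])
        also have "\<dots> = (\<integral>x. v \<tau> x * \<psi> x - v t x * \<psi> x + of_real (\<tau> - t) * (g t x * \<psi> x) \<partial>lborel)"
        proof (rule Bochner_Integration.integral_cong[OF refl])
          fix x
          have "complex_of_real (\<tau> - t) \<noteq> 0" using \<tau> by simp
          then have eq: "of_real (\<tau> - t) * ?H x = v \<tau> x - v t x - of_real (\<tau> - t) * (- g t x)"
            by (rule cancel_quotient)
          have "of_real (\<tau> - t) * (?H x * \<psi> x) = (v \<tau> x - v t x - of_real (\<tau> - t) * (- g t x)) * \<psi> x"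
            by (simp only: mult.assoc[symmetric] eq)
          then show "of_real (\<tau> - t) * (?H x * \<psi> x) = v \<tau> x * \<psi> x - v t x * \<psi> x + of_real (\<tau> - t) * (g t x * \<psi> x)"
            by (simp add: left_diff_distrib distrib_right mult.assoc del: of_real_diff)
        qed
        also have "\<dots> = ?m \<tau> - ?m t + of_real (\<tau> - t) * ?\<gamma> t"
          using L2_integrable_mult[OF L2(2)[OF \<tau>(1)] \<psi>] L2_integrable_mult[OF L2(2)[OF t] \<psi>] L2_integrable_mult[OF L2(3)[OF t] \<psi>] by simp
        finally show ?thesis by (simp add: scaleR_conv_of_real del: of_real_diff)
      qed
      ultimately have "\<bar>\<tau> - t\<bar> * cmod (\<integral>x. ?H x * \<psi> x \<partial>lborel) \<le> \<bar>\<tau> - t\<bar> * (e / 2 * L2norm \<psi>)"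
        by (simp only: norm_mult norm_of_real real_norm_def)
      then show "cmod (\<integral>x. ?H x * \<psi> x \<partial>lborel) \<le> e / 2 * L2norm \<psi>"
        using \<tau>(2) by (simp add: mult_le_cancel_left)
    qed (use e in simp)
  qed
  show "\<forall>\<^sub>F \<tau> in at t within {0..T}. dist (L2norm (\<lambda>x. (v \<tau> x - v t x) / of_real (\<tau> - t) - (- g t x))) 0 < e"
    unfolding eventually_at
  proof (intro exI[of _ d] conjI ballI impI d(1))
    fix \<tau> assume "\<tau> \<in> {0..T}" "\<tau> \<noteq> t \<and> dist \<tau> t < d"
    then show "dist (L2norm (\<lambda>x. (v \<tau> x - v t x) / of_real (\<tau> - t) - (- g t x))) 0 < e"
      using step[of \<tau>] e by simp
  qed
qed

lemma tensor_derivative: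
  fixes \<theta> \<theta>' :: "real \<Rightarrow> complex" and \<psi> :: "'a::euclidean_space \<Rightarrow> complex"
  assumes \<theta>: "\<And>t. (\<theta> has_vector_derivative \<theta>' t) (at t)" and \<psi>: "smooth \<psi>"
  shows "frechet_derivative (\<lambda>z. \<theta> (fst z) * \<psi> (snd z)) (at z) (1, 0) = \<theta>' (fst z) * \<psi> (snd z)"
proof -
  have 1: "((\<lambda>z::real \<times> 'a. \<theta> (fst z)) has_derivative (\<lambda>h. fst h *\<^sub>R \<theta>' (fst z))) (at z)"
    using \<theta>[of "fst z", unfolded has_vector_derivative_def]
    by (rule has_derivative_compose[OF bounded_linear_imp_has_derivative[OF bounded_linear_fst]])
  have 2: "((\<lambda>z::real \<times> 'a. \<psi> (snd z)) has_derivative (\<lambda>h. frechet_derivative \<psi> (at (snd z)) (snd h))) (at z)"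
    by (rule has_derivative_compose[OF bounded_linear_imp_has_derivative[OF bounded_linear_snd] smooth_step(1)[OF \<psi>]])
  have "frechet_derivative \<psi> (at (snd z)) 0 = 0"
    using linear_0[OF bounded_linear.linear[OF has_derivative_bounded_linear[OF smooth_step(1)[OF \<psi>]]]] by simp
  with frechet_derivative_at[OF has_derivative_mult[OF 1 2], symmetric] show ?thesis by simp
qed

text \<open>Products \<open>\<theta> (t) \<psi> (x)\<close> separate the variables in the iterated integral.\<close>

lemma wave_equation_tensor:
  fixes u v :: "real \<Rightarrow> 'a::euclidean_space \<Rightarrow> complex"
  assumes w: "wave_equation s T a b u v" and \<psi>: "test_function UNIV \<psi>" and \<theta>: "time_test T \<theta> \<theta>' \<theta>''"
    and u: "\<And>t. t \<in> {0..T} \<Longrightarrow> u t \<in> L2" 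
    and g: "\<And>t. t \<in> {0..T} \<Longrightarrow> (\<lambda>x. frac_laplacian s (u t) x + a x * u t x + b x * v t x) \<in> L2"
  shows "(LINT t:{0<..<T}|lborel. \<theta>'' t * (\<integral>x. u t x * \<psi> x \<partial>lborel) + 
     \<theta> t * (\<integral>x. (frac_laplacian s (u t) x + a x * u t x + b x * v t x) * \<psi> x \<partial>lborel)) = 0"
proof -
  define \<phi> where "\<phi> = (\<lambda>z::real \<times> 'a. \<theta> (fst z) * \<psi> (snd z))"
  from \<theta> have s\<theta>: "smooth \<theta>" and d1: "\<And>t. (\<theta> has_vector_derivative \<theta>' t) (at t)" and d2: "\<And>t. (\<theta>' has_vector_derivative \<theta>'' t) (at t)"
    by (auto simp: time_test_def)
  from \<theta> obtain r0 r1 where r: "0 < r0" "r1 < T" "\<And>t. t \<notin> {r0..r1} \<Longrightarrow> \<theta> t = 0" by (auto simp: time_test_def)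
  have s\<psi>: "smooth \<psi>" and c\<psi>: "compact (supp \<psi>)" using \<psi> by (auto simp: test_function_def)
  have \<psi>2: "\<psi> \<in> L2" using \<psi> by (rule test_function_L2)
  have K: "compact ({r0..r1} \<times> supp \<psi>)" by (intro compact_Times c\<psi>) simp
  have \<phi>0: "\<phi> z = 0" if "z \<notin> {r0..r1} \<times> supp \<psi>" for z
    using that r(3)[of "fst z"] not_supp[of "snd z" \<psi>] by (cases z) (auto simp: \<phi>_def)
  have sup: "compact (supp \<phi>)" "supp \<phi> \<subseteq> {r0..r1} \<times> supp \<psi>"
    by (rule supp_subset_compact[OF K \<phi>0]; assumption)+
  have "smooth \<phi>" unfolding \<phi>_def
    by (intro smooth_mult smooth_compose_linear[OF s\<theta> bounded_linear_fst] smooth_compose_linear[OF s\<psi> bounded_linear_snd])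
  then have tf: "test_function ({0<..<T} \<times> UNIV) \<phi>"
    using sup r(1,2) by (fastforce simp: test_function_def)
  have "dir_derivs [(1, 0)] \<phi> = (\<lambda>z. \<theta>' (fst z) * \<psi> (snd z))"
    unfolding \<phi>_def by (simp add: tensor_derivative[OF d1 s\<psi>])
  then have dd: "dir_derivs [(1, 0), (1, 0)] \<phi> = (\<lambda>z. \<theta>'' (fst z) * \<psi> (snd z))"
    by (simp add: tensor_derivative[OF d2 s\<psi>])
  have "(LINT t:{0<..<T}|lborel. (\<integral>x. u t x * dir_derivs [(1, 0), (1, 0)] \<phi> (t, x)
          + (frac_laplacian s (u t) x + a x * u t x + b x * v t x) * \<phi> (t, x) \<partial>lborel)) = 0"
    using w tf unfolding wave_equation_def by blast
  also have "(LINT t:{0<..<T}|lborel. (\<integral>x. u t x * dir_derivs [(1, 0), (1, 0)] \<phi> (t, x)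
          + (frac_laplacian s (u t) x + a x * u t x + b x * v t x) * \<phi> (t, x) \<partial>lborel)) = 
    (LINT t:{0<..<T}|lborel. \<theta>'' t * (\<integral>x. u t x * \<psi> x \<partial>lborel) + 
     \<theta> t * (\<integral>x. (frac_laplacian s (u t) x + a x * u t x + b x * v t x) * \<psi> x \<partial>lborel))"
  proof (rule set_lebesgue_integral_cong)
    show "\<forall>t. t \<in> {0<..<T} \<longrightarrow> (\<integral>x. u t x * dir_derivs [(1, 0), (1, 0)] \<phi> (t, x)
          + (frac_laplacian s (u t) x + a x * u t x + b x * v t x) * \<phi> (t, x) \<partial>lborel) = 
       \<theta>'' t * (\<integral>x. u t x * \<psi> x \<partial>lborel) + 
       \<theta> t * (\<integral>x. (frac_laplacian s (u t) x + a x * u t x + b x * v t x) * \<psi> x \<partial>lborel)"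
    proof (intro allI impI)
      fix t assume "t \<in> {0<..<T}"
      then have t: "t \<in> {0..T}" by simp
      let ?g = "\<lambda>x. frac_laplacian s (u t) x + a x * u t x + b x * v t x"
      have "(\<integral>x. u t x * dir_derivs [(1, 0), (1, 0)] \<phi> (t, x) + ?g x * \<phi> (t, x) \<partial>lborel)
        = (\<integral>x. \<theta>'' t * (u t x * \<psi> x) + \<theta> t * (?g x * \<psi> x) \<partial>lborel)"
        unfolding dd unfolding \<phi>_def by (intro Bochner_Integration.integral_cong refl) (simp only: fst_conv snd_conv mult_ac)
      also have "\<dots> = \<theta>'' t * (\<integral>x. u t x * \<psi> x \<partial>lborel) + \<theta> t * (\<integral>x. ?g x * \<psi> x \<partial>lborel)"
        using L2_integrable_mult[OF u[OF t] \<psi>2] L2_integrable_mult[OF g[OF t] \<psi>2]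
        by (subst Bochner_Integration.integral_add) (auto simp only: integral_mult_right_zero intro!: integrable_mult_right)
      finally show "(\<integral>x. u t x * dir_derivs [(1, 0), (1, 0)] \<phi> (t, x) + ?g x * \<phi> (t, x) \<partial>lborel)
        = \<theta>'' t * (\<integral>x. u t x * \<psi> x \<partial>lborel) + \<theta> t * (\<integral>x. ?g x * \<psi> x \<partial>lborel)" .
    qed
  qed simp
  finally show ?thesis .
qed

section \<open>Curves with two time derivatives\<close>

lemma Dfrac_norm_diff_eq:
  assumes "f \<in> elems (Hs \<sigma>)" "g \<in> elems (Hs \<sigma>)"
  shows "L2norm (Dfrac \<sigma> (\<lambda>x. f x - g x)) = L2norm (\<lambda>x. Dfrac \<sigma> f x - Dfrac \<sigma> g x)"
  by (rule L2norm_cong_AE[OF _ _ Dfrac_diff(2)[OF assms]]) (intro L2_measurable L2_diff Hs_L2 Dfrac_diff(1) assms)+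

lemma Dfrac_norm_divide:
  assumes "f \<in> elems (Hs \<sigma>)"
  shows "L2norm (Dfrac \<sigma> (\<lambda>x. f x / c)) = L2norm (Dfrac \<sigma> f) / cmod c"
proof -
  have "L2norm (Dfrac \<sigma> (\<lambda>x. f x / c)) = L2norm (\<lambda>x. Dfrac \<sigma> f x / c)"
    by (rule L2norm_cong_AE[OF _ _ Dfrac_divide(2)[OF assms]]) (intro L2_measurable L2_divide Hs_L2 Dfrac_divide(1) assms)+
  then show ?thesis by (simp add: L2norm_divide)
qed

lemma Hs_norm_nonneg: "0 \<le> fnorm (Hs \<sigma>) f"
  by (simp add: Hs_norm)

lemma Hs_norm_diff:
  assumes "f \<in> elems (Hs \<sigma>)" "g \<in> elems (Hs \<sigma>)"
  shows "fnorm (Hs \<sigma>) (\<lambda>x. f x - g x) \<le> fnorm (Hs \<sigma>) f + fnorm (Hs \<sigma>) g"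
  unfolding Hs_norm Dfrac_norm_diff_eq[OF assms]
  using L2norm_triangle_diff[OF Hs_L2(1)[OF assms(1)] Hs_L2(1)[OF assms(2)]]
    L2norm_triangle_diff[OF Hs_L2(2)[OF assms(1)] Hs_L2(2)[OF assms(2)]] by linarith

lemma Hs_norm_divide:
  assumes "f \<in> elems (Hs \<sigma>)"
  shows "fnorm (Hs \<sigma>) (\<lambda>x. f x / c) = fnorm (Hs \<sigma>) f / cmod c"
  unfolding Hs_norm by (simp add: Dfrac_norm_divide[OF assms] L2norm_divide add_divide_distrib)

lemma Hs_norm_cong_AE:
  assumes "f \<in> elems (Hs \<sigma>)" "g \<in> L2" "AE x in lborel. f x = g x"
  shows "fnorm (Hs \<sigma>) f = fnorm (Hs \<sigma>) g"
proof -
  note c = Dfrac_cong_AE[OF assms]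
  have "L2norm f = L2norm g"
    by (rule L2norm_cong_AE[OF L2_measurable[OF Hs_L2(1)[OF assms(1)]] L2_measurable[OF assms(2)] assms(3)])
  moreover have "L2norm (Dfrac \<sigma> g) = L2norm (Dfrac \<sigma> f)"
    by (rule L2norm_cong_AE[OF L2_measurable[OF Hs_L2(2)[OF c(1)]] L2_measurable[OF Hs_L2(2)[OF assms(1)]] c(2)])
  ultimately show ?thesis by (simp add: Hs_norm)
qed

text \<open>A curve \<open>z\<close> with time derivative \<open>y\<close> in the norm of \<open>Hs s\<close> and second time derivative \<open>y1\<close> in \<open>L\<^sup>2\<close>.
  Keeping the equation apart makes the notion stable under differences, shifts in time and division by
  constants; these give the difference of two solutions and difference quotients in time.\<close>

definition wave_curve ::
  "real \<Rightarrow> real \<Rightarrow> (real \<Rightarrow> 'a::euclidean_space \<Rightarrow> complex) \<Rightarrow> (real \<Rightarrow> 'a \<Rightarrow> complex) \<Rightarrow> (real \<Rightarrow> 'a \<Rightarrow> complex) \<Rightarrow> bool" where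
  "wave_curve s T z y y1 \<longleftrightarrow> (\<forall>t\<in>{0..T}. z t \<in> elems (Hs s) \<and> z t \<in> elems (Hs (2 * s)) \<and> y t \<in> elems (Hs s) \<and> y1 t \<in> L2 \<and>
     ((\<lambda>\<tau>. fnorm (Hs s) (\<lambda>x. (z \<tau> x - z t x) / of_real (\<tau> - t) - y t x)) \<longlongrightarrow> 0) (at t within {0..T}) \<and>
     has_L2_derivative y (y1 t) t {0..T})"

lemma wave_curveD:
  assumes "wave_curve s T z y y1" "t \<in> {0..T}"
  shows "z t \<in> elems (Hs s)" "z t \<in> elems (Hs (2 * s))" "y t \<in> elems (Hs s)" "y1 t \<in> L2"
     "((\<lambda>\<tau>. fnorm (Hs s) (\<lambda>x. (z \<tau> x - z t x) / of_real (\<tau> - t) - y t x)) \<longlongrightarrow> 0) (at t within {0..T})"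
     "has_L2_derivative y (y1 t) t {0..T}"
  using assms unfolding wave_curve_def by blast+

lemma quotient_diff: "(p - p') / c - q - ((r - r') / c - q') = ((p - r) - (p' - r')) / c - (q - q')" for c :: complex
  by (simp add: diff_divide_distrib)

lemma wave_curve_diff:
  assumes A: "wave_curve s T z y y1" and B: "wave_curve s T z' y' y1'"
  shows "wave_curve s T (\<lambda>t x. z t x - z' t x) (\<lambda>t x. y t x - y' t x) (\<lambda>t x. y1 t x - y1' t x)"
  unfolding wave_curve_def
proof (intro ballI conjI)
  fix t assume t: "t \<in> {0..T}"
  note a = wave_curveD[OF A t] and b = wave_curveD[OF B t]
  show "(\<lambda>x. z t x - z' t x) \<in> elems (Hs s)" "(\<lambda>x. z t x - z' t x) \<in> elems (Hs (2 * s))" 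
    "(\<lambda>x. y t x - y' t x) \<in> elems (Hs s)" "(\<lambda>x. y1 t x - y1' t x) \<in> L2"
    by (intro Dfrac_diff L2_diff a b)+
  show "((\<lambda>\<tau>. fnorm (Hs s) (\<lambda>x. ((z \<tau> x - z' \<tau> x) - (z t x - z' t x)) / of_real (\<tau> - t) - (y t x - y' t x))) \<longlongrightarrow> 0) (at t within {0..T})"
  proof (rule tendsto_null_within[OF tendsto_add_zero[OF a(5) b(5)]], intro conjI Hs_norm_nonneg)
    fix \<tau> assume \<tau>: "\<tau> \<in> {0..T}"
    show "fnorm (Hs s) (\<lambda>x. ((z \<tau> x - z' \<tau> x) - (z t x - z' t x)) / of_real (\<tau> - t) - (y t x - y' t x)) \<le> 
      fnorm (Hs s) (\<lambda>x. (z \<tau> x - z t x) / of_real (\<tau> - t) - y t x) + fnorm (Hs s) (\<lambda>x. (z' \<tau> x - z' t x) / of_real (\<tau> - t) - y' t x)"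
      unfolding quotient_diff[symmetric]
      by (intro Hs_norm_diff Dfrac_diff Dfrac_divide wave_curveD[OF A \<tau>] wave_curveD[OF B \<tau>] a b)
  qed
  show "has_L2_derivative (\<lambda>t x. y t x - y' t x) (\<lambda>x. y1 t x - y1' t x) t {0..T}"
    unfolding has_L2_derivative_def
  proof (rule tendsto_null_within[OF tendsto_add_zero[OF a(6)[unfolded has_L2_derivative_def] b(6)[unfolded has_L2_derivative_def]]], intro conjI L2norm_nonneg)
    fix \<tau> assume \<tau>: "\<tau> \<in> {0..T}"
    show "L2norm (\<lambda>x. ((y \<tau> x - y' \<tau> x) - (y t x - y' t x)) / of_real (\<tau> - t) - (y1 t x - y1' t x)) \<le> 
      L2norm (\<lambda>x. (y \<tau> x - y t x) / of_real (\<tau> - t) - y1 t x) + L2norm (\<lambda>x. (y' \<tau> x - y' t x) / of_real (\<tau> - t) - y1' t x)"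
      unfolding quotient_diff[symmetric]
      by (intro L2norm_triangle_diff L2_diff L2_divide Hs_L2(1)[OF wave_curveD(3)[OF A \<tau>]] Hs_L2(1)[OF wave_curveD(3)[OF B \<tau>]] 
          Hs_L2(1)[OF a(3)] Hs_L2(1)[OF b(3)] a b)
  qed
qed

lemma wave_curve_divide:
  assumes A: "wave_curve s T z y y1" 
  shows "wave_curve s T (\<lambda>t x. z t x / c) (\<lambda>t x. y t x / c) (\<lambda>t x. y1 t x / c)"
  unfolding wave_curve_def
proof (intro ballI conjI)
  fix t assume t: "t \<in> {0..T}"
  note a = wave_curveD[OF A t]
  show "(\<lambda>x. z t x / c) \<in> elems (Hs s)" "(\<lambda>x. z t x / c) \<in> elems (Hs (2 * s))" 
    "(\<lambda>x. y t x / c) \<in> elems (Hs s)" "(\<lambda>x. y1 t x / c) \<in> L2"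
    by (intro Dfrac_divide L2_divide a)+
  have q: "(p / c - p' / c) / e - q / c = ((p - p') / e - q) / c" for p p' e q :: complex
    by (simp add: diff_divide_distrib mult.commute)
  have "((\<lambda>\<tau>. fnorm (Hs s) (\<lambda>x. (z \<tau> x - z t x) / of_real (\<tau> - t) - y t x) / cmod c) \<longlongrightarrow> 0) (at t within {0..T})"
    using tendsto_mult_left_zero[OF a(5), of "1 / cmod c"] by simp
  then show "((\<lambda>\<tau>. fnorm (Hs s) (\<lambda>x. (z \<tau> x / c - z t x / c) / of_real (\<tau> - t) - y t x / c)) \<longlongrightarrow> 0) (at t within {0..T})"
  proof (rule tendsto_null_within, intro conjI Hs_norm_nonneg)
    fix \<tau> assume \<tau>: "\<tau> \<in> {0..T}"
    show "fnorm (Hs s) (\<lambda>x. (z \<tau> x / c - z t x / c) / of_real (\<tau> - t) - y t x / c) \<le> 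
      fnorm (Hs s) (\<lambda>x. (z \<tau> x - z t x) / of_real (\<tau> - t) - y t x) / cmod c"
      unfolding q by (rule eq_refl, intro Hs_norm_divide Dfrac_diff Dfrac_divide wave_curveD[OF A \<tau>] a)
  qed
  have "((\<lambda>\<tau>. L2norm (\<lambda>x. (y \<tau> x - y t x) / of_real (\<tau> - t) - y1 t x) / cmod c) \<longlongrightarrow> 0) (at t within {0..T})"
    using tendsto_mult_left_zero[OF a(6)[unfolded has_L2_derivative_def], of "1 / cmod c"] by simp
  then show "has_L2_derivative (\<lambda>t x. y t x / c) (\<lambda>x. y1 t x / c) t {0..T}"
    unfolding has_L2_derivative_def q L2norm_divide .
qed

lemma filterlim_shift_within:
  assumes "0 \<le> h" "t \<in> {0..T - h}"
  shows "filterlim (\<lambda>\<tau>. \<tau> + h) (at (t + h) within {0..T}) (at t within {0..T - h :: real})"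
  unfolding filterlim_at
proof
  show "\<forall>\<^sub>F x in at t within {0..T - h}. x + h \<in> {0..T} \<and> x + h \<noteq> t + h"
    unfolding eventually_at_filter using assms by (intro always_eventually) auto
  show "((\<lambda>\<tau>. \<tau> + h) \<longlongrightarrow> t + h) (at t within {0..T - h})"
    by (intro tendsto_intros)
qed

lemma wave_curve_shift:
  assumes A: "wave_curve s T z y y1" and h: "0 \<le> h"
  shows "wave_curve s (T - h) (\<lambda>t. z (t + h)) (\<lambda>t. y (t + h)) (\<lambda>t. y1 (t + h))"
  unfolding wave_curve_def
proof (intro ballI conjI)
  fix t assume t: "t \<in> {0..T - h}"
  then have t': "t + h \<in> {0..T}" using h by auto
  note a = wave_curveD[OF A t']
  show "z (t + h) \<in> elems (Hs s)" "z (t + h) \<in> elems (Hs (2 * s))" "y (t + h) \<in> elems (Hs s)" "y1 (t + h) \<in> L2"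
    by (fact a)+
  show "((\<lambda>\<tau>. fnorm (Hs s) (\<lambda>x. (z (\<tau> + h) x - z (t + h) x) / of_real (\<tau> - t) - y (t + h) x)) \<longlongrightarrow> 0) (at t within {0..T - h})"
    using filterlim_compose[OF a(5) filterlim_shift_within[OF h t]] by simp
  show "has_L2_derivative (\<lambda>t. y (t + h)) (y1 (t + h)) t {0..T - h}"
    using filterlim_compose[OF a(6)[unfolded has_L2_derivative_def] filterlim_shift_within[OF h t]] 
    by (simp add: has_L2_derivative_def)
qed

lemma wave_curve_restrict:
  assumes A: "wave_curve s T z y y1" and h: "T' \<le> T"
  shows "wave_curve s T' z y y1"
  unfolding wave_curve_def
proof (intro ballI conjI)
  fix t assume t: "t \<in> {0..T'}"
  then have t': "t \<in> {0..T}" using h by auto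
  note a = wave_curveD[OF A t']
  have sub: "at t within {0..T'} \<le> at t within {0..T}" using h by (intro at_le) auto
  show "z t \<in> elems (Hs s)" "z t \<in> elems (Hs (2 * s))" "y t \<in> elems (Hs s)" "y1 t \<in> L2"
    by (fact a)+
  show "((\<lambda>\<tau>. fnorm (Hs s) (\<lambda>x. (z \<tau> x - z t x) / of_real (\<tau> - t) - y t x)) \<longlongrightarrow> 0) (at t within {0..T'})"
    by (rule tendsto_mono[OF sub a(5)])
  show "has_L2_derivative y (y1 t) t {0..T'}"
    unfolding has_L2_derivative_def by (rule tendsto_mono[OF sub a(6)[unfolded has_L2_derivative_def]])
qed

section \<open>The energy estimate\<close>

text \<open>The differential inequality \<open>E' \<le> 2 M \<surd>E\<close> says that \<open>\<surd>E\<close> has slope at most \<open>M\<close>.\<close>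

lemma sqrt_growth:
  fixes E e :: "real \<Rightarrow> real"
  assumes E: "\<And>t. t \<in> {0..T} \<Longrightarrow> 0 \<le> E t" 
    and d: "\<And>t. t \<in> {0..T} \<Longrightarrow> (E has_real_derivative e t) (at t within {0..T})"
    and e: "\<And>t. t \<in> {0..T} \<Longrightarrow> e t \<le> 2 * M * sqrt (E t)"
    and M: "0 \<le> M" and t: "t \<in> {0..T}"
  shows "sqrt (E t) \<le> sqrt (E 0) + M * t"
proof -
  have step: "sqrt (E t + \<eta>) \<le> sqrt (E 0 + \<eta>) + M * t" if \<eta>: "\<eta> > 0" for \<eta>
  proof (cases "t = 0")
    case False
    then have t0: "0 < t" using t by simp
    \<comment> \<open>The shift by \<open>\<eta>\<close> keeps the square root differentiable where \<open>E\<close> vanishes.\<close>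
    define F where "F \<tau> = sqrt (E \<tau> + \<eta>) - M * \<tau>" for \<tau>
    have F': "(F has_real_derivative e \<tau> * (inverse (sqrt (E \<tau> + \<eta>)) / 2) - M) (at \<tau> within {0..t})" if \<tau>: "\<tau> \<in> {0..t}" for \<tau>
    proof -
      have \<tau>T: "\<tau> \<in> {0..T}" using \<tau> t by auto
      have "(E has_real_derivative e \<tau>) (at \<tau> within {0..t})"
        by (rule has_field_derivative_subset[OF d[OF \<tau>T]]) (use t in auto)
      moreover have "E \<tau> + \<eta> > 0" using E[OF \<tau>T] \<eta> by linarith
      ultimately show ?thesis
        unfolding F_def by (auto intro!: derivative_eq_intros simp: field_simps)
    qed
    have "\<exists>x\<in>{0<..<t}. F t - F 0 = (\<lambda>h. h * (e x * (inverse (sqrt (E x + \<eta>)) / 2) - M)) (t - 0)"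
      by (rule mvt_simple[OF t0]) (use F' in \<open>auto simp: has_field_derivative_def mult_commute_abs\<close>)
    then obtain x where x: "0 < x" "x < t" and Fx: "F t - F 0 = t * (e x * (inverse (sqrt (E x + \<eta>)) / 2) - M)" by auto
    have xT: "x \<in> {0..T}" using x t by auto
    have pos: "sqrt (E x + \<eta>) > 0" using E[OF xT] \<eta> by simp
    have "e x * (inverse (sqrt (E x + \<eta>)) / 2) \<le> (2 * M * sqrt (E x + \<eta>)) * (inverse (sqrt (E x + \<eta>)) / 2)"
    proof (rule mult_right_mono)
      have "2 * M * sqrt (E x) \<le> 2 * M * sqrt (E x + \<eta>)" using M \<eta> by (intro mult_left_mono) auto
      then show "e x \<le> 2 * M * sqrt (E x + \<eta>)" using e[OF xT] by linarith
    qed (use pos in simp)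
    also have "\<dots> = M" using pos by simp
    finally have "F t - F 0 \<le> 0" unfolding Fx using t0 by (simp add: mult_le_0_iff)
    then show ?thesis by (simp add: F_def)
  qed simp
  have l1: "((\<lambda>\<eta>. sqrt (E t + \<eta>)) \<longlongrightarrow> sqrt (E t + 0)) (at_right 0)"
    by (intro tendsto_intros)
  have l2: "((\<lambda>\<eta>. sqrt (E 0 + \<eta>) + M * t) \<longlongrightarrow> sqrt (E 0 + 0) + M * t) (at_right 0)"
    by (intro tendsto_intros)
  have "sqrt (E t + 0) \<le> sqrt (E 0 + 0) + M * t"
    by (rule tendsto_le[OF _ l2 l1]) (use step in \<open>auto simp: eventually_at_filter intro!: always_eventually\<close>)
  then show ?thesis by simp
qed

text \<open>The potential term \<open>\<integral> a |z|\<^sup>2\<close> is written as a squared \<open>L\<^sup>2\<close> norm, so that all three terms are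
  differentiated by the same rule.\<close>

definition energy :: "real \<Rightarrow> ('a::euclidean_space \<Rightarrow> complex) \<Rightarrow> ('a \<Rightarrow> complex) \<Rightarrow> ('a \<Rightarrow> complex) \<Rightarrow> real" where
  "energy s a z y = (L2norm y)\<^sup>2 + (L2norm (Dfrac s z))\<^sup>2 + (L2norm (\<lambda>x. of_real (sqrt (cmod (a x))) * z x))\<^sup>2"

lemma energy_bounds:
  "0 \<le> energy s a z y" "L2norm y \<le> sqrt (energy s a z y)" "L2norm (Dfrac s z) \<le> sqrt (energy s a z y)"
  "sqrt (energy s a z y) \<le> L2norm y + L2norm (Dfrac s z) + L2norm (\<lambda>x. of_real (sqrt (cmod (a x))) * z x)"
proof -
  show "0 \<le> energy s a z y" by (simp add: energy_def)
  show "L2norm y \<le> sqrt (energy s a z y)" "L2norm (Dfrac s z) \<le> sqrt (energy s a z y)"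
    by (auto intro!: real_le_rsqrt simp: energy_def)
  show "sqrt (energy s a z y) \<le> L2norm y + L2norm (Dfrac s z) + L2norm (\<lambda>x. of_real (sqrt (cmod (a x))) * z x)"
    unfolding energy_def by (intro real_le_lsqrt) (auto simp: power2_eq_square algebra_simps)
qed

lemma sobolev_const_mult:
  assumes "sobolev_const s C TYPE('a::euclidean_space)" "(f::'a \<Rightarrow> complex) \<in> elems (Hs s)" 
  shows "0 < C"
    "c \<in> elems (Lp (real DIM('a) / s)) \<Longrightarrow> (\<lambda>x. c x * f x) \<in> L2"
    "c \<in> elems (Lp (real DIM('a) / s)) \<Longrightarrow> L2norm (\<lambda>x. c x * f x) \<le> C * fnorm (Lp (real DIM('a) / s)) c * L2norm (Dfrac s f)"
    "a \<in> elems (Lp (real DIM('a) / (2 * s))) \<Longrightarrow> (\<lambda>x. of_real (sqrt (cmod (a x))) * f x) \<in> L2"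
    "a \<in> elems (Lp (real DIM('a) / (2 * s))) \<Longrightarrow> L2norm (\<lambda>x. of_real (sqrt (cmod (a x))) * f x) \<le> C * sqrt (fnorm (Lp (real DIM('a) / (2 * s))) a) * L2norm (Dfrac s f)"
  using assms unfolding sobolev_const_def by blast+

text \<open>In the derivative of the energy the terms with \<open>(-\<Delta>)\<^sup>s\<close> and with \<open>a\<close> cancel against the equation. What remains is
  \<open>2 Re \<langle>f, y\<rangle> - 2 \<integral> b |y|\<^sup>2\<close>, and the second term has a sign.\<close>

theorem energy_estimate:
  fixes z y y1 f :: "real \<Rightarrow> 'a::euclidean_space \<Rightarrow> complex"
  assumes s: "s > 0" and C: "sobolev_const s C TYPE('a)"
    and a1: "a \<in> elems (Lp (real DIM('a) / s))" and a2: "a \<in> elems (Lp (real DIM('a) / (2 * s)))" and b: "b \<in> elems (Lp (real DIM('a) / s))"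
    and nn: "\<And>x. a x \<in> \<real>\<^sub>\<ge>\<^sub>0" "\<And>x. b x \<in> \<real>\<^sub>\<ge>\<^sub>0"
    and W: "wave_curve s T z y y1"
    and f: "\<And>t. t \<in> {0..T} \<Longrightarrow> f t \<in> L2" "\<And>t. t \<in> {0..T} \<Longrightarrow> L2norm (f t) \<le> M" and M: "0 \<le> M"
    and eq: "\<And>t. t \<in> {0..T} \<Longrightarrow> AE x in lborel. y1 t x = f t x - (frac_laplacian s (z t) x + a x * z t x + b x * y t x)"
    and t: "t \<in> {0..T}"
  shows "sqrt (energy s a (z t) (y t)) \<le> sqrt (energy s a (z 0) (y 0)) + M * t"
proof -
  define sa where "sa = (\<lambda>(g::'a \<Rightarrow> complex) x. complex_of_real (sqrt (cmod (a x))) * g x)"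
  define e where "e t = 2 * Re (L2inner (y1 t) (y t)) + 2 * Re (L2inner (Dfrac s (y t)) (Dfrac s (z t))) + 2 * Re (L2inner (sa (y t)) (sa (z t)))" for t
  have deriv: "((\<lambda>t. energy s a (z t) (y t)) has_real_derivative e t) (at t within {0..T})" if t: "t \<in> {0..T}" for t
  proof -
    note w = wave_curveD[OF W t]
    have q: "(\<lambda>x. (z \<tau> x - z t x) / of_real (\<tau> - t)) \<in> elems (Hs s)" if "\<tau> \<in> {0..T}" for \<tau>
      by (intro Dfrac_divide Dfrac_diff wave_curveD[OF W that] w)
    have d1: "((\<lambda>\<tau>. (L2norm (y \<tau>))\<^sup>2) has_real_derivative 2 * Re (L2inner (y1 t) (y t))) (at t within {0..T})"
      by (rule L2norm_sq_has_derivative[OF Hs_L2(1)[OF wave_curveD(3)[OF W]] t w(4) w(6)[unfolded has_L2_derivative_def]])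
    have d2: "((\<lambda>\<tau>. (L2norm (Dfrac s (z \<tau>)))\<^sup>2) has_real_derivative 2 * Re (L2inner (Dfrac s (y t)) (Dfrac s (z t)))) (at t within {0..T})"
    proof (rule L2norm_sq_has_derivative[OF Hs_L2(2)[OF wave_curveD(1)[OF W]] t Hs_L2(2)[OF w(3)]])
      show "((\<lambda>\<tau>. L2norm (\<lambda>x. (Dfrac s (z \<tau>) x - Dfrac s (z t) x) / of_real (\<tau> - t) - Dfrac s (y t) x)) \<longlongrightarrow> 0) (at t within {0..T})"
      proof (rule tendsto_null_within[OF w(5)], intro conjI L2norm_nonneg)
        fix \<tau> assume \<tau>: "\<tau> \<in> {0..T}"
        note z\<tau> = wave_curveD(1)[OF W \<tau>]
        have "AE x in lborel. (Dfrac s (z \<tau>) x - Dfrac s (z t) x) / of_real (\<tau> - t) - Dfrac s (y t) x = 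
          Dfrac s (\<lambda>x. (z \<tau> x - z t x) / of_real (\<tau> - t) - y t x) x"
          using Dfrac_diff(2)[OF z\<tau> w(1)] Dfrac_divide(2)[OF Dfrac_diff(1)[OF z\<tau> w(1)], of "of_real (\<tau> - t)"] Dfrac_diff(2)[OF q[OF \<tau>] w(3)]
          by eventually_elim (simp del: of_real_diff)
        then have "L2norm (\<lambda>x. (Dfrac s (z \<tau>) x - Dfrac s (z t) x) / of_real (\<tau> - t) - Dfrac s (y t) x) = 
          L2norm (Dfrac s (\<lambda>x. (z \<tau> x - z t x) / of_real (\<tau> - t) - y t x))"
          by (rule L2norm_cong_AE[rotated 2]) (intro L2_measurable L2_diff L2_divide Hs_L2(2) Dfrac_diff(1) q \<tau> z\<tau> w)+
        then show "L2norm (\<lambda>x. (Dfrac s (z \<tau>) x - Dfrac s (z t) x) / of_real (\<tau> - t) - Dfrac s (y t) x) \<le> 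
          fnorm (Hs s) (\<lambda>x. (z \<tau> x - z t x) / of_real (\<tau> - t) - y t x)"
          by (simp add: Hs_norm)
      qed
    qed
    have saL2: "sa (z \<tau>) \<in> L2" if "\<tau> \<in> {0..T}" for \<tau>
      unfolding sa_def by (rule sobolev_const_mult(4)[OF C wave_curveD(1)[OF W that] a2])
    have d3: "((\<lambda>\<tau>. (L2norm (sa (z \<tau>)))\<^sup>2) has_real_derivative 2 * Re (L2inner (sa (y t)) (sa (z t)))) (at t within {0..T})"
    proof (rule L2norm_sq_has_derivative[OF saL2 t])
      show "sa (y t) \<in> L2" unfolding sa_def by (rule sobolev_const_mult(4)[OF C w(3) a2])
      let ?c = "C * sqrt (fnorm (Lp (real DIM('a) / (2 * s))) a)"
      have c0: "?c \<ge> 0" using sobolev_const_mult(1)[OF C w(3)] by (simp add: Lp_def)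
      have lim: "((\<lambda>\<tau>. ?c * fnorm (Hs s) (\<lambda>x. (z \<tau> x - z t x) / of_real (\<tau> - t) - y t x)) \<longlongrightarrow> 0) (at t within {0..T})"
        using tendsto_mult_right_zero[OF w(5), of ?c] .
      show "((\<lambda>\<tau>. L2norm (\<lambda>x. (sa (z \<tau>) x - sa (z t) x) / of_real (\<tau> - t) - sa (y t) x)) \<longlongrightarrow> 0) (at t within {0..T})"
      proof (rule tendsto_null_within[OF lim], intro conjI L2norm_nonneg)
        fix \<tau> assume \<tau>: "\<tau> \<in> {0..T}"
        have "(\<lambda>x. (sa (z \<tau>) x - sa (z t) x) / of_real (\<tau> - t) - sa (y t) x) = (\<lambda>x. of_real (sqrt (cmod (a x))) * ((z \<tau> x - z t x) / of_real (\<tau> - t) - y t x))"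
          by (simp add: sa_def fun_eq_iff right_diff_distrib diff_divide_distrib)
        then have "L2norm (\<lambda>x. (sa (z \<tau>) x - sa (z t) x) / of_real (\<tau> - t) - sa (y t) x) \<le> ?c * L2norm (Dfrac s (\<lambda>x. (z \<tau> x - z t x) / of_real (\<tau> - t) - y t x))"
          using sobolev_const_mult(5)[OF C Dfrac_diff(1)[OF q[OF \<tau>] w(3)] a2] by simp
        also have "\<dots> \<le> ?c * fnorm (Hs s) (\<lambda>x. (z \<tau> x - z t x) / of_real (\<tau> - t) - y t x)"
          by (rule mult_left_mono[OF _ c0]) (simp add: Hs_norm)
        finally show "L2norm (\<lambda>x. (sa (z \<tau>) x - sa (z t) x) / of_real (\<tau> - t) - sa (y t) x) \<le> ?c * fnorm (Hs s) (\<lambda>x. (z \<tau> x - z t x) / of_real (\<tau> - t) - y t x)" .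
      qed
    qed
    show ?thesis
      using DERIV_add[OF DERIV_add[OF d1 d2] d3] by (simp only: energy_def e_def sa_def)
  qed
  have ebound: "e t \<le> 2 * M * sqrt (energy s a (z t) (y t))" if t: "t \<in> {0..T}" for t
  proof -
    note w = wave_curveD[OF W t]
    have y2: "y t \<in> L2" by (rule Hs_L2(1)[OF w(3)])
    have L: "frac_laplacian s (z t) \<in> L2" using Hs_L2(2)[OF w(2)] by simp
    have az: "(\<lambda>x. a x * z t x) \<in> L2" by (rule sobolev_const_mult(2)[OF C w(1) a1])
    have bY: "(\<lambda>x. b x * y t x) \<in> L2" by (rule sobolev_const_mult(2)[OF C w(3) b])
    have sq: "complex_of_real (sqrt (cmod (a x))) * complex_of_real (sqrt (cmod (a x))) = a x" for x
    proof -
      have "complex_of_real (sqrt (cmod (a x))) * complex_of_real (sqrt (cmod (a x))) = complex_of_real (cmod (a x))"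
        unfolding of_real_mult[symmetric] by simp
      also have "\<dots> = a x" using nn(1)[of x] by (auto elim!: nonneg_Reals_cases)
      finally show ?thesis .
    qed
    have "L2inner (y1 t) (y t) = L2inner (\<lambda>x. f t x - (frac_laplacian s (z t) x + a x * z t x + b x * y t x)) (y t)"
      unfolding L2inner_def
    proof (rule integral_cong_AE)
      have cm: "(\<lambda>x. cnj (y t x)) \<in> borel_measurable lborel" using L2_measurable[OF L2_cnj[OF y2]] by simp
      show "(\<lambda>x. y1 t x * cnj (y t x)) \<in> borel_measurable lborel"
        using L2_measurable[OF w(4)] cm by simp
      have "(\<lambda>x. f t x - (frac_laplacian s (z t) x + a x * z t x + b x * y t x)) \<in> borel_measurable lborel"
        using L2_measurable[OF L2_diff[OF f(1)[OF t] L2_add[OF L2_add[OF L az] bY]]] by simp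
      then show "(\<lambda>x. (f t x - (frac_laplacian s (z t) x + a x * z t x + b x * y t x)) * cnj (y t x)) \<in> borel_measurable lborel"
        using cm by (rule borel_measurable_times)
      show "AE x in lborel. y1 t x * cnj (y t x) = (f t x - (frac_laplacian s (z t) x + a x * z t x + b x * y t x)) * cnj (y t x)"
        using eq[OF t] by eventually_elim simp
    qed
    also have "\<dots> = L2inner (f t) (y t) - (L2inner (frac_laplacian s (z t)) (y t) + L2inner (\<lambda>x. a x * z t x) (y t) + L2inner (\<lambda>x. b x * y t x) (y t))"
      by (simp only: L2inner_diff_left[OF f(1)[OF t] L2_add[OF L2_add[OF L az] bY] y2] L2inner_add_left[OF L2_add[OF L az] bY y2] L2inner_add_left[OF L az y2])
    also have "L2inner (frac_laplacian s (z t)) (y t) = L2inner (Dfrac s (z t)) (Dfrac s (y t))"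
      by (rule Dfrac_form[OF s w(1-3)])
    also have "L2inner (\<lambda>x. a x * z t x) (y t) = L2inner (sa (z t)) (sa (y t))"
      unfolding L2inner_def
    proof (intro Bochner_Integration.integral_cong refl)
      fix x
      show "a x * z t x * cnj (y t x) = sa (z t) x * cnj (sa (y t) x)"
        unfolding sa_def by (subst sq[symmetric]) (simp add: mult_ac)
    qed
    finally have "Re (L2inner (y1 t) (y t)) = Re (L2inner (f t) (y t)) - Re (L2inner (Dfrac s (z t)) (Dfrac s (y t))) - Re (L2inner (sa (z t)) (sa (y t))) - Re (L2inner (\<lambda>x. b x * y t x) (y t))"
      by simp
    moreover have "Re (L2inner (Dfrac s (z t)) (Dfrac s (y t))) = Re (L2inner (Dfrac s (y t)) (Dfrac s (z t)))" 
      "Re (L2inner (sa (z t)) (sa (y t))) = Re (L2inner (sa (y t)) (sa (z t)))"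
      by (subst L2inner_commute, simp)+
    moreover have "0 \<le> Re (L2inner (\<lambda>x. b x * y t x) (y t))"
    proof -
      have "L2inner (\<lambda>x. b x * y t x) (y t) = (\<integral>x. of_real (cmod (b x) * (cmod (y t x))\<^sup>2) \<partial>lborel)"
        unfolding L2inner_def
      proof (intro Bochner_Integration.integral_cong refl)
        fix x
        have "b x = of_real (cmod (b x))" using nn(2)[of x] by (auto elim!: nonneg_Reals_cases)
        moreover have "y t x * cnj (y t x) = of_real ((cmod (y t x))\<^sup>2)" by (rule complex_norm_square[symmetric])
        ultimately show "b x * y t x * cnj (y t x) = of_real (cmod (b x) * (cmod (y t x))\<^sup>2)"
          by (metis mult.assoc of_real_mult)
      qed
      also have "\<dots> = of_real (\<integral>x. cmod (b x) * (cmod (y t x))\<^sup>2 \<partial>lborel)" by (rule integral_complex_of_real)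
      finally show ?thesis by (simp add: Bochner_Integration.integral_nonneg)
    qed
    moreover have "Re (L2inner (f t) (y t)) \<le> M * sqrt (energy s a (z t) (y t))"
    proof -
      have "Re (L2inner (f t) (y t)) \<le> L2norm (f t) * L2norm (y t)"
        using complex_Re_le_cmod[of "L2inner (f t) (y t)"] L2inner_bound[OF f(1)[OF t] y2] by linarith
      also have "\<dots> \<le> M * sqrt (energy s a (z t) (y t))"
        by (intro mult_mono f(2) t energy_bounds M L2norm_nonneg)
      finally show ?thesis .
    qed
    ultimately show ?thesis unfolding e_def by linarith
  qed
  show ?thesis
    by (rule sqrt_growth[OF energy_bounds(1) deriv ebound M t])
qed

lemma tendsto_at_right_shift:
  fixes F :: "real \<Rightarrow> real"
  assumes "(F \<longlongrightarrow> l) (at t within {0..T})" "0 \<le> t" "t < T"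
  shows "((\<lambda>h. F (t + h)) \<longlongrightarrow> l) (at_right 0)"
proof (rule filterlim_compose[OF assms(1)])
  show "filterlim (\<lambda>h. t + h) (at t within {0..T}) (at_right 0)"
    unfolding filterlim_at
  proof
    show "\<forall>\<^sub>F x in at_right 0. t + x \<in> {0..T} \<and> t + x \<noteq> t"
      unfolding eventually_at by (rule exI[of _ "T - t"]) (use assms in \<open>auto simp: dist_real_def\<close>)
    have "((\<lambda>h. t + h) \<longlongrightarrow> t + 0) (at_right 0)" by (intro tendsto_intros)
    then show "((\<lambda>h. t + h) \<longlongrightarrow> t) (at_right 0)" by simp
  qed
qed

text \<open>The time derivative of a solution formally solves the same equation, because the coefficients do not depend on
  time, and its energy bounds \<open>v\<close> in the homogeneous Sobolev norm. The regularity for differentiating the equation is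
  missing, so the argument runs through difference quotients in time. The norm of \<open>g 0\<close> is that of the second time
  derivative at time zero.\<close>

theorem time_derivative_estimate:
  fixes u v g :: "real \<Rightarrow> 'a::euclidean_space \<Rightarrow> complex"
  assumes s: "s > 0" and T: "T > 0" and C: "sobolev_const s C TYPE('a)"
    and a1: "a \<in> elems (Lp (real DIM('a) / s))" and a2: "a \<in> elems (Lp (real DIM('a) / (2 * s)))" and b: "b \<in> elems (Lp (real DIM('a) / s))"
    and nn: "\<And>x. a x \<in> \<real>\<^sub>\<ge>\<^sub>0" "\<And>x. b x \<in> \<real>\<^sub>\<ge>\<^sub>0"
    and W: "wave_curve s T u v (\<lambda>t x. - g t x)"
    and g: "\<And>t x. g t x = frac_laplacian s (u t) x + a x * u t x + b x * v t x"
    and vc: "\<And>t. t \<in> {0..T} \<Longrightarrow> ((\<lambda>\<tau>. fnorm (Hs s) (\<lambda>x. v \<tau> x - v t x)) \<longlongrightarrow> 0) (at t within {0..T})"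
    and t: "t \<in> {0..T}"
  shows "L2norm (Dfrac s (v t)) \<le> L2norm (g 0) + (1 + C * sqrt (fnorm (Lp (real DIM('a) / (2 * s))) a)) * L2norm (Dfrac s (v 0))"
proof -
  let ?c = "C * sqrt (fnorm (Lp (real DIM('a) / (2 * s))) a)"
  let ?B = "L2norm (g 0) + (1 + ?c) * L2norm (Dfrac s (v 0))"
  have t00: "(0::real) \<in> {0..T}" using T by simp
  have c0: "?c \<ge> 0" using sobolev_const_mult(1)[OF C wave_curveD(1)[OF W t00]] by (simp add: Lp_def)
  \<comment> \<open>The difference quotient \<open>z h\<close> solves the same homogeneous equation on the shorter interval
    \<open>[0, T - h]\<close>, and the limit \<open>h \<rightarrow> 0\<close> of its energy estimate is taken at both ends.\<close>
  define z where "z h t x = (u (t + h) x - u t x) / complex_of_real h" for h t x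
  define y where "y h t x = (v (t + h) x - v t x) / complex_of_real h" for h t x
  define y1 where "y1 h t x = (- g (t + h) x - - g t x) / complex_of_real h" for h t x
  have WC: "wave_curve s (T - h) (z h) (y h) (y1 h)" if h: "0 < h" "h < T" for h
    unfolding z_def y_def y1_def
    by (intro wave_curve_divide wave_curve_diff wave_curve_shift[OF W] wave_curve_restrict[OF W]) (use h in auto)
  have bound: "L2norm (Dfrac s (z h t)) \<le> L2norm (y h 0) + (1 + ?c) * L2norm (Dfrac s (z h 0))" 
    if h: "0 < h" "h < T" and t: "0 \<le> t" "t \<le> T - h" for h t
  proof -
    have tt: "t \<in> {0..T - h}" using t by simp
    have zz: "(0::real) \<in> {0..T - h}" using h by simp
    have E: "sqrt (energy s a (z h t) (y h t)) \<le> sqrt (energy s a (z h 0) (y h 0)) + 0 * t"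
    proof (rule energy_estimate[OF s C a1 a2 b nn WC[OF h] _ _ _ _ tt, where f = "\<lambda>_ _. 0"])
      fix r assume r: "r \<in> {0..T - h}"
      then have r1: "r + h \<in> {0..T}" and r2: "r \<in> {0..T}" using h by auto
      note u1 = wave_curveD(2)[OF W r1] and u2 = wave_curveD(2)[OF W r2]
      have "AE x in lborel. Dfrac (2 * s) (z h r) x = (Dfrac (2 * s) (u (r + h)) x - Dfrac (2 * s) (u r) x) / of_real h"
        unfolding z_def using Dfrac_diff(2)[OF u1 u2] Dfrac_divide(2)[OF Dfrac_diff(1)[OF u1 u2], of "of_real h"]
        by eventually_elim simp
      then show "AE x in lborel. y1 h r x = 0 - (frac_laplacian s (z h r) x + a x * z h r x + b x * y h r x)"
      proof eventually_elim
        case (elim x)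
        have "frac_laplacian s (z h r) x = (frac_laplacian s (u (r + h)) x - frac_laplacian s (u r) x) / of_real h"
          using elim by simp
        then show ?case unfolding y1_def z_def y_def g by (simp add: diff_divide_distrib add_divide_distrib algebra_simps)
      qed
    qed auto
    have "L2norm (Dfrac s (z h t)) \<le> sqrt (energy s a (z h 0) (y h 0))"
      using order_trans[OF energy_bounds(3) E] by simp
    also have "\<dots> \<le> L2norm (y h 0) + L2norm (Dfrac s (z h 0)) + L2norm (\<lambda>x. of_real (sqrt (cmod (a x))) * z h 0 x)"
      by (rule energy_bounds(4))
    also have "\<dots> \<le> L2norm (y h 0) + L2norm (Dfrac s (z h 0)) + ?c * L2norm (Dfrac s (z h 0))"
      by (intro add_left_mono sobolev_const_mult(5)[OF C wave_curveD(1)[OF WC[OF h] zz] a2])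
    finally show ?thesis by (simp add: algebra_simps)
  qed
  have limD: "((\<lambda>h. L2norm (Dfrac s (z h t))) \<longlongrightarrow> L2norm (Dfrac s (v t))) (at_right 0)" if t: "0 \<le> t" "t < T" for t
  proof (rule LIM_zero_cancel, rule Lim_null_comparison)
    have tT: "t \<in> {0..T}" using t by simp
    note w = wave_curveD[OF W tT]
    show "((\<lambda>h. fnorm (Hs s) (\<lambda>x. z h t x - v t x)) \<longlongrightarrow> 0) (at_right 0)"
      using tendsto_at_right_shift[OF w(5) t] by (simp add: z_def)
    show "\<forall>\<^sub>F h in at_right 0. norm (L2norm (Dfrac s (z h t)) - L2norm (Dfrac s (v t))) \<le> fnorm (Hs s) (\<lambda>x. z h t x - v t x)"
      unfolding eventually_at
    proof (intro exI[of _ "T - t"] conjI ballI impI)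
      fix h :: real assume h: "h \<in> {0<..}" "h \<noteq> 0 \<and> dist h 0 < T - t"
      then have tz: "t + h \<in> {0..T}" using t by (auto simp: dist_real_def)
      have zm: "z h t \<in> elems (Hs s)" unfolding z_def by (intro Dfrac_divide Dfrac_diff wave_curveD(1)[OF W] tz tT)
      show "norm (L2norm (Dfrac s (z h t)) - L2norm (Dfrac s (v t))) \<le> fnorm (Hs s) (\<lambda>x. z h t x - v t x)"
        using L2norm_reverse_triangle[OF Hs_L2(2)[OF zm] Hs_L2(2)[OF w(3)]] 
        by (simp add: Hs_norm Dfrac_norm_diff_eq[OF zm w(3)] add_increasing)
    qed (use t in simp)
  qed
  have limy: "((\<lambda>h. L2norm (y h 0)) \<longlongrightarrow> L2norm (g 0)) (at_right 0)"
  proof (rule LIM_zero_cancel, rule Lim_null_comparison)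
    note w = wave_curveD[OF W t00]
    show "((\<lambda>h. L2norm (\<lambda>x. y h 0 x - - g 0 x)) \<longlongrightarrow> 0) (at_right 0)"
      using tendsto_at_right_shift[OF w(6)[unfolded has_L2_derivative_def] _ T] by (simp add: y_def)
    show "\<forall>\<^sub>F h in at_right 0. norm (L2norm (y h 0) - L2norm (g 0)) \<le> L2norm (\<lambda>x. y h 0 x - - g 0 x)"
      unfolding eventually_at
    proof (intro exI[of _ T] conjI ballI impI T)
      fix h :: real assume h: "h \<in> {0<..}" "h \<noteq> 0 \<and> dist h 0 < T"
      then have tz: "0 + h \<in> {0..T}" by (auto simp: dist_real_def)
      have ym: "y h 0 \<in> L2" unfolding y_def by (intro L2_divide L2_diff Hs_L2(1)[OF wave_curveD(3)[OF W]] tz t00)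
      show "norm (L2norm (y h 0) - L2norm (g 0)) \<le> L2norm (\<lambda>x. y h 0 x - - g 0 x)"
        using L2norm_reverse_triangle[OF ym w(4)] by (simp add: L2norm_uminus)
    qed
  qed
  have main: "L2norm (Dfrac s (v t)) \<le> ?B" if t: "0 \<le> t" "t < T" for t
  proof (rule tendsto_le[OF _ _ limD[OF t]])
    show "((\<lambda>h. L2norm (y h 0) + (1 + ?c) * L2norm (Dfrac s (z h 0))) \<longlongrightarrow> ?B) (at_right 0)"
      by (intro tendsto_intros limy limD T) simp
    show "\<forall>\<^sub>F h in at_right 0. L2norm (Dfrac s (z h t)) \<le> L2norm (y h 0) + (1 + ?c) * L2norm (Dfrac s (z h 0))"
      unfolding eventually_at
    proof (intro exI[of _ "T - t"] conjI ballI impI)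
      fix h :: real assume h: "h \<in> {0<..}" "h \<noteq> 0 \<and> dist h 0 < T - t"
      show "L2norm (Dfrac s (z h t)) \<le> L2norm (y h 0) + (1 + ?c) * L2norm (Dfrac s (z h 0))"
        by (rule bound) (use h t in \<open>auto simp: dist_real_def\<close>)
    qed (use t in simp)
  qed simp
  show ?thesis
  proof (cases "t < T")
    case True
    then show ?thesis using main[of t] t by simp
  next
    case False
    \<comment> \<open>Forward difference quotients do not reach the final time; the bound extends to it by continuity of \<open>v\<close>.\<close>
    then have tT: "t = T" using t by simp
    have TT: "T \<in> {0..T}" using T by simp
    have lim: "((\<lambda>\<tau>. L2norm (Dfrac s (v \<tau>))) \<longlongrightarrow> L2norm (Dfrac s (v T))) (at T within {0..T})"
    proof (rule LIM_zero_cancel, rule Lim_null_comparison[OF _ vc[OF TT]])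
      show "\<forall>\<^sub>F \<tau> in at T within {0..T}. norm (L2norm (Dfrac s (v \<tau>)) - L2norm (Dfrac s (v T))) \<le> fnorm (Hs s) (\<lambda>x. v \<tau> x - v T x)"
        unfolding eventually_at_filter
      proof (intro always_eventually allI impI)
        fix \<tau> assume \<tau>: "\<tau> \<in> {0..T}"
        note m = wave_curveD(3)[OF W \<tau>] wave_curveD(3)[OF W TT]
        show "norm (L2norm (Dfrac s (v \<tau>)) - L2norm (Dfrac s (v T))) \<le> fnorm (Hs s) (\<lambda>x. v \<tau> x - v T x)"
          using L2norm_reverse_triangle[OF Hs_L2(2)[OF m(1)] Hs_L2(2)[OF m(2)]] 
          by (simp add: Hs_norm Dfrac_norm_diff_eq[OF m] add_increasing)
      qed
    qed
    have "{0..T} - {T} = {0..<T}" by auto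
    then have nb: "at T within {0..T} \<noteq> bot" using T by (simp add: at_within_eq_bot_iff)
    have "L2norm (Dfrac s (v T)) \<le> ?B"
    proof (rule tendsto_upperbound[OF lim _ nb])
      show "\<forall>\<^sub>F \<tau> in at T within {0..T}. L2norm (Dfrac s (v \<tau>)) \<le> ?B"
        unfolding eventually_at_filter using main by (intro always_eventually) auto
    qed
    then show ?thesis by (simp add: tT)
  qed
qed

text \<open>By the multiplication estimates every term of the equation is continuous in time with values in \<open>L\<^sup>2\<close>; hence a
  weak solution has a second time derivative in \<open>L\<^sup>2\<close>.\<close>

lemma cauchy_solution_wave_curve:
  fixes u :: "real \<Rightarrow> 'a::euclidean_space \<Rightarrow> complex"
  assumes s: "s > 0" and T: "T > 0" and C: "sobolev_const s C TYPE('a)"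
    and a1: "a \<in> elems (Lp (real DIM('a) / s))" and b: "b \<in> elems (Lp (real DIM('a) / s))"
    and sol: "cauchy_solution s T a b u0 u1 u"
  obtains v where "wave_curve s T u v (\<lambda>t x. - (frac_laplacian s (u t) x + a x * u t x + b x * v t x))"
    "\<And>t. t \<in> {0..T} \<Longrightarrow> ((\<lambda>\<tau>. fnorm (Hs s) (\<lambda>x. v \<tau> x - v t x)) \<longlongrightarrow> 0) (at t within {0..T})"
    "AE x in lborel. u 0 x = u0 x" "AE x in lborel. v 0 x = u1 x"
proof -
  from sol obtain v where uc: "continuous_into (Hs (2 * s)) T u" and C1: "C1_into_with_deriv (Hs s) T u v" 
    and weq: "wave_equation s T a b u v" and init: "AE x in lborel. u 0 x = u0 x" "AE x in lborel. v 0 x = u1 x"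
    unfolding cauchy_solution_def by blast
  have u2: "u t \<in> elems (Hs (2 * s))" and uc': "((\<lambda>\<tau>. fnorm (Hs (2 * s)) (\<lambda>x. u \<tau> x - u t x)) \<longlongrightarrow> 0) (at t within {0..T})" if "t \<in> {0..T}" for t
    using uc that unfolding continuous_into_def by blast+
  have u1: "u t \<in> elems (Hs s)" and ud: "((\<lambda>\<tau>. fnorm (Hs s) (\<lambda>x. (u \<tau> x - u t x) / of_real (\<tau> - t) - v t x)) \<longlongrightarrow> 0) (at t within {0..T})" 
    and v1: "v t \<in> elems (Hs s)" and vc: "((\<lambda>\<tau>. fnorm (Hs s) (\<lambda>x. v \<tau> x - v t x)) \<longlongrightarrow> 0) (at t within {0..T})" if "t \<in> {0..T}" for t
    using C1 that unfolding C1_into_with_deriv_def continuous_into_def by blast+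
  define g where "g t x = frac_laplacian s (u t) x + a x * u t x + b x * v t x" for t x
  let ?A = "C * fnorm (Lp (real DIM('a) / s)) a" and ?B = "C * fnorm (Lp (real DIM('a) / s)) b"
  have L: "frac_laplacian s f \<in> L2" if "f \<in> elems (Hs (2 * s))" for f :: "'a \<Rightarrow> complex"
    using Hs_L2(2)[OF that] by simp
  have t00: "(0::real) \<in> {0..T}" using T by simp
  have AB: "0 \<le> ?A" "0 \<le> ?B" using sobolev_const_mult(1)[OF C u1[OF t00]] by (simp_all add: Lp_def)
  have gL2: "g t \<in> L2" if "t \<in> {0..T}" for t
    unfolding g_def[abs_def] by (intro L2_add L u2 sobolev_const_mult(2)[OF C u1 a1] sobolev_const_mult(2)[OF C v1 b] that)
  have gc: "L2_continuous g t {0..T}" if t: "t \<in> {0..T}" for t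
    unfolding L2_continuous_def
  proof (rule tendsto_null_within)
    have "((\<lambda>\<tau>. fnorm (Hs (2 * s)) (\<lambda>x. u \<tau> x - u t x) + ?A * fnorm (Hs (2 * s)) (\<lambda>x. u \<tau> x - u t x) + ?B * fnorm (Hs s) (\<lambda>x. v \<tau> x - v t x)) \<longlongrightarrow> 0 + ?A * 0 + ?B * 0) (at t within {0..T})"
      by (intro tendsto_add tendsto_mult tendsto_const uc' vc t)
    then show "((\<lambda>\<tau>. fnorm (Hs (2 * s)) (\<lambda>x. u \<tau> x - u t x) + ?A * fnorm (Hs (2 * s)) (\<lambda>x. u \<tau> x - u t x) + ?B * fnorm (Hs s) (\<lambda>x. v \<tau> x - v t x)) \<longlongrightarrow> 0) (at t within {0..T})"
      by simp
    fix \<tau> assume \<tau>: "\<tau> \<in> {0..T}"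
    note d1 = Dfrac_diff(1)[OF u1[OF \<tau>] u1[OF t]] and d2 = Dfrac_diff(1)[OF u2[OF \<tau>] u2[OF t]] and d3 = Dfrac_diff(1)[OF v1[OF \<tau>] v1[OF t]]
    have "g \<tau> x - g t x = (frac_laplacian s (u \<tau>) x - frac_laplacian s (u t) x) + a x * (u \<tau> x - u t x) + b x * (v \<tau> x - v t x)" for x
      by (simp add: g_def algebra_simps)
    then have "L2norm (\<lambda>x. g \<tau> x - g t x) = L2norm (\<lambda>x. ((frac_laplacian s (u \<tau>) x - frac_laplacian s (u t) x) + a x * (u \<tau> x - u t x)) + b x * (v \<tau> x - v t x))"
      by presburger
    also have "\<dots> \<le> L2norm (\<lambda>x. (frac_laplacian s (u \<tau>) x - frac_laplacian s (u t) x) + a x * (u \<tau> x - u t x)) + L2norm (\<lambda>x. b x * (v \<tau> x - v t x))"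
      by (intro L2norm_triangle L2_add L2_diff L u2 \<tau> t sobolev_const_mult(2)[OF C d1 a1] sobolev_const_mult(2)[OF C d3 b])
    also have "\<dots> \<le> L2norm (\<lambda>x. frac_laplacian s (u \<tau>) x - frac_laplacian s (u t) x) + L2norm (\<lambda>x. a x * (u \<tau> x - u t x)) + L2norm (\<lambda>x. b x * (v \<tau> x - v t x))"
      by (intro add_right_mono L2norm_triangle L2_diff L u2 \<tau> t sobolev_const_mult(2)[OF C d1 a1])
    also have "\<dots> \<le> fnorm (Hs (2 * s)) (\<lambda>x. u \<tau> x - u t x) + ?A * fnorm (Hs (2 * s)) (\<lambda>x. u \<tau> x - u t x) + ?B * fnorm (Hs s) (\<lambda>x. v \<tau> x - v t x)"
    proof (intro add_mono)
      show "L2norm (\<lambda>x. frac_laplacian s (u \<tau>) x - frac_laplacian s (u t) x) \<le> fnorm (Hs (2 * s)) (\<lambda>x. u \<tau> x - u t x)"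
        using Dfrac_norm_diff_eq[OF u2[OF \<tau>] u2[OF t]] L2norm_nonneg[of "\<lambda>x. u \<tau> x - u t x"] unfolding Hs_norm by simp
      have "L2norm (\<lambda>x. a x * (u \<tau> x - u t x)) \<le> ?A * L2norm (Dfrac s (\<lambda>x. u \<tau> x - u t x))"
        by (rule sobolev_const_mult(3)[OF C d1 a1])
      also have "\<dots> \<le> ?A * fnorm (Hs (2 * s)) (\<lambda>x. u \<tau> x - u t x)"
        by (rule mult_left_mono[OF Dfrac_interpolation[OF s d1 d2] AB(1)])
      finally show "L2norm (\<lambda>x. a x * (u \<tau> x - u t x)) \<le> ?A * fnorm (Hs (2 * s)) (\<lambda>x. u \<tau> x - u t x)" .
      have "L2norm (\<lambda>x. b x * (v \<tau> x - v t x)) \<le> ?B * L2norm (Dfrac s (\<lambda>x. v \<tau> x - v t x))"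
        by (rule sobolev_const_mult(3)[OF C d3 b])
      also have "\<dots> \<le> ?B * fnorm (Hs s) (\<lambda>x. v \<tau> x - v t x)"
        by (rule mult_left_mono[OF _ AB(2)]) (simp add: Hs_norm)
      finally show "L2norm (\<lambda>x. b x * (v \<tau> x - v t x)) \<le> ?B * fnorm (Hs s) (\<lambda>x. v \<tau> x - v t x)" .
    qed
    finally show "0 \<le> L2norm (\<lambda>x. g \<tau> x - g t x) \<and> L2norm (\<lambda>x. g \<tau> x - g t x) \<le> fnorm (Hs (2 * s)) (\<lambda>x. u \<tau> x - u t x) + ?A * fnorm (Hs (2 * s)) (\<lambda>x. u \<tau> x - u t x) + ?B * fnorm (Hs s) (\<lambda>x. v \<tau> x - v t x)"
      by simp
  qed
  have ud': "has_L2_derivative u (v t) t {0..T}" if t: "t \<in> {0..T}" for t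
    unfolding has_L2_derivative_def
    by (rule tendsto_null_within[OF ud[OF t]]) (simp add: Hs_norm)
  have vc': "L2_continuous v t {0..T}" if t: "t \<in> {0..T}" for t
    unfolding L2_continuous_def
    by (rule tendsto_null_within[OF vc[OF t]]) (simp add: Hs_norm)
  have vd: "has_L2_derivative v (\<lambda>x. - g t x) t {0..T}" if t: "t \<in> {0..T}" for t
  proof (rule L2_derivative_of_weak_equation[OF T Hs_L2(1)[OF u1] Hs_L2(1)[OF v1] gL2 ud' vc' gc _ t])
    fix \<psi> :: "'a \<Rightarrow> complex" and \<theta> \<theta>' \<theta>'' :: "real \<Rightarrow> complex"
    assume "test_function UNIV \<psi>" "time_test T \<theta> \<theta>' \<theta>''"
    from wave_equation_tensor[OF weq this Hs_L2(1)[OF u1] gL2[unfolded g_def[abs_def]]]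
    show "(LINT t:{0<..<T}|lborel. \<theta>'' t * (\<integral>x. u t x * \<psi> x \<partial>lborel) + \<theta> t * (\<integral>x. g t x * \<psi> x \<partial>lborel)) = 0"
      unfolding g_def .
  qed
  have "wave_curve s T u v (\<lambda>t x. - g t x)"
    unfolding wave_curve_def using u1 u2 v1 L2_uminus[OF gL2] ud vd by blast
  then show thesis using that vc init unfolding g_def by blast
qed

section \<open>Stability of solutions\<close>

text \<open>The energy of a solution of the homogeneous equation does not increase.\<close>

lemma first_derivative_estimate:
  fixes u v :: "real \<Rightarrow> 'a::euclidean_space \<Rightarrow> complex"
  assumes s: "s > 0" and C: "sobolev_const s C TYPE('a)"
    and a1: "a \<in> elems (Lp (real DIM('a) / s))" and a2: "a \<in> elems (Lp (real DIM('a) / (2 * s)))" and b: "b \<in> elems (Lp (real DIM('a) / s))"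
    and nn: "\<And>x. a x \<in> \<real>\<^sub>\<ge>\<^sub>0" "\<And>x. b x \<in> \<real>\<^sub>\<ge>\<^sub>0"
    and W: "wave_curve s T u v (\<lambda>t x. - (frac_laplacian s (u t) x + a x * u t x + b x * v t x))"
    and t: "t \<in> {0..T}"
  shows "L2norm (Dfrac s (u t)) \<le> L2norm (v 0) + (1 + C * sqrt (fnorm (Lp (real DIM('a) / (2 * s))) a)) * L2norm (Dfrac s (u 0))"
proof -
  have t00: "0 \<in> {0..T}" using t by simp
  have "L2norm (Dfrac s (u t)) \<le> sqrt (energy s a (u t) (v t))" by (rule energy_bounds(3))
  also have "\<dots> \<le> sqrt (energy s a (u 0) (v 0)) + 0 * t"
    by (rule energy_estimate[OF s C a1 a2 b nn W _ _ _ _ t, where f = "\<lambda>_ _. 0"]) auto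
  also have "\<dots> = sqrt (energy s a (u 0) (v 0))" by simp
  also have "\<dots> \<le> L2norm (v 0) + L2norm (Dfrac s (u 0)) + L2norm (\<lambda>x. of_real (sqrt (cmod (a x))) * u 0 x)"
    by (rule energy_bounds(4))
  also have "\<dots> \<le> L2norm (v 0) + L2norm (Dfrac s (u 0)) + C * sqrt (fnorm (Lp (real DIM('a) / (2 * s))) a) * L2norm (Dfrac s (u 0))"
    by (intro add_left_mono sobolev_const_mult(5)[OF C wave_curveD(1)[OF W t00] a2])
  finally show ?thesis by (simp add: algebra_simps)
qed

text \<open>The energy does not control the \<open>L\<^sup>2\<close> norm of the curve itself, which is recovered from its velocity.\<close>

lemma wave_curve_L2_growth:
  assumes W: "wave_curve s T z y y1" and M: "\<And>t. t \<in> {0..T} \<Longrightarrow> L2norm (y t) \<le> M" "0 \<le> M" and t: "t \<in> {0..T}"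
  shows "L2norm (z t) \<le> L2norm (z 0) + M * t"
proof -
  have "sqrt ((L2norm (z t))\<^sup>2) \<le> sqrt ((L2norm (z 0))\<^sup>2) + M * t"
  proof (rule sqrt_growth[where e = "\<lambda>t. 2 * Re (L2inner (y t) (z t))", OF _ _ _ M(2) t])
    fix r assume r: "r \<in> {0..T}"
    note w = wave_curveD[OF W r]
    show "((\<lambda>t. (L2norm (z t))\<^sup>2) has_real_derivative 2 * Re (L2inner (y r) (z r))) (at r within {0..T})"
    proof (rule L2norm_sq_has_derivative[OF Hs_L2(1)[OF wave_curveD(1)[OF W]] r Hs_L2(1)[OF w(3)]])
      show "((\<lambda>\<tau>. L2norm (\<lambda>x. (z \<tau> x - z r x) / of_real (\<tau> - r) - y r x)) \<longlongrightarrow> 0) (at r within {0..T})"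
        by (rule tendsto_null_within[OF w(5)]) (simp add: Hs_norm)
    qed
    have "Re (L2inner (y r) (z r)) \<le> L2norm (y r) * L2norm (z r)"
      using complex_Re_le_cmod[of "L2inner (y r) (z r)"] L2inner_bound[OF Hs_L2(1)[OF w(3)] Hs_L2(1)[OF w(1)]] by linarith
    also have "\<dots> \<le> M * L2norm (z r)" by (intro mult_right_mono M r) simp
    finally show "2 * Re (L2inner (y r) (z r)) \<le> 2 * M * sqrt ((L2norm (z r))\<^sup>2)" by simp
  qed simp
  then show ?thesis by simp
qed

text \<open>The bound is a polynomial in the norms of the coefficients and data, and every summand contains a factor that
  measures the difference of the two problems. Only this shape matters for nets. The factors multiplying \<open>\<delta>a\<close> and
  \<open>\<delta>b\<close> bound the solution of the second problem and its time derivative in the homogeneous Sobolev norm.\<close>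

theorem stability_estimate:
  fixes u u' :: "real \<Rightarrow> 'a::euclidean_space \<Rightarrow> complex" 
    and a a' b b' u0 u0' u1 u1' :: "'a \<Rightarrow> complex" and s T C t :: real
  defines "La \<equiv> inter_space (Lp (real DIM('a) / s)) (Lp (real DIM('a) / (2 * s)))" and "Lb \<equiv> Lp (real DIM('a) / s)"
  assumes s: "s > 0" and T: "T > 0" and C: "sobolev_const s C TYPE('a)"
    and a: "a \<in> elems La" and a': "a' \<in> elems La" and da: "(\<lambda>x. a x - a' x) \<in> elems La"
    and b: "b \<in> elems Lb" and b': "b' \<in> elems Lb" and db: "(\<lambda>x. b x - b' x) \<in> elems Lb"
    and nn: "\<And>x. a x \<in> \<real>\<^sub>\<ge>\<^sub>0" "\<And>x. b x \<in> \<real>\<^sub>\<ge>\<^sub>0" "\<And>x. a' x \<in> \<real>\<^sub>\<ge>\<^sub>0" "\<And>x. b' x \<in> \<real>\<^sub>\<ge>\<^sub>0"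
    and u0: "u0' \<in> elems (Hs (2 * s))" "(\<lambda>x. u0 x - u0' x) \<in> elems (Hs (2 * s))"
    and u1: "u1' \<in> elems (Hs s)" "(\<lambda>x. u1 x - u1' x) \<in> elems (Hs s)"
    and sol: "cauchy_solution s T a b u0 u1 u" and sol': "cauchy_solution s T a' b' u0' u1' u'"
    and t: "t \<in> {0..T}"
  defines "U0 \<equiv> fnorm (Hs (2 * s)) u0'" and "U1 \<equiv> fnorm (Hs s) u1'"
    and "\<delta>0 \<equiv> fnorm (Hs (2 * s)) (\<lambda>x. u0 x - u0' x)" and "\<delta>1 \<equiv> fnorm (Hs s) (\<lambda>x. u1 x - u1' x)"
    and "\<delta>a \<equiv> fnorm La (\<lambda>x. a x - a' x)" and "\<delta>b \<equiv> fnorm Lb (\<lambda>x. b x - b' x)"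
    and "\<alpha> \<equiv> fnorm La a" and "\<alpha>' \<equiv> fnorm La a'" and "\<beta>' \<equiv> fnorm Lb b'"
  shows "(\<lambda>x. u t x - u' t x) \<in> L2"
    and "L2norm (\<lambda>x. u t x - u' t x) \<le> \<delta>0 + T * ((\<delta>1 + (1 + C * (1 + \<alpha>)) * \<delta>0) + 
        T * (C * \<delta>a * (U1 + (1 + C * (1 + \<alpha>')) * U0) + 
             C * \<delta>b * ((U0 + C * \<alpha>' * U0 + C * \<beta>' * U1) + (1 + C * (1 + \<alpha>')) * U1)))"
proof -
  let ?p = "real DIM('a) / s" and ?q = "real DIM('a) / (2 * s)"
  have mem: "a \<in> elems (Lp ?p)" "a \<in> elems (Lp ?q)" "a' \<in> elems (Lp ?p)" "a' \<in> elems (Lp ?q)" 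
    "(\<lambda>x. a x - a' x) \<in> elems (Lp ?p)" "b \<in> elems (Lp ?p)" "b' \<in> elems (Lp ?p)" "(\<lambda>x. b x - b' x) \<in> elems (Lp ?p)"
    using a a' da b b' db by (auto simp: La_def Lb_def inter_space_def)
  have Lp0: "0 \<le> fnorm (Lp r) (h :: 'a \<Rightarrow> complex)" for r h by (simp add: Lp_def)
  have La: "fnorm La h = fnorm (Lp ?p) h + fnorm (Lp ?q) h" for h :: "'a \<Rightarrow> complex"
    by (simp add: La_def inter_space_def)
  have nonneg: "0 \<le> U0" "0 \<le> U1" "0 \<le> \<delta>0" "0 \<le> \<delta>1" "0 \<le> \<delta>a" "0 \<le> \<delta>b" "0 \<le> \<alpha>" "0 \<le> \<alpha>'" "0 \<le> \<beta>'"
    by (simp_all add: U0_def U1_def \<delta>0_def \<delta>1_def \<delta>a_def \<delta>b_def \<alpha>_def \<alpha>'_def \<beta>'_def La Lb_def Hs_norm Lp0)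
  \<comment> \<open>Square roots of the norms are traded for the norms, as only polynomial bounds in \<open>\<epsilon>\<close> matter.\<close>
  have root: "sqrt (fnorm (Lp ?q) h) \<le> 1 + fnorm La h" for h :: "'a \<Rightarrow> complex"
  proof -
    have "sqrt (fnorm (Lp ?q) h) \<le> 1 + fnorm (Lp ?q) h"
      using Lp0[of ?q h] by (intro real_le_lsqrt) (auto simp: power2_eq_square algebra_simps)
    then show ?thesis using Lp0[of ?p h] by (simp add: La)
  qed
  obtain v where W: "wave_curve s T u v (\<lambda>t x. - (frac_laplacian s (u t) x + a x * u t x + b x * v t x))"
    and i: "AE x in lborel. u 0 x = u0 x" "AE x in lborel. v 0 x = u1 x"
    by (rule cauchy_solution_wave_curve[OF s T C mem(1) mem(6) sol]; rule that; assumption)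
  obtain v' where W': "wave_curve s T u' v' (\<lambda>t x. - (frac_laplacian s (u' t) x + a' x * u' t x + b' x * v' t x))"
    and vc': "\<And>t. t \<in> {0..T} \<Longrightarrow> ((\<lambda>\<tau>. fnorm (Hs s) (\<lambda>x. v' \<tau> x - v' t x)) \<longlongrightarrow> 0) (at t within {0..T})"
    and i': "AE x in lborel. u' 0 x = u0' x" "AE x in lborel. v' 0 x = u1' x"
    by (rule cauchy_solution_wave_curve[OF s T C mem(3) mem(7) sol']; rule that; assumption)
  have t00: "(0::real) \<in> {0..T}" using T by simp
  note w0 = wave_curveD[OF W t00] and w0' = wave_curveD[OF W' t00]
  have C0: "C > 0" by (rule sobolev_const_mult(1)[OF C w0(1)])
  have N: "fnorm (Hs (2 * s)) (u' 0) = U0" "fnorm (Hs s) (v' 0) = U1"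
    unfolding U0_def U1_def by (rule Hs_norm_cong_AE[OF w0'(2) Hs_L2(1)[OF u0(1)] i'(1)], rule Hs_norm_cong_AE[OF w0'(3) Hs_L2(1)[OF u1(1)] i'(2)])
  have ND: "fnorm (Hs (2 * s)) (\<lambda>x. u 0 x - u' 0 x) = \<delta>0" "fnorm (Hs s) (\<lambda>x. v 0 x - v' 0 x) = \<delta>1"
    unfolding \<delta>0_def \<delta>1_def
    by (rule Hs_norm_cong_AE[OF Dfrac_diff(1)[OF w0(2) w0'(2)] Hs_L2(1)[OF u0(2)]], use i i' in force,
        rule Hs_norm_cong_AE[OF Dfrac_diff(1)[OF w0(3) w0'(3)] Hs_L2(1)[OF u1(2)]], use i i' in force)
  have D0': "L2norm (Dfrac s (u' 0)) \<le> U0" using Dfrac_interpolation[OF s w0'(1,2)] N by simp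
  have D1': "L2norm (v' 0) \<le> U1" "L2norm (Dfrac s (v' 0)) \<le> U1" using N(2) by (simp_all add: Hs_norm flip: N(2))
  \<comment> \<open>\<open>X\<close> and \<open>Y\<close> bound \<open>u'\<close> and its time derivative in the homogeneous Sobolev norm.\<close>
  define X where "X = U1 + (1 + C * (1 + \<alpha>')) * U0"
  define Y where "Y = (U0 + C * \<alpha>' * U0 + C * \<beta>' * U1) + (1 + C * (1 + \<alpha>')) * U1"
  have ra: "1 + C * sqrt (fnorm (Lp ?q) a) \<le> 1 + C * (1 + \<alpha>)" "1 + C * sqrt (fnorm (Lp ?q) a') \<le> 1 + C * (1 + \<alpha>')"
    unfolding \<alpha>_def \<alpha>'_def using C0 by (intro add_left_mono mult_left_mono root; simp)+
  have X: "L2norm (Dfrac s (u' r)) \<le> X" if r: "r \<in> {0..T}" for r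
  proof -
    have "L2norm (Dfrac s (u' r)) \<le> L2norm (v' 0) + (1 + C * sqrt (fnorm (Lp ?q) a')) * L2norm (Dfrac s (u' 0))"
      by (rule first_derivative_estimate[OF s C mem(3,4,7) nn(3,4) W' r])
    also have "\<dots> \<le> X" unfolding X_def
      using ra(2) C0 nonneg Lp0[of ?q a'] by (intro add_mono D1' mult_mono D0') auto
    finally show ?thesis .
  qed
  have Y: "L2norm (Dfrac s (v' r)) \<le> Y" if r: "r \<in> {0..T}" for r
  proof -
    define g where "g t x = frac_laplacian s (u' t) x + a' x * u' t x + b' x * v' t x" for t x
    have L: "frac_laplacian s (u' 0) \<in> L2" using Hs_L2(2)[OF w0'(2)] by simp
    have "L2norm (g 0) \<le> L2norm (frac_laplacian s (u' 0)) + L2norm (\<lambda>x. a' x * u' 0 x) + L2norm (\<lambda>x. b' x * v' 0 x)"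
      unfolding g_def[abs_def]
      using L2norm_triangle[OF L2_add[OF L sobolev_const_mult(2)[OF C w0'(1) mem(3)]] sobolev_const_mult(2)[OF C w0'(3) mem(7)]]
        L2norm_triangle[OF L sobolev_const_mult(2)[OF C w0'(1) mem(3)]] by linarith
    also have "\<dots> \<le> U0 + C * \<alpha>' * U0 + C * \<beta>' * U1"
    proof (intro add_mono)
      show "L2norm (frac_laplacian s (u' 0)) \<le> U0" unfolding N(1)[symmetric] Hs_norm by simp
      have "fnorm (Lp ?p) a' \<le> \<alpha>'" by (simp add: \<alpha>'_def La Lp0)
      then have "C * fnorm (Lp ?p) a' * L2norm (Dfrac s (u' 0)) \<le> C * \<alpha>' * U0"
        using C0 nonneg Lp0 by (intro mult_mono D0') auto
      then show "L2norm (\<lambda>x. a' x * u' 0 x) \<le> C * \<alpha>' * U0"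
        using sobolev_const_mult(3)[OF C w0'(1) mem(3)] by linarith
      have "C * fnorm (Lp ?p) b' * L2norm (Dfrac s (v' 0)) \<le> C * \<beta>' * U1"
        using C0 nonneg Lp0 by (intro mult_mono D1') (auto simp: \<beta>'_def Lb_def)
      then show "L2norm (\<lambda>x. b' x * v' 0 x) \<le> C * \<beta>' * U1"
        using sobolev_const_mult(3)[OF C w0'(3) mem(7)] by linarith
    qed
    finally have g0: "L2norm (g 0) \<le> U0 + C * \<alpha>' * U0 + C * \<beta>' * U1" .
    have "L2norm (Dfrac s (v' r)) \<le> L2norm (g 0) + (1 + C * sqrt (fnorm (Lp ?q) a')) * L2norm (Dfrac s (v' 0))"
      by (rule time_derivative_estimate[OF s T C mem(3,4,7) nn(3,4) W'[folded g_def] g_def vc' r])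
    also have "\<dots> \<le> Y" unfolding Y_def
      using ra(2) C0 nonneg Lp0[of ?q a'] by (intro add_mono g0 mult_mono D1') auto
    finally show ?thesis .
  qed
  \<comment> \<open>The difference solves the equation with coefficients \<open>a\<close>, \<open>b\<close> and this right-hand side.\<close>
  define f where "f t x = - ((a x - a' x) * u' t x + (b x - b' x) * v' t x)" for t x
  note WD = wave_curve_diff[OF W W']
  have fL2: "f r \<in> L2" and fM: "L2norm (f r) \<le> C * \<delta>a * X + C * \<delta>b * Y" if r: "r \<in> {0..T}" for r
  proof -
    note w' = wave_curveD[OF W' r]
    have m: "(\<lambda>x. (a x - a' x) * u' r x) \<in> L2" "(\<lambda>x. (b x - b' x) * v' r x) \<in> L2"
      by (rule sobolev_const_mult(2)[OF C w'(1) mem(5)], rule sobolev_const_mult(2)[OF C w'(3) mem(8)])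
    show "f r \<in> L2" unfolding f_def[abs_def] by (intro L2_uminus L2_add m)
    have "L2norm (f r) \<le> L2norm (\<lambda>x. (a x - a' x) * u' r x) + L2norm (\<lambda>x. (b x - b' x) * v' r x)"
      unfolding f_def[abs_def] L2norm_uminus by (rule L2norm_triangle[OF m])
    also have "\<dots> \<le> C * fnorm (Lp ?p) (\<lambda>x. a x - a' x) * L2norm (Dfrac s (u' r)) + C * fnorm (Lp ?p) (\<lambda>x. b x - b' x) * L2norm (Dfrac s (v' r))"
      by (rule add_mono[OF sobolev_const_mult(3)[OF C w'(1) mem(5)] sobolev_const_mult(3)[OF C w'(3) mem(8)]])
    also have "\<dots> \<le> C * \<delta>a * X + C * \<delta>b * Y"
      using C0 nonneg Lp0 
      by (intro add_mono mult_mono X Y r) (auto simp: \<delta>a_def \<delta>b_def La Lb_def X_def)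
    finally show "L2norm (f r) \<le> C * \<delta>a * X + C * \<delta>b * Y" .
  qed
  have XY: "0 \<le> X" "0 \<le> Y" using C0 nonneg by (auto simp: X_def Y_def)
  define M where "M = C * \<delta>a * X + C * \<delta>b * Y"
  have M: "0 \<le> M" unfolding M_def using XY C0 nonneg by simp
  have E: "sqrt (energy s a (\<lambda>x. u r x - u' r x) (\<lambda>x. v r x - v' r x)) \<le> sqrt (energy s a (\<lambda>x. u 0 x - u' 0 x) (\<lambda>x. v 0 x - v' 0 x)) + M * r" 
    if r: "r \<in> {0..T}" for r
  proof (rule energy_estimate[OF s C mem(1,2,6) nn(1,2) WD fL2 _ M _ r])
    fix r assume r: "r \<in> {0..T}"
    show "L2norm (f r) \<le> M" unfolding M_def by (rule fM[OF r])
    have "AE x in lborel. Dfrac (2 * s) (\<lambda>x. u r x - u' r x) x = Dfrac (2 * s) (u r) x - Dfrac (2 * s) (u' r) x"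
      by (rule Dfrac_diff(2)[OF wave_curveD(2)[OF W r] wave_curveD(2)[OF W' r]])
    then show "AE x in lborel. - (frac_laplacian s (u r) x + a x * u r x + b x * v r x) - - (frac_laplacian s (u' r) x + a' x * u' r x + b' x * v' r x)
      = f r x - (frac_laplacian s (\<lambda>x. u r x - u' r x) x + a x * (u r x - u' r x) + b x * (v r x - v' r x))"
    proof eventually_elim
      case (elim x)
      then have "frac_laplacian s (\<lambda>x. u r x - u' r x) x = frac_laplacian s (u r) x - frac_laplacian s (u' r) x" by simp
      then show ?case by (simp add: f_def algebra_simps)
    qed
  qed
  have E0: "sqrt (energy s a (\<lambda>x. u 0 x - u' 0 x) (\<lambda>x. v 0 x - v' 0 x)) \<le> \<delta>1 + (1 + C * (1 + \<alpha>)) * \<delta>0"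
  proof -
    note wd = wave_curveD[OF WD t00]
    have d: "L2norm (Dfrac s (\<lambda>x. u 0 x - u' 0 x)) \<le> \<delta>0" using Dfrac_interpolation[OF s wd(1,2)] ND by simp
    have "sqrt (energy s a (\<lambda>x. u 0 x - u' 0 x) (\<lambda>x. v 0 x - v' 0 x)) \<le> 
      L2norm (\<lambda>x. v 0 x - v' 0 x) + L2norm (Dfrac s (\<lambda>x. u 0 x - u' 0 x)) + L2norm (\<lambda>x. of_real (sqrt (cmod (a x))) * (u 0 x - u' 0 x))"
      by (rule energy_bounds(4))
    also have "\<dots> \<le> L2norm (\<lambda>x. v 0 x - v' 0 x) + L2norm (Dfrac s (\<lambda>x. u 0 x - u' 0 x)) + C * sqrt (fnorm (Lp ?q) a) * L2norm (Dfrac s (\<lambda>x. u 0 x - u' 0 x))"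
      by (intro add_left_mono sobolev_const_mult(5)[OF C wd(1) mem(2)])
    also have "\<dots> = L2norm (\<lambda>x. v 0 x - v' 0 x) + (1 + C * sqrt (fnorm (Lp ?q) a)) * L2norm (Dfrac s (\<lambda>x. u 0 x - u' 0 x))"
      by (simp add: algebra_simps)
    also have "\<dots> \<le> \<delta>1 + (1 + C * (1 + \<alpha>)) * \<delta>0"
    proof (intro add_mono mult_mono ra d)
      show "L2norm (\<lambda>x. v 0 x - v' 0 x) \<le> \<delta>1" unfolding ND(2)[symmetric] Hs_norm by simp
    qed (use C0 nonneg root[of a, folded \<alpha>_def] Lp0[of ?q a] in auto)
    finally show ?thesis .
  qed
  have yb: "L2norm (\<lambda>x. v r x - v' r x) \<le> (\<delta>1 + (1 + C * (1 + \<alpha>)) * \<delta>0) + T * M" if r: "r \<in> {0..T}" for r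
  proof -
    have "L2norm (\<lambda>x. v r x - v' r x) \<le> sqrt (energy s a (\<lambda>x. u r x - u' r x) (\<lambda>x. v r x - v' r x))"
      by (rule energy_bounds(2))
    moreover have "M * r \<le> T * M" using r M by (simp add: mult.commute mult_left_mono)
    ultimately show ?thesis using E[OF r] E0 by linarith
  qed
  show "(\<lambda>x. u t x - u' t x) \<in> L2" by (rule Hs_L2(1)[OF wave_curveD(1)[OF WD t]])
  have B0: "0 \<le> (\<delta>1 + (1 + C * (1 + \<alpha>)) * \<delta>0) + T * M" using C0 nonneg M T by simp
  have "L2norm (\<lambda>x. u t x - u' t x) \<le> L2norm (\<lambda>x. u 0 x - u' 0 x) + ((\<delta>1 + (1 + C * (1 + \<alpha>)) * \<delta>0) + T * M) * t"
    by (rule wave_curve_L2_growth[OF WD yb B0 t])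
  also have "\<dots> \<le> \<delta>0 + T * ((\<delta>1 + (1 + C * (1 + \<alpha>)) * \<delta>0) + T * M)"
  proof (intro add_mono)
    show "L2norm (\<lambda>x. u 0 x - u' 0 x) \<le> \<delta>0" unfolding ND(1)[symmetric] Hs_norm by simp
    show "((\<delta>1 + (1 + C * (1 + \<alpha>)) * \<delta>0) + T * M) * t \<le> T * ((\<delta>1 + (1 + C * (1 + \<alpha>)) * \<delta>0) + T * M)"
      using mult_right_mono[of t T, OF _ B0] t by (simp add: mult.commute)
  qed
  finally show "L2norm (\<lambda>x. u t x - u' t x) \<le> \<delta>0 + T * ((\<delta>1 + (1 + C * (1 + \<alpha>)) * \<delta>0) + 
        T * (C * \<delta>a * (U1 + (1 + C * (1 + \<alpha>')) * U0) + 
             C * \<delta>b * ((U0 + C * \<alpha>' * U0 + C * \<beta>' * U1) + (1 + C * (1 + \<alpha>')) * U1)))"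
    unfolding M_def X_def Y_def .
qed

section \<open>Moderate and negligible nets of numbers\<close>

text \<open>Moderate nonnegative nets of numbers form a semiring and the negligible ones an ideal in it; polynomial bounds are
  then treated term by term.\<close>

definition moderate_bound :: "(real \<Rightarrow> real) \<Rightarrow> bool" where
  "moderate_bound f \<longleftrightarrow> (\<forall>\<epsilon>\<in>{0<..1}. 0 \<le> f \<epsilon>) \<and> (\<exists>N::nat. \<exists>C>0. \<forall>\<epsilon>\<in>{0<..1}. f \<epsilon> \<le> C / \<epsilon> ^ N)"

definition negligible_bound :: "(real \<Rightarrow> real) \<Rightarrow> bool" where
  "negligible_bound f \<longleftrightarrow> (\<forall>\<epsilon>\<in>{0<..1}. 0 \<le> f \<epsilon>) \<and> (\<forall>k>0. \<exists>C>0. \<forall>\<epsilon>\<in>{0<..1}. f \<epsilon> \<le> C * \<epsilon> powr k)"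

lemma moderate_boundE:
  assumes "moderate_bound f"
  obtains N :: nat and C where "C > 0" "\<And>\<epsilon>. \<epsilon> \<in> {0<..1} \<Longrightarrow> f \<epsilon> \<le> C / \<epsilon> ^ N"
  using assms unfolding moderate_bound_def by blast

lemma negligible_boundE:
  assumes "negligible_bound f" "k > 0"
  obtains C where "C > 0" "\<And>\<epsilon>. \<epsilon> \<in> {0<..1} \<Longrightarrow> f \<epsilon> \<le> C * \<epsilon> powr k"
  using assms unfolding negligible_bound_def by blast

lemma moderate_boundI:
  assumes "\<And>\<epsilon>. \<epsilon> \<in> {0<..1} \<Longrightarrow> 0 \<le> f \<epsilon>" "C > 0" "\<And>\<epsilon>. \<epsilon> \<in> {0<..1} \<Longrightarrow> f \<epsilon> \<le> C / \<epsilon> ^ N"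
  shows "moderate_bound f"
  using assms unfolding moderate_bound_def by blast

lemma bound_nonneg:
  "moderate_bound f \<Longrightarrow> \<epsilon> \<in> {0<..1} \<Longrightarrow> 0 \<le> f \<epsilon>" "negligible_bound f \<Longrightarrow> \<epsilon> \<in> {0<..1} \<Longrightarrow> 0 \<le> f \<epsilon>"
  by (auto simp: moderate_bound_def negligible_bound_def)

lemma moderate_const: "0 \<le> c \<Longrightarrow> moderate_bound (\<lambda>_. c)"
  unfolding moderate_bound_def by (auto intro!: exI[of _ 0] exI[of _ "c + 1"])

lemma moderate_add:
  assumes "moderate_bound f" "moderate_bound g" shows "moderate_bound (\<lambda>\<epsilon>. f \<epsilon> + g \<epsilon>)"
proof -
  obtain N C where 1: "C > 0" "\<And>\<epsilon>. \<epsilon> \<in> {0<..1} \<Longrightarrow> f \<epsilon> \<le> C / \<epsilon> ^ N" 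
    using moderate_boundE[OF assms(1)] by metis
  obtain N' C' where 2: "C' > 0" "\<And>\<epsilon>. \<epsilon> \<in> {0<..1} \<Longrightarrow> g \<epsilon> \<le> C' / \<epsilon> ^ N'" 
    using moderate_boundE[OF assms(2)] by metis
  have "f \<epsilon> + g \<epsilon> \<le> (C + C') / \<epsilon> ^ (N + N')" if e: "\<epsilon> \<in> {0<..1}" for \<epsilon>
  proof -
    have "\<epsilon> ^ (N + N') \<le> \<epsilon> ^ N" "\<epsilon> ^ (N + N') \<le> \<epsilon> ^ N'" using e by (auto intro!: power_decreasing)
    then have "C / \<epsilon> ^ N \<le> C / \<epsilon> ^ (N + N')" "C' / \<epsilon> ^ N' \<le> C' / \<epsilon> ^ (N + N')"
      using e 1(1) 2(1) by (auto intro!: divide_left_mono)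
    then show ?thesis using 1(2)[OF e] 2(2)[OF e] by (simp add: add_divide_distrib)
  qed
  moreover have "C + C' > 0" using 1 2 by simp
  ultimately show ?thesis using bound_nonneg(1)[OF assms(1)] bound_nonneg(1)[OF assms(2)]
    by (intro moderate_boundI[where C = "C + C'" and N = "N + N'"] add_nonneg_nonneg)
qed

lemma moderate_mult:
  assumes "moderate_bound f" "moderate_bound g" shows "moderate_bound (\<lambda>\<epsilon>. f \<epsilon> * g \<epsilon>)"
proof -
  obtain N C where 1: "C > 0" "\<And>\<epsilon>. \<epsilon> \<in> {0<..1} \<Longrightarrow> f \<epsilon> \<le> C / \<epsilon> ^ N" 
    using moderate_boundE[OF assms(1)] by metis
  obtain N' C' where 2: "C' > 0" "\<And>\<epsilon>. \<epsilon> \<in> {0<..1} \<Longrightarrow> g \<epsilon> \<le> C' / \<epsilon> ^ N'" 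
    using moderate_boundE[OF assms(2)] by metis
  have "f \<epsilon> * g \<epsilon> \<le> (C * C') / \<epsilon> ^ (N + N')" if e: "\<epsilon> \<in> {0<..1}" for \<epsilon>
  proof -
    have "f \<epsilon> * g \<epsilon> \<le> (C / \<epsilon> ^ N) * (C' / \<epsilon> ^ N')"
      using e 1(1) by (intro mult_mono 1 2 bound_nonneg(1)[OF assms(2)]) auto
    then show ?thesis by (simp add: power_add)
  qed
  moreover have "C * C' > 0" using 1 2 by simp
  ultimately show ?thesis using bound_nonneg(1)[OF assms(1)] bound_nonneg(1)[OF assms(2)]
    by (intro moderate_boundI[where C = "C * C'" and N = "N + N'"] mult_nonneg_nonneg)
qed

lemma negligible_add:
  assumes "negligible_bound f" "negligible_bound g" shows "negligible_bound (\<lambda>\<epsilon>. f \<epsilon> + g \<epsilon>)"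
  unfolding negligible_bound_def
proof (intro conjI ballI allI impI)
  show "0 \<le> f \<epsilon> + g \<epsilon>" if "\<epsilon> \<in> {0<..1}" for \<epsilon> using that assms by (auto simp: negligible_bound_def)
  fix k :: real assume k: "k > 0"
  obtain C where 1: "C > 0" "\<And>\<epsilon>. \<epsilon> \<in> {0<..1} \<Longrightarrow> f \<epsilon> \<le> C * \<epsilon> powr k"
    using negligible_boundE[OF assms(1) k] by metis
  obtain C' where 2: "C' > 0" "\<And>\<epsilon>. \<epsilon> \<in> {0<..1} \<Longrightarrow> g \<epsilon> \<le> C' * \<epsilon> powr k" 
    using negligible_boundE[OF assms(2) k] by metis
  show "\<exists>C>0. \<forall>\<epsilon>\<in>{0<..1}. f \<epsilon> + g \<epsilon> \<le> C * \<epsilon> powr k"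
  proof (intro exI[of _ "C + C'"] conjI ballI)
    fix \<epsilon> :: real assume e: "\<epsilon> \<in> {0<..1}"
    show "f \<epsilon> + g \<epsilon> \<le> (C + C') * \<epsilon> powr k" using 1(2)[OF e] 2(2)[OF e] by (simp add: distrib_right)
  qed (use 1 2 in simp)
qed

lemma negligible_mult:
  assumes "moderate_bound f" "negligible_bound g" shows "negligible_bound (\<lambda>\<epsilon>. f \<epsilon> * g \<epsilon>)"
  unfolding negligible_bound_def
proof (intro conjI ballI allI impI)
  show "0 \<le> f \<epsilon> * g \<epsilon>" if "\<epsilon> \<in> {0<..1}" for \<epsilon> using that assms by (auto simp: negligible_bound_def moderate_bound_def)
  fix k :: real assume k: "k > 0"
  obtain N C where 1: "C > 0" "\<And>\<epsilon>. \<epsilon> \<in> {0<..1} \<Longrightarrow> f \<epsilon> \<le> C / \<epsilon> ^ N" 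
    using moderate_boundE[OF assms(1)] by metis
  have "real N + k > 0" using k by simp
  then obtain C' where 2: "C' > 0" "\<And>\<epsilon>. \<epsilon> \<in> {0<..1} \<Longrightarrow> g \<epsilon> \<le> C' * \<epsilon> powr (real N + k)" 
    using negligible_boundE[OF assms(2)] by metis
  show "\<exists>C>0. \<forall>\<epsilon>\<in>{0<..1}. f \<epsilon> * g \<epsilon> \<le> C * \<epsilon> powr k"
  proof (intro exI[of _ "C * C'"] conjI ballI)
    fix \<epsilon> :: real assume e: "\<epsilon> \<in> {0<..1}"
    have "f \<epsilon> * g \<epsilon> \<le> (C / \<epsilon> ^ N) * (C' * \<epsilon> powr (real N + k))"
      using e 1(1) by (intro mult_mono 1 2 bound_nonneg(2)[OF assms(2)]) auto
    also have "\<dots> = C * C' * \<epsilon> powr k" using e by (simp add: powr_add powr_realpow)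
    finally show "f \<epsilon> * g \<epsilon> \<le> C * C' * \<epsilon> powr k" .
  qed (use 1 2 in simp)
qed

lemma moderate_norm:
  assumes "moderate X f" "\<And>g. 0 \<le> fnorm X g" shows "moderate_bound (\<lambda>\<epsilon>. fnorm X (f \<epsilon>))"
  using assms unfolding moderate_def moderate_bound_def by blast

lemma negligible_norm:
  assumes "negligible_net X f" "\<And>g. 0 \<le> fnorm X g" shows "negligible_bound (\<lambda>\<epsilon>. fnorm X (f \<epsilon>))"
  using assms unfolding negligible_net_def negligible_bound_def by blast

lemma negligible_netI:
  assumes "\<And>\<epsilon>. \<epsilon> \<in> {0<..1} \<Longrightarrow> f \<epsilon> \<in> elems X" "negligible_bound B" "\<And>\<epsilon>. \<epsilon> \<in> {0<..1} \<Longrightarrow> fnorm X (f \<epsilon>) \<le> B \<epsilon>"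
  shows "negligible_net X f"
  using assms unfolding negligible_net_def negligible_bound_def by (meson order_trans)

section \<open>Uniqueness of the very weak solution\<close>

text \<open>For each \<open>\<epsilon>\<close> the stability estimate applies with the same constant, and its right-hand side is a combination of
  negligible nets with moderate coefficients.\<close>

theorem theorem3p5:
  fixes s T :: real
    and a b u0 u1 :: "'a::euclidean_space fun_or_distr"
    and conv :: "'a net \<Rightarrow> 'a fun_or_distr \<Rightarrow> bool"
  defines "d \<equiv> real DIM('a)"
  defines "La \<equiv> inter_space (Lp (d / s)) (Lp (d / (2 * s)))"
    and "Lb \<equiv> Lp (d / s)"
  assumes "s > 0" and "d > 2 * s" and "T > 0"
    and "\<exists>a_net. approximation conv a a_net \<and> nonneg_net a_net \<and> moderate La a_net"
    and "\<exists>b_net. approximation conv b b_net \<and> nonneg_net b_net \<and> moderate Lb b_net"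
    and "\<exists>u0_net. approximation conv u0 u0_net \<and> moderate (Hs (2 * s)) u0_net"
    and "\<exists>u1_net. approximation conv u1 u1_net \<and> moderate (Hs s) u1_net"
  shows "\<forall>a_net a_net' b_net b_net' u0_net u0_net' u1_net u1_net' u u'.
    approximation conv a a_net \<and> nonneg_net a_net \<and> moderate La a_net \<longrightarrow>
    approximation conv a a_net' \<and> nonneg_net a_net' \<and> moderate La a_net' \<longrightarrow>
    approximation conv b b_net \<and> nonneg_net b_net \<and> moderate Lb b_net \<longrightarrow>
    approximation conv b b_net' \<and> nonneg_net b_net' \<and> moderate Lb b_net' \<longrightarrow>
    approximation conv u0 u0_net \<and> moderate (Hs (2 * s)) u0_net \<longrightarrow>
    approximation conv u0 u0_net' \<and> moderate (Hs (2 * s)) u0_net' \<longrightarrow>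
    approximation conv u1 u1_net \<and> moderate (Hs s) u1_net \<longrightarrow>
    approximation conv u1 u1_net' \<and> moderate (Hs s) u1_net' \<longrightarrow>
    negligible_net La (\<lambda>\<epsilon> x. a_net \<epsilon> x - a_net' \<epsilon> x) \<longrightarrow>
    negligible_net Lb (\<lambda>\<epsilon> x. b_net \<epsilon> x - b_net' \<epsilon> x) \<longrightarrow>
    negligible_net (Hs (2 * s)) (\<lambda>\<epsilon> x. u0_net \<epsilon> x - u0_net' \<epsilon> x) \<longrightarrow>
    negligible_net (Hs s) (\<lambda>\<epsilon> x. u1_net \<epsilon> x - u1_net' \<epsilon> x) \<longrightarrow>
    (\<forall>\<epsilon>\<in>{0<..1}. cauchy_solution s T (a_net \<epsilon>) (b_net \<epsilon>) (u0_net \<epsilon>) (u1_net \<epsilon>) (u \<epsilon>)) \<longrightarrow>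
    (\<forall>\<epsilon>\<in>{0<..1}. cauchy_solution s T (a_net' \<epsilon>) (b_net' \<epsilon>) (u0_net' \<epsilon>) (u1_net' \<epsilon>) (u' \<epsilon>)) \<longrightarrow>
    (\<forall>t\<in>{0..T}. negligible_net (Lp 2) (\<lambda>\<epsilon> x. u \<epsilon> t x - u' \<epsilon> t x))"
proof (intro allI impI ballI)
  fix an an' bn bn' u0n u0n' u1n u1n' :: "'a net" and u u' :: "real \<Rightarrow> real \<Rightarrow> 'a \<Rightarrow> complex" and t :: real
  assume an: "approximation conv a an \<and> nonneg_net an \<and> moderate La an"
    and an': "approximation conv a an' \<and> nonneg_net an' \<and> moderate La an'"
    and bn: "approximation conv b bn \<and> nonneg_net bn \<and> moderate Lb bn"
    and bn': "approximation conv b bn' \<and> nonneg_net bn' \<and> moderate Lb bn'"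
    and u0n: "approximation conv u0 u0n \<and> moderate (Hs (2 * s)) u0n"
    and u0n': "approximation conv u0 u0n' \<and> moderate (Hs (2 * s)) u0n'"
    and u1n: "approximation conv u1 u1n \<and> moderate (Hs s) u1n"
    and u1n': "approximation conv u1 u1n' \<and> moderate (Hs s) u1n'"
    and da: "negligible_net La (\<lambda>\<epsilon> x. an \<epsilon> x - an' \<epsilon> x)"
    and db: "negligible_net Lb (\<lambda>\<epsilon> x. bn \<epsilon> x - bn' \<epsilon> x)"
    and d0: "negligible_net (Hs (2 * s)) (\<lambda>\<epsilon> x. u0n \<epsilon> x - u0n' \<epsilon> x)"
    and d1: "negligible_net (Hs s) (\<lambda>\<epsilon> x. u1n \<epsilon> x - u1n' \<epsilon> x)"
    and sol: "\<forall>\<epsilon>\<in>{0<..1}. cauchy_solution s T (an \<epsilon>) (bn \<epsilon>) (u0n \<epsilon>) (u1n \<epsilon>) (u \<epsilon>)"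
    and sol': "\<forall>\<epsilon>\<in>{0<..1}. cauchy_solution s T (an' \<epsilon>) (bn' \<epsilon>) (u0n' \<epsilon>) (u1n' \<epsilon>) (u' \<epsilon>)"
    and t: "t \<in> {0..T}"
  obtain C where C: "sobolev_const s C TYPE('a)"
    using sobolev_const_exists[where 'a='a, OF \<open>s > 0\<close>] \<open>d > 2 * s\<close> unfolding d_def by blast
  have C0: "C > 0" using C by (simp add: sobolev_const_def)
  have pos: "0 \<le> fnorm La g" "0 \<le> fnorm Lb g" "0 \<le> fnorm (Hs \<sigma>) g" for g :: "'a \<Rightarrow> complex" and \<sigma>
    by (simp_all add: La_def Lb_def inter_space_def Lp_def Hs_norm)
  define \<alpha> \<alpha>' \<beta>' where "\<alpha> \<epsilon> = fnorm La (an \<epsilon>)" and "\<alpha>' \<epsilon> = fnorm La (an' \<epsilon>)" and "\<beta>' \<epsilon> = fnorm Lb (bn' \<epsilon>)" for \<epsilon>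
  define U0 U1 where "U0 \<epsilon> = fnorm (Hs (2 * s)) (u0n' \<epsilon>)" and "U1 \<epsilon> = fnorm (Hs s) (u1n' \<epsilon>)" for \<epsilon>
  define \<delta>0 \<delta>1 where "\<delta>0 \<epsilon> = fnorm (Hs (2 * s)) (\<lambda>x. u0n \<epsilon> x - u0n' \<epsilon> x)" and "\<delta>1 \<epsilon> = fnorm (Hs s) (\<lambda>x. u1n \<epsilon> x - u1n' \<epsilon> x)" for \<epsilon>
  define \<delta>a \<delta>b where "\<delta>a \<epsilon> = fnorm La (\<lambda>x. an \<epsilon> x - an' \<epsilon> x)" and "\<delta>b \<epsilon> = fnorm Lb (\<lambda>x. bn \<epsilon> x - bn' \<epsilon> x)" for \<epsilon>
  have mod: "moderate_bound \<alpha>" "moderate_bound \<alpha>'" "moderate_bound \<beta>'" "moderate_bound U0" "moderate_bound U1"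
    unfolding \<alpha>_def[abs_def] \<alpha>'_def[abs_def] \<beta>'_def[abs_def] U0_def[abs_def] U1_def[abs_def]
    using an an' bn' u0n' u1n' by (auto intro!: moderate_norm pos)
  have neg: "negligible_bound \<delta>0" "negligible_bound \<delta>1" "negligible_bound \<delta>a" "negligible_bound \<delta>b"
    unfolding \<delta>0_def[abs_def] \<delta>1_def[abs_def] \<delta>a_def[abs_def] \<delta>b_def[abs_def]
    using negligible_norm[OF d0 pos(3)] negligible_norm[OF d1 pos(3)] negligible_norm[OF da pos(1)] negligible_norm[OF db pos(2)] by auto
  define B where "B \<epsilon> = \<delta>0 \<epsilon> + T * ((\<delta>1 \<epsilon> + (1 + C * (1 + \<alpha> \<epsilon>)) * \<delta>0 \<epsilon>) + 
        T * ((C * (U1 \<epsilon> + (1 + C * (1 + \<alpha>' \<epsilon>)) * U0 \<epsilon>)) * \<delta>a \<epsilon> + 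
             (C * ((U0 \<epsilon> + C * \<alpha>' \<epsilon> * U0 \<epsilon> + C * \<beta>' \<epsilon> * U1 \<epsilon>) + (1 + C * (1 + \<alpha>' \<epsilon>)) * U1 \<epsilon>)) * \<delta>b \<epsilon>))" for \<epsilon>
  have B: "negligible_bound B" unfolding B_def[abs_def]
    using C0 \<open>T > 0\<close> by (intro negligible_add negligible_mult moderate_add moderate_mult moderate_const mod neg) auto
  have "(\<lambda>x. u \<epsilon> t x - u' \<epsilon> t x) \<in> L2 \<and> L2norm (\<lambda>x. u \<epsilon> t x - u' \<epsilon> t x) \<le> B \<epsilon>" if e: "\<epsilon> \<in> {0<..1}" for \<epsilon>
  proof -
    have m: "an \<epsilon> \<in> elems La" "an' \<epsilon> \<in> elems La" "(\<lambda>x. an \<epsilon> x - an' \<epsilon> x) \<in> elems La"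
      "bn \<epsilon> \<in> elems Lb" "bn' \<epsilon> \<in> elems Lb" "(\<lambda>x. bn \<epsilon> x - bn' \<epsilon> x) \<in> elems Lb"
      using an an' bn bn' da db e unfolding moderate_def negligible_net_def by blast+
    have n: "an \<epsilon> x \<in> \<real>\<^sub>\<ge>\<^sub>0" "bn \<epsilon> x \<in> \<real>\<^sub>\<ge>\<^sub>0" "an' \<epsilon> x \<in> \<real>\<^sub>\<ge>\<^sub>0" "bn' \<epsilon> x \<in> \<real>\<^sub>\<ge>\<^sub>0" for x
      using an an' bn bn' e unfolding nonneg_net_def by blast+
    have h: "u0n' \<epsilon> \<in> elems (Hs (2 * s))" "(\<lambda>x. u0n \<epsilon> x - u0n' \<epsilon> x) \<in> elems (Hs (2 * s))"
      "u1n' \<epsilon> \<in> elems (Hs s)" "(\<lambda>x. u1n \<epsilon> x - u1n' \<epsilon> x) \<in> elems (Hs s)"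
      using u0n' u1n' d0 d1 e unfolding moderate_def negligible_net_def by blast+
    note st = stability_estimate[OF \<open>s > 0\<close> \<open>T > 0\<close> C m[unfolded La_def Lb_def d_def] n h sol[rule_format, OF e] sol'[rule_format, OF e] t]
    show ?thesis
      using st(1) st(2)[folded d_def, folded La_def Lb_def, folded \<alpha>_def \<alpha>'_def \<beta>'_def U0_def U1_def \<delta>0_def \<delta>1_def \<delta>a_def \<delta>b_def]
      unfolding B_def by (simp only: mult_ac simp_thms)
  qed
  then show "negligible_net (Lp 2) (\<lambda>\<epsilon> x. u \<epsilon> t x - u' \<epsilon> t x)"
    by (intro negligible_netI[OF _ B]) auto
qed

end
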